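(* Let $\mathcal{A}$ and $\mathcal{B}$ be two locally $C^{\ast}$-algebras and $\varphi:\mathcal{A}\rightarrow\mathcal{B}$ be a linear map. Then $\varphi$ is local completely positive if and only if $\varphi$ is continuous and completely positive.
   Context: A locally $C^{\ast}$-algebra is a complete Hausdorff complex topological $\ast$-algebra $\mathcal{A}$ whose topology is determined by an upward filtered family $\{p_{\lambda}\}_{\lambda\in\Lambda}$ of $C^{\ast}$-seminorms. An element $a\in\mathcal{A}$ is positive if $a=b^{\ast}b$ for some $b\in\mathcal{A}$. Write $a\geq_{\lambda}0$ if $a=b^{\ast}b+c$ with $b,c\in\mathcal{A}$, $p_{\lambda}(c)=0$ (equivalently, the image of $a$ in the $C^{\ast}$-algebra $\mathcal{A}_\lambda=\mathcal{A}/\ker p_{\lambda}$ is positive), and $a=_{\lambda}0$ if $p_{\lambda}(a)=0$. $M_{n}(\mathcal{A})$ is a locally $C^{\ast}$-algebra with seminorms $\{p_{\lambda}^{n}\}_{\lambda\in\Lambda}$ induced by the $C^{\ast}$-norms of $M_{n}(\mathcal{A}_{\lambda})$; $\geq_{\lambda}0$ and $=_{\lambda}0$ in $M_{n}(\mathcal{A})$ refer to $p_{\lambda}^{n}$. Let $\mathcal{A},\mathcal{B}$ have defining families $\{p_{\lambda}\}_{\lambda\in\Lambda}$, $\{q_{\delta}\}_{\delta\in\Delta}$. For a linear map $\varphi:\mathcal{A}\to\mathcal{B}$, $\varphi^{(n)}:M_{n}(\mathcal{A})\to M_{n}(\mathcal{B})$ is $\varphi^{(n)}([a_{ij}])=[\varphi(a_{ij})]$.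 $\varphi$ is completely positive if for every $n\in\mathbb{N}$, $\varphi^{(n)}$ maps positive elements to positive elements. $\varphi$ is local completely positive if for each $\delta\in\Delta$ there is $\lambda\in\Lambda$ such that, for all $n\in\mathbb{N}$ and $x\in M_{n}(\mathcal{A})$, $\varphi^{(n)}(x)\geq_{\delta}0$ whenever $x\geq_{\lambda}0$, and $\varphi^{(n)}(x)=_{\delta}0$ whenever $x=_{\lambda}0$. *)

theory Defs
  imports Complex_Main "Jordan_Normal_Form.Matrix"
begin

class scaleC =
  fixes scaleC :: "complex \<Rightarrow> 'a \<Rightarrow> 'a"  (infixr "*\<^sub>C" 75)

class star =
  fixes star :: "'a \<Rightarrow> 'a"

text \<open>Associative complex algebras with an involution; no unit is assumed.\<close>

class complex_star_algebra = ring + scaleC + star +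
  assumes scaleC_add_right: "c *\<^sub>C (x + y) = c *\<^sub>C x + c *\<^sub>C y"
    and scaleC_add_left: "(c + d) *\<^sub>C x = c *\<^sub>C x + d *\<^sub>C x"
    and scaleC_scaleC: "c *\<^sub>C (d *\<^sub>C x) = (c * d) *\<^sub>C x"
    and scaleC_one: "1 *\<^sub>C x = x"
    and mult_scaleC_left: "(c *\<^sub>C x) * y = c *\<^sub>C (x * y)"
    and mult_scaleC_right: "x * (c *\<^sub>C y) = c *\<^sub>C (x * y)"
    and star_star: "star (star x) = x"
    and star_add: "star (x + y) = star x + star y"
    and star_scaleC: "star (c *\<^sub>C x) = cnj c *\<^sub>C star x"
    and star_mult: "star (x * y) = star y * star x"

definition cstar_seminorm :: "('a::complex_star_algebra \<Rightarrow> real) \<Rightarrow> bool" where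
  "cstar_seminorm p \<longleftrightarrow>
     (\<forall>x. 0 \<le> p x) \<and>
     (\<forall>x y. p (x + y) \<le> p x + p y) \<and>
     (\<forall>c x. p (c *\<^sub>C x) = cmod c * p x) \<and>
     (\<forall>x y. p (x * y) \<le> p x * p y) \<and>
     (\<forall>x. p (star x * x) = (p x)\<^sup>2)"

text \<open>The topology is carried by the type. Since the family is directed, the uniformity
  below is the translation-invariant uniformity whose topology is given by the seminorms;
  \<^const>\<open>complete\<close> refers to it. The Hausdorff property is the sort \<^class>\<open>t2_space\<close>. Continuity of
  the algebra operations and of the involution follows from the seminorm axioms.\<close>

locale locally_cstar_algebra =
  fixes L :: "'l set"
    and p :: "'l \<Rightarrow> 'a::{complex_star_algebra, uniform_space, t2_space} \<Rightarrow> real"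
  assumes index_nonempty: "L \<noteq> {}"
    and seminorms: "l \<in> L \<Longrightarrow> cstar_seminorm (p l)"
    and upward_filtered:
      "l \<in> L \<Longrightarrow> m \<in> L \<Longrightarrow> \<exists>k\<in>L. \<forall>x. p l x \<le> p k x \<and> p m x \<le> p k x"
    and uniformity_seminorms:
      "uniformity = (INF l\<in>L. INF e\<in>{0<..}. principal {(x, y). p l (x - y) < e})"
    and complete_UNIV: "complete (UNIV :: 'a set)"

definition mat_star :: "'a::complex_star_algebra mat \<Rightarrow> 'a mat" where
  "mat_star a = map_mat star (transpose_mat a)"

definition mat_positive :: "nat \<Rightarrow> 'a::complex_star_algebra mat \<Rightarrow> bool" where
  "mat_positive n x \<longleftrightarrow> (\<exists>b\<in>carrier_mat n n. x = mat_star b * b)"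

text \<open>The C*-norm of \<open>M\<^sub>n(A/ker p)\<close>, pulled back to \<open>M\<^sub>n(A)\<close>: a matrix acts on the Hilbert
  module \<open>(A/ker p)\<^sup>n\<close>, whose norm is the root of the norm of \<open>\<Sum>\<^sub>j x\<^sub>j\<^sup>* x\<^sub>j\<close>, and its C*-norm is
  the operator norm of this action. The supremum is finite whenever \<open>p\<close> is one of the defining
  seminorms of a locally C*-algebra.\<close>

definition vec_seminorm :: "('a::complex_star_algebra \<Rightarrow> real) \<Rightarrow> 'a vec \<Rightarrow> real" where
  "vec_seminorm p v = sqrt (p (map_vec star v \<bullet> v))"

definition mat_seminorm :: "('a::complex_star_algebra \<Rightarrow> real) \<Rightarrow> nat \<Rightarrow> 'a mat \<Rightarrow> real" where
  "mat_seminorm p n a =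
     (SUP v\<in>{v \<in> carrier_vec n. vec_seminorm p v \<le> 1}. vec_seminorm p (a *\<^sub>v v))"

definition mat_zero_wrt :: "('a::complex_star_algebra \<Rightarrow> real) \<Rightarrow> nat \<Rightarrow> 'a mat \<Rightarrow> bool" where
  "mat_zero_wrt p n x \<longleftrightarrow> mat_seminorm p n x = 0"

definition mat_positive_wrt :: "('a::complex_star_algebra \<Rightarrow> real) \<Rightarrow> nat \<Rightarrow> 'a mat \<Rightarrow> bool" where
  "mat_positive_wrt p n x \<longleftrightarrow>
     (\<exists>b\<in>carrier_mat n n. \<exists>c\<in>carrier_mat n n. x = mat_star b * b + c \<and> mat_seminorm p n c = 0)"

text \<open>The amplification of \<open>f\<close> to matrices is \<^term>\<open>map_mat f\<close>.\<close>

definition completely_positive ::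
    "('a::complex_star_algebra \<Rightarrow> 'b::complex_star_algebra) \<Rightarrow> bool" where
  "completely_positive f \<longleftrightarrow>
     (\<forall>n\<ge>1. \<forall>x\<in>carrier_mat n n. mat_positive n x \<longrightarrow> mat_positive n (map_mat f x))"

definition local_completely_positive ::
    "'l set \<Rightarrow> ('l \<Rightarrow> 'a::complex_star_algebra \<Rightarrow> real) \<Rightarrow>
     'd set \<Rightarrow> ('d \<Rightarrow> 'b::complex_star_algebra \<Rightarrow> real) \<Rightarrow> ('a \<Rightarrow> 'b) \<Rightarrow> bool" where
  "local_completely_positive L p D q f \<longleftrightarrow>
     (\<forall>d\<in>D. \<exists>l\<in>L. \<forall>n\<ge>1. \<forall>x\<in>carrier_mat n n.
        (mat_positive_wrt (p l) n x \<longrightarrow> mat_positive_wrt (q d) n (map_mat f x)) \<and>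
        (mat_zero_wrt (p l) n x \<longrightarrow> mat_zero_wrt (q d) n (map_mat f x)))"

end

theory Submission
  imports Defs
begin

text \<open>
  Everything rests on three facts about C*-seminorms, which follow from norm estimates in the
  possibly incomplete algebra itself, without spectral theory. (1) Elements \<open>b\<^sup>* b\<close> are positive and
  seminorms are monotone on positive elements. (2) In a complete star algebra an element that is
  positive for every defining seminorm is a square; applied to \<open>M\<^sub>n(B)\<close> this turns local positivity
  for all indices into positivity. (3) A linear map that is positive modulo null elements is bounded
  by a gliding hump: elements of \<open>A\<close> that are bounded for one seminorm are first truncated so that
  they are bounded for all of them at once, which makes the hump series converge in \<open>A\<close>.
  Conversely, continuity gives \<open>q\<^sub>d (\<phi> a) = 0\<close> whenever \<open>p\<^sub>l a = 0\<close> for a suitable \<open>l\<close>, and complete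
  positivity does the rest.
\<close>

section \<open>Star algebras and C*-seminorms\<close>

text \<open>The algebras may lack a unit and no quotient \<open>A/ker p\<close> is formed, so a
  seminorm may have a kernel and need not be complete. Positivity is an estimate on
  \<open>s - x\<close> and needs scalars; hence the theory is developed for algebras with unit and
  carried to the others by adjoining one. The delicate point is that \<open>star b * b\<close> is
  positive: the usual argument splits it into positive and negative parts, which takes functional
  calculus in a complete algebra. Estimates on powers replace it, with dyadic exponents in the role
  of the spectral radius formula. The family of seminorms may be uncountable, yet sequential
  completeness suffices, because the approximate roots and the hump series are Cauchy for all
  seminorms at once. Continuity is extracted from 1 by 1 matrices, complete positivity from matrices
  of every size. In the converse direction one index has to serve all sizes; this works because a
  matrix is null exactly when its entries are.\<close>

lemma scaleC_zero_left [simp]: "0 *\<^sub>C (x::'a::complex_star_algebra) = 0"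
  using scaleC_add_left[of 0 0 x] by simp

lemma scaleC_zero_right [simp]: "c *\<^sub>C (0::'a::complex_star_algebra) = 0"
  using scaleC_add_right[of c 0 "0::'a"] by simp

lemma scaleC_minus_right [simp]: "c *\<^sub>C (- x) = - (c *\<^sub>C (x::'a::complex_star_algebra))"
  using scaleC_add_right[of c x "- x"] by (simp add: eq_neg_iff_add_eq_0 add.commute)

lemma scaleC_minus_left [simp]: "(- c) *\<^sub>C x = - (c *\<^sub>C (x::'a::complex_star_algebra))"
  using scaleC_add_left[of c "- c" x] by (simp add: eq_neg_iff_add_eq_0 add.commute)

lemma scaleC_diff_right: "c *\<^sub>C (x - y) = c *\<^sub>C x - c *\<^sub>C (y::'a::complex_star_algebra)"
  using scaleC_add_right[of c x "- y"] by simp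

lemma scaleC_sum_right: "c *\<^sub>C sum f A = (\<Sum>i\<in>A. c *\<^sub>C (f i :: 'a::complex_star_algebra))"
  by (induction A rule: infinite_finite_induct) (simp_all add: scaleC_add_right)

lemma star_zero [simp]: "star (0::'a::complex_star_algebra) = 0"
  using star_add[of 0 "0::'a"] by simp

lemma star_minus [simp]: "star (- x) = - star (x::'a::complex_star_algebra)"
  using star_add[of x "- x"] by (simp add: eq_neg_iff_add_eq_0 add.commute)

lemma star_diff: "star (x - y) = star x - star (y::'a::complex_star_algebra)"
  using star_add[of x "- y"] by simp

lemma star_sum: "star (sum f A) = (\<Sum>i\<in>A. star (f i :: 'a::complex_star_algebra))"
  by (induction A rule: infinite_finite_induct) (simp_all add: star_add)

declare star_star [simp]

section \<open>C*-seminorms on algebras without unit\<close>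

locale cstar_seminormed =
  fixes p :: "'a::complex_star_algebra \<Rightarrow> real"
  assumes cstar_seminorm: "cstar_seminorm p"
begin

lemma nonneg [simp]: "0 \<le> p x"
  and triangle: "p (x + y) \<le> p x + p y"
  and scale: "p (c *\<^sub>C x) = cmod c * p x"
  and submult: "p (x * y) \<le> p x * p y"
  and cstar: "p (star x * x) = (p x)\<^sup>2"
  using cstar_seminorm unfolding cstar_seminorm_def by blast+

lemma zero [simp]: "p 0 = 0"
  using scale[of 0 0] by simp

lemma minus [simp]: "p (- x) = p x"
  using scale[of "-1" x] by (simp add: scaleC_one)

lemma triangle_diff: "p (x - y) \<le> p x + p y"
  using triangle[of x "- y"] by simp

lemma minus_commute: "p (x - y) = p (y - x)"
  using minus[of "x - y"] by simp

lemma diff_bound: "p x \<le> p y + p (x - y)"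
  using triangle[of y "x - y"] by simp

lemma sum_bound: "p (sum f A) \<le> (\<Sum>i\<in>A. p (f i))"
proof (induction A rule: infinite_finite_induct)
  case (insert a A)
  then show ?case using triangle[of "f a" "sum f A"] by simp
qed simp_all

lemma star [simp]: "p (star x) = p x"
proof -
  have *: "p x \<le> p (star x)" for x
  proof (cases "p x = 0")
    case False
    then have "p x > 0" using nonneg[of x] by linarith
    moreover have "p x * p x \<le> p (star x) * p x"
      using submult[of "star x" x] cstar[of x] by (simp add: power2_eq_square)
    ultimately show ?thesis by simp
  qed simp
  show ?thesis using *[of x] *[of "star x"] by simp
qed

lemma cstar': "p (x * star x) = (p x)\<^sup>2"
  using cstar[of "star x"] by simp

lemma mult_le: "p x \<le> a \<Longrightarrow> p y \<le> b \<Longrightarrow> p (x * y) \<le> a * b"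
  by (meson nonneg mult_mono order_trans submult)

lemma eq_mod_null: "p (x - y) = 0 \<Longrightarrow> p x = p y"
  using diff_bound[of x y] diff_bound[of y x] by (simp add: minus_commute)

end

text \<open>Positivity is phrased with scalars \<open>of_real s\<close>, so the unital theory is
  built on \<open>real_algebra_1\<close>, with real scaling tied to complex scaling. The instance to
  which it is applied is the unitization.\<close>

class complex_star_algebra_1 = complex_star_algebra + real_algebra_1 +
  assumes scaleR_scaleC: "r *\<^sub>R x = complex_of_real r *\<^sub>C x"

lemma star_one [simp]: "star (1::'a::complex_star_algebra_1) = 1"
  by (metis mult_1_left mult_1_right star_mult star_star)

lemma star_scaleR [simp]: "star (r *\<^sub>R x) = r *\<^sub>R star (x::'a::complex_star_algebra_1)"
  by (simp add: scaleR_scaleC star_scaleC)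

lemma star_of_real [simp]: "star (of_real r) = (of_real r :: 'a::complex_star_algebra_1)"
  by (simp add: of_real_def)

lemma star_power: "star (x ^ n) = star (x::'a::complex_star_algebra_1) ^ n"
  by (induction n) (simp_all add: star_mult power_commutes)

locale cstar_seminormed_1 = cstar_seminormed p
  for p :: "'a::complex_star_algebra_1 \<Rightarrow> real"
begin

lemma scaleR: "p (r *\<^sub>R x) = \<bar>r\<bar> * p x"
  by (simp add: scaleR_scaleC scale)

text \<open>By the C*-identity \<open>p 1\<close> equals its own square, so it is \<open>0\<close>
  or \<open>1\<close>; the value \<open>0\<close> does occur, for the zero seminorm.\<close>

lemma one_le: "p 1 \<le> 1"
proof -
  have "p 1 * p 1 = p 1 * 1" using cstar[of 1] by (simp add: power2_eq_square)
  then show ?thesis by (metis mult_cancel_left nle_le zero_le_one)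
qed

lemma of_real_le: "p (of_real r) \<le> \<bar>r\<bar>"
  using mult_left_mono[OF one_le, of "\<bar>r\<bar>"] by (simp add: of_real_def scaleR)

lemma power_le: "p (x ^ n) \<le> p x ^ n"
proof (induction n)
  case 0 show ?case using one_le by simp
next
  case (Suc n)
  then show ?case using mult_le[of x "p x" "x ^ n" "p x ^ n"] by simp
qed

lemma selfadjoint_square: "star x = x \<Longrightarrow> p (x * x) = (p x)\<^sup>2"
  using cstar[of x] by simp

text \<open>Dyadic exponents are those reached by iterating the C*-identity. They are enough to
  compare growth rates of powers.\<close>

lemma selfadjoint_power: "star x = x \<Longrightarrow> p (x ^ 2 ^ j) = p x ^ 2 ^ j"
proof (induction j)
  case (Suc j)
  have "p (x ^ 2 ^ j * x ^ 2 ^ j) = (p (x ^ 2 ^ j))\<^sup>2"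
    by (rule selfadjoint_square) (simp add: star_power Suc.prems)
  then show ?case using Suc by (simp add: power_mult mult.commute power2_eq_square flip: power_add mult_2)
qed simp

text \<open>The norms of \<open>g \<plusminus> \<i>h\<close> are both the root of that of \<open>g\<^sup>2 + h\<^sup>2\<close>, and \<open>g\<close> is their mean.\<close>

lemma commuting_square_le:
  assumes "star g = g" "star h = h" "g * h = h * g"
  shows "(p g)\<^sup>2 \<le> p (g * g + h * h)"
proof -
  let ?i = "\<lambda>x. \<i> *\<^sub>C x"
  have ii: "?i (?i x) = - x" for x :: 'a
    by (simp add: scaleC_scaleC) (metis scaleC_minus_left scaleC_one)
  have s1: "star (g + ?i h) = g - ?i h" "star (g - ?i h) = g + ?i h"
    by (simp_all add: star_add star_diff star_scaleC assms)
  have "p (g + ?i h) ^ 2 = p ((g - ?i h) * (g + ?i h))"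
    using cstar[of "g + ?i h"] s1 by simp
  also have "(g - ?i h) * (g + ?i h) = g * g + h * h"
    by (simp add: algebra_simps mult_scaleC_left mult_scaleC_right scaleC_diff_right scaleC_add_right ii assms)
  finally have a: "p (g + ?i h) ^ 2 = p (g * g + h * h)" .
  have "p (g - ?i h) ^ 2 = p ((g + ?i h) * (g - ?i h))"
    using cstar[of "g - ?i h"] s1 by simp
  also have "(g + ?i h) * (g - ?i h) = g * g + h * h"
    by (simp add: algebra_simps mult_scaleC_left mult_scaleC_right scaleC_diff_right scaleC_add_right ii assms)
  finally have b: "p (g - ?i h) = p (g + ?i h)"
    using a by (intro power2_eq_imp_eq[OF _ nonneg nonneg]) simp
  have "2 *\<^sub>R g = (g + ?i h) + (g - ?i h)" by (simp add: scaleR_2)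
  then have "2 * p g \<le> p (g + ?i h) + p (g - ?i h)"
    using triangle[of "g + ?i h" "g - ?i h"] scaleR[of 2 g] by simp
  then have "p g \<le> p (g + ?i h)" using b by simp
  then have "(p g)\<^sup>2 \<le> (p (g + ?i h))\<^sup>2" by (rule power_mono) simp
  then show ?thesis by (simp only: a)
qed

section \<open>The positive cone of a C*-seminorm\<close>

text \<open>In the completion of the quotient this says that the spectrum of \<open>x\<close> is nonnegative.\<close>

definition pos :: "'a \<Rightarrow> bool" where
  "pos x \<longleftrightarrow> star x = x \<and> (\<forall>e>0. \<exists>s>0. p (of_real s - x) \<le> s + e)"

lemma posD: "pos x \<Longrightarrow> star x = x"
  by (simp add: pos_def)

text \<open>Adding \<open>\<bar>t\<bar>\<close> to a witness raises the left side by at most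
  \<open>\<bar>t\<bar>\<close> and the right side by exactly that, so witnesses can be taken
  arbitrarily large.\<close>

lemma posE:
  assumes "pos x" "e > 0"
  obtains s where "s > 0" "s \<ge> t" "p (of_real s - x) \<le> s + e"
proof -
  obtain s where s: "s > 0" "p (of_real s - x) \<le> s + e"
    using assms pos_def by blast
  have "p (of_real (s + \<bar>t\<bar>) - x) \<le> s + \<bar>t\<bar> + e"
    using triangle[of "of_real s - x" "of_real \<bar>t\<bar>"] of_real_le[of "\<bar>t\<bar>"] s
    by (simp add: algebra_simps)
  then show ?thesis using that[of "s + \<bar>t\<bar>"] s by simp
qed

lemma pos_closed:
  assumes "star x = x" "\<And>e. e > 0 \<Longrightarrow> \<exists>y. pos y \<and> p (x - y) \<le> e"
  shows "pos x"
  unfolding pos_def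
proof (intro conjI allI impI assms(1))
  fix e :: real assume "e > 0"
  then obtain y where y: "pos y" "p (x - y) \<le> e/2" using assms(2)[of "e/2"] by auto
  obtain s where s: "s > 0" "p (of_real s - y) \<le> s + e/2"
    using posE[OF y(1), of "e/2" 0] \<open>e > 0\<close> by auto
  have "p (of_real s - x) \<le> s + e"
    using triangle_diff[of "of_real s - y" "x - y"] s y by simp
  then show "\<exists>s>0. p (of_real s - x) \<le> s + e" using s by blast
qed

lemma pos_limit:
  assumes "star x = x" "\<And>n. pos (f n)" "(\<lambda>n. p (x - f n)) \<longlonglongrightarrow> 0"
  shows "pos x"
proof (rule pos_closed[OF assms(1)])
  fix e :: real assume "e > 0"
  then have "\<forall>\<^sub>F n in sequentially. p (x - f n) < e"
    using order_tendstoD(2)[OF assms(3)] by simp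
  then obtain n where "p (x - f n) < e" by (meson eventually_happens sequentially_bot)
  then show "\<exists>y. pos y \<and> p (x - y) \<le> e" using assms(2) by (meson less_imp_le)
qed

lemma pos_null: "star x = x \<Longrightarrow> pos y \<Longrightarrow> p (x - y) = 0 \<Longrightarrow> pos x"
  by (rule pos_closed) (auto intro: exI[of _ y])

lemma pos_add: assumes "pos x" "pos y" shows "pos (x + y)"
  unfolding pos_def
proof (intro conjI allI impI)
  show "star (x + y) = x + y" using assms by (simp add: star_add posD)
  fix e :: real assume "e > 0"
  obtain s where s: "s > 0" "p (of_real s - x) \<le> s + e/2"
    using posE[OF assms(1), of "e/2" 0] \<open>e > 0\<close> by auto
  obtain t where t: "t > 0" "p (of_real t - y) \<le> t + e/2"
    using posE[OF assms(2), of "e/2" 0] \<open>e > 0\<close> by auto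
  have "p (of_real (s + t) - (x + y)) \<le> s + t + e"
    using triangle[of "of_real s - x" "of_real t - y"] s t by (simp add: algebra_simps)
  then show "\<exists>s>0. p (of_real s - (x + y)) \<le> s + e" using s t by (meson add_pos_pos)
qed

lemma pos_sub_bound:
  assumes "star x = x" "p x \<le> c" shows "pos (of_real c - x)"
  unfolding pos_def
proof (intro conjI allI impI)
  show "star (of_real c - x) = of_real c - x" using assms by (simp add: star_diff)
  fix e :: real assume "e > 0"
  have "c \<ge> 0" using assms nonneg[of x] by linarith
  \<comment> \<open>The witness is \<open>c + 1\<close> because \<open>c\<close> may be
    \<open>0\<close> while a witness has to be positive; the argument of \<open>p\<close> is then
    \<open>1 + x\<close>.\<close>
  have "p (of_real (c + 1) - (of_real c - x)) \<le> c + 1 + e"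
    using triangle[of 1 x] one_le assms \<open>e > 0\<close> by simp
  then show "\<exists>s>0. p (of_real s - (of_real c - x)) \<le> s + e"
    using \<open>c \<ge> 0\<close> by (intro exI[of _ "c + 1"]) simp
qed

lemma pos_add_bound: "star x = x \<Longrightarrow> p x \<le> c \<Longrightarrow> pos (of_real c + x)"
  using pos_sub_bound[of "- x" c] by simp

lemma pos_zero [simp]: "pos 0"
  using pos_sub_bound[of 0 0] by simp

lemma pos_of_real: "0 \<le> r \<Longrightarrow> pos (of_real r)"
  using pos_sub_bound[of 0 r] by simp

lemma pos_one: "pos 1"
  using pos_of_real[of 1] by simp

lemma pos_scaleR: assumes "pos x" "0 \<le> r" shows "pos (r *\<^sub>R x)"
proof (cases "r = 0")
  case False
  with assms have r: "r > 0" by simp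
  show ?thesis unfolding pos_def
  proof (intro conjI allI impI)
    show "star (r *\<^sub>R x) = r *\<^sub>R x" using assms by (simp add: posD)
    fix e :: real assume "e > 0"
    then obtain s where s: "s > 0" "p (of_real s - x) \<le> s + e / r"
      using posE[OF assms(1), of "e / r" 0] r by auto
    have "p (of_real (r * s) - r *\<^sub>R x) = r * p (of_real s - x)"
      using scaleR[of r "of_real s - x"] r by (simp add: algebra_simps scaleR_conv_of_real)
    also have "\<dots> \<le> r * s + e" using mult_left_mono[OF s(2), of r] r by (simp add: distrib_left)
    finally show "\<exists>s>0. p (of_real s - r *\<^sub>R x) \<le> s + e"
      using r s by (intro exI[of _ "r * s"]) simp
  qed
qed simp

lemma pos_sum: "(\<And>i. i \<in> A \<Longrightarrow> pos (f i)) \<Longrightarrow> pos (sum f A)"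
  by (induction A rule: infinite_finite_induct) (auto intro: pos_add)

text \<open>With \<open>g = 1 - d h\<^sup>2\<close> and \<open>k = (2d)\<^bsup>1/2\<^esup> h\<close> one has \<open>g\<^sup>2 + k\<^sup>2 = 1 + d\<^sup>2 h\<^sup>4\<close>: the
  first-order Taylor polynomial of a unitary.\<close>

lemma pos_square:
  assumes "star h = h" shows "pos (h * h)"
  unfolding pos_def
proof (intro conjI allI impI)
  show "star (h * h) = h * h" by (simp add: star_mult assms)
  fix e :: real assume "e > 0"
  define c where "c = (p h)^4"
  have c: "c \<ge> 0" by (simp add: c_def)
  \<comment> \<open>This \<open>d\<close> makes the second-order term \<open>d\<^sup>2 * c\<close>
    at most \<open>d * e\<close>. Dividing the resulting bound \<open>1 + d * e\<close> by
    \<open>d\<close> gives the witness \<open>1 / d\<close> with error \<open>e\<close>.\<close>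
  define d where "d = e / (1 + c)"
  have d: "d > 0" "d * c \<le> e" using c \<open>e > 0\<close>
    by (auto simp: d_def field_simps)
  let ?g = "1 - d *\<^sub>R (h * h)" and ?k = "sqrt (2 * d) *\<^sub>R h"
  have "(p ?g)\<^sup>2 \<le> p (?g * ?g + ?k * ?k)"
    by (rule commuting_square_le) (simp_all add: star_diff star_mult assms algebra_simps)
  also have "?k * ?k = 2 *\<^sub>R (d *\<^sub>R (h * h))" using d by simp
  also have "?g * ?g + 2 *\<^sub>R (d *\<^sub>R (h * h)) = 1 + (d\<^sup>2) *\<^sub>R (h * h * h * h)"
    by (simp add: algebra_simps power2_eq_square scaleR_2 del: scaleR_scaleR) (simp add: mult.assoc)
  also have "p \<dots> \<le> 1 + d\<^sup>2 * c"
  proof -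
    have "p (h * h * h * h) \<le> c"
      using power_le[of h 4] by (simp add: c_def numeral_eq_Suc mult.assoc)
    then show ?thesis
      using triangle[of 1 "(d\<^sup>2) *\<^sub>R (h * h * h * h)"] one_le
      by (simp add: scaleR) (smt (verit) mult_left_mono zero_le_power2)
  qed
  also have "\<dots> \<le> (1 + d * e)\<^sup>2"
  proof -
    have "d\<^sup>2 * c \<le> d * e" using d by (simp add: power2_eq_square)
    moreover have "(1 + d * e)\<^sup>2 = 1 + 2 * (d * e) + (d * e)\<^sup>2" by (simp add: power2_sum)
    moreover have "0 < d * e" using d \<open>e > 0\<close> by simp
    ultimately show ?thesis using zero_le_power2[of "d * e"] by linarith
  qed
  finally have g: "p ?g \<le> 1 + d * e" using d \<open>e > 0\<close> by (simp add: power2_le_iff_abs_le)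
  have "of_real (1 / d) - h * h = (1 / d) *\<^sub>R ?g"
    using d by (simp add: algebra_simps of_real_def)
  then have "p (of_real (1 / d) - h * h) = p ?g / d"
    using d scaleR[of "1 / d" ?g] by simp
  also have "\<dots> \<le> 1 / d + e" using g d by (simp add: field_simps)
  finally show "\<exists>s>0. p (of_real s - h * h) \<le> s + e"
    using d by (intro exI[of _ "1 / d"]) simp
qed

end

section \<open>Approximate square roots\<close>

text \<open>\<open>1 - sqrt_defect z n\<close> approximates the square root of \<open>1 - z\<close>. As the coefficients in \<open>z\<close>
  are nonnegative, the scalar iteration at \<open>z = 1\<close> is a majorant.\<close>

fun sqrt_defect :: "'a::complex_star_algebra_1 \<Rightarrow> nat \<Rightarrow> 'a" where
  "sqrt_defect z 0 = 0"
| "sqrt_defect z (Suc n) = (1/2) *\<^sub>R (z + sqrt_defect z n * sqrt_defect z n)"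

declare sqrt_defect.simps(2) [simp del]

fun sqrt_majorant :: "nat \<Rightarrow> real" where
  "sqrt_majorant 0 = 0"
| "sqrt_majorant (Suc n) = (1 + (sqrt_majorant n)\<^sup>2) / 2"

declare sqrt_majorant.simps(2) [simp del]

lemma sqrt_majorant_bounds: "0 \<le> sqrt_majorant n \<and> sqrt_majorant n \<le> 1"
proof (induction n)
  case (Suc n)
  then have "(sqrt_majorant n)\<^sup>2 \<le> 1" by (simp add: power_le_one)
  then show ?case by (simp add: sqrt_majorant.simps)
qed simp

lemma sqrt_majorant_mono: "sqrt_majorant n \<le> sqrt_majorant (Suc n)"
  using zero_le_power2[of "1 - sqrt_majorant n"]
  by (simp add: sqrt_majorant.simps power2_eq_square algebra_simps)

text \<open>By \<open>sqrt_defect_error\<close> the residual of an approximate root is, up to sign,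
  twice an increment of the iteration. What the majorant has to provide is therefore that its
  increments vanish, which follows from monotonicity and boundedness.\<close>

lemma sqrt_majorant_increment: "(\<lambda>n. sqrt_majorant (Suc n) - sqrt_majorant n) \<longlonglongrightarrow> 0"
proof -
  have "incseq sqrt_majorant" by (rule incseq_SucI) (rule sqrt_majorant_mono)
  then obtain l where l: "sqrt_majorant \<longlonglongrightarrow> l"
    using incseq_convergent[of sqrt_majorant 1] sqrt_majorant_bounds by blast
  have "(\<lambda>n. sqrt_majorant (Suc n) - sqrt_majorant n) \<longlonglongrightarrow> l - l"
    using l by (intro tendsto_diff) (rule LIMSEQ_Suc)
  then show ?thesis by simp
qed

lemma sqrt_defect_commute: "y * z = z * y \<Longrightarrow> y * sqrt_defect z n = sqrt_defect z n * y"
proof (induction n)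
  case (Suc n)
  then have "y * (sqrt_defect z n * sqrt_defect z n) = (sqrt_defect z n * sqrt_defect z n) * y"
    by (metis mult.assoc)
  then show ?case using Suc by (simp add: sqrt_defect.simps algebra_simps)
qed simp

lemma star_sqrt_defect: "star z = z \<Longrightarrow> star (sqrt_defect z n) = sqrt_defect z n"
  by (induction n) (simp_all add: star_add star_mult sqrt_defect.simps)

lemma sqrt_defect_error:
  "(1 - z) - (1 - sqrt_defect z n) * (1 - sqrt_defect z n) =
     (-2) *\<^sub>R (sqrt_defect z (Suc n) - sqrt_defect z n)"
  by (simp add: sqrt_defect.simps algebra_simps scaleR_2)

context cstar_seminormed_1
begin

text \<open>Successive iterates commute, so the next increment is half the product of the last
  difference and the sum of the last two iterates; the scalar iteration obeys the same identity. The
  bound on an iterate comes from the bound on its increment and conversely, hence the joint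
  induction.\<close>

lemma sqrt_defect_bound:
  assumes "p z \<le> 1"
  shows "p (sqrt_defect z n) \<le> sqrt_majorant n \<and>
         p (sqrt_defect z (Suc n) - sqrt_defect z n) \<le> sqrt_majorant (Suc n) - sqrt_majorant n"
proof (induction n)
  case 0
  then show ?case using assms by (simp add: scaleR sqrt_defect.simps sqrt_majorant.simps)
next
  case (Suc n)
  let ?e = "sqrt_defect z" and ?E = "sqrt_majorant"
  have a: "p (?e (Suc n)) \<le> ?E (Suc n)"
    using diff_bound[of "?e (Suc n)" "?e n"] Suc by linarith
  have cm: "?e n * ?e (Suc n) = ?e (Suc n) * ?e n"
    by (intro sqrt_defect_commute sqrt_defect_commute[symmetric] refl)
  have "?e (Suc (Suc n)) - ?e (Suc n) = (1/2) *\<^sub>R ((?e (Suc n) - ?e n) * (?e (Suc n) + ?e n))"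
  proof -
    have "(?e (Suc n) - ?e n) * (?e (Suc n) + ?e n) = ?e (Suc n) * ?e (Suc n) - ?e n * ?e n"
      using cm by (simp add: algebra_simps)
    then show ?thesis by (subst (1 2) sqrt_defect.simps(2)) (simp flip: scaleR_diff_right)
  qed
  then have "p (?e (Suc (Suc n)) - ?e (Suc n))
      = (1/2) * p ((?e (Suc n) - ?e n) * (?e (Suc n) + ?e n))" by (simp add: scaleR)
  also have "\<dots> \<le> (1/2) * ((?E (Suc n) - ?E n) * (?E (Suc n) + ?E n))"
    using Suc a triangle[of "?e (Suc n)" "?e n"] by (intro mult_left_mono mult_le) auto
  also have "\<dots> = ?E (Suc (Suc n)) - ?E (Suc n)"
    by (subst (3 4) sqrt_majorant.simps(2)) (simp add: power2_eq_square field_simps)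
  finally show ?case using a by blast
qed

lemma pos_one_minus_sqrt_defect:
  assumes "star z = z" "p z \<le> 1" shows "pos (1 - sqrt_defect z n)"
  using pos_sub_bound[of "sqrt_defect z n" 1] star_sqrt_defect[OF assms(1)]
    sqrt_defect_bound[OF assms(2), of n] sqrt_majorant_bounds[of n] by fastforce

lemma sqrt_defect_error_bound:
  assumes "p z \<le> 1"
  shows "p ((1 - z) - (1 - sqrt_defect z n) * (1 - sqrt_defect z n)) \<le>
           2 * (sqrt_majorant (Suc n) - sqrt_majorant n)"
  using sqrt_defect_bound[OF assms, of n] unfolding sqrt_defect_error scaleR by simp

text \<open>The root is a polynomial in \<open>y\<close>, so it commutes with whatever commutes with
  \<open>y\<close>. In an algebra that may be incomplete the iteration is stopped at a finite stage,
  which leaves an error.\<close>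

lemma approx_sqrt:
  assumes "pos y" "e > 0"
  obtains g where "pos g" "p (y - g * g) \<le> e" "\<And>z. z * y = y * z \<Longrightarrow> z * g = g * z"
proof -
  obtain s0 where s0: "s0 > 0" "p (of_real s0 - y) \<le> s0 + e/2"
    using posE[OF assms(1), of "e/2" 0] assms(2) by auto
  \<comment> \<open>Positivity only bounds \<open>s0 - y\<close> by \<open>s0 + e/2\<close>.
    Shifting both \<open>s0\<close> and \<open>y\<close> by \<open>e/2\<close> leaves the difference
    unchanged and removes the excess, so \<open>z\<close> has seminorm at most \<open>1\<close>. The
    shift costs half of the admissible error, the iteration the other half.\<close>
  define s where "s = s0 + e/2"
  have s: "s > 0" "p (of_real s - (y + of_real (e/2))) \<le> s"
    using s0 assms by (simp_all add: s_def algebra_simps)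
  define z where "z = 1 - (1/s) *\<^sub>R (y + of_real (e/2))"
  have "z = (1/s) *\<^sub>R (of_real s - (y + of_real (e/2)))"
    using s by (simp add: z_def algebra_simps of_real_def)
  then have "p z = (1/s) * p (of_real s - (y + of_real (e/2)))"
    using s by (simp only: scaleR) simp
  then have z: "p z \<le> 1" using s by simp
  have zs: "star z = z" using assms by (simp add: z_def star_diff star_add posD)
  have "(\<lambda>n. 2 * (sqrt_majorant (Suc n) - sqrt_majorant n)) \<longlonglongrightarrow> 0"
    by (rule tendsto_mult_right_zero[OF sqrt_majorant_increment])
  moreover have "0 < e / (2 * s)" using s(1) assms(2) by simp
  ultimately have "\<forall>\<^sub>F n in sequentially. 2 * (sqrt_majorant (Suc n) - sqrt_majorant n) < e / (2 * s)"
    by (rule order_tendstoD(2))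
  then obtain n where n: "2 * (sqrt_majorant (Suc n) - sqrt_majorant n) < e / (2 * s)"
    by (meson eventually_happens sequentially_bot)
  define h where "h = 1 - sqrt_defect z n"
  define g where "g = sqrt s *\<^sub>R h"
  have 1: "pos g" unfolding g_def h_def
    using pos_one_minus_sqrt_defect[OF zs z] s by (intro pos_scaleR) simp_all
  have "y + of_real (e/2) - g * g = s *\<^sub>R ((1 - z) - h * h)"
    using s by (simp add: g_def z_def algebra_simps)
  then have "p (y + of_real (e/2) - g * g) = s * p ((1 - z) - h * h)"
    using s scaleR[of s "(1 - z) - h * h"] by simp
  also have "\<dots> \<le> s * (e / (2 * s))"
    using sqrt_defect_error_bound[OF z, of n] n s unfolding h_def
    by (intro mult_left_mono) simp_all
  also have "\<dots> = e/2" using s by simp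
  finally have "p (y - g * g) \<le> e"
    using triangle_diff[of "y + of_real (e/2) - g * g" "of_real (e/2)"] of_real_le[of "e/2"] assms(2)
    by simp
  moreover have "x * g = g * x" if "x * y = y * x" for x
  proof -
    have "x * z = z * x" using that by (simp add: z_def algebra_simps of_real_def)
    then show ?thesis by (simp add: g_def h_def algebra_simps sqrt_defect_commute)
  qed
  ultimately show ?thesis using that 1 by blast
qed

text \<open>For commuting approximate roots \<open>g\<close> and \<open>h\<close> the product is
  close to the square of the self-adjoint \<open>g * h\<close>. The tolerance for \<open>h\<close>
  is fixed after \<open>g\<close>, because its error gets multiplied by
  \<open>p (g * g)\<close>.\<close>

lemma pos_mult_commuting:
  assumes "pos x" "pos y" "x * y = y * x" shows "pos (x * y)"
proof (rule pos_closed)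
  show "star (x * y) = x * y" using assms by (simp add: star_mult posD)
  fix e :: real assume "e > 0"
  define d where "d = e / 2 / (p y + 1)"
  have yp: "p y + 1 > 0" using nonneg[of y] by linarith
  have d: "d > 0" "d * p y \<le> e/2" using \<open>e > 0\<close> yp by (auto simp: d_def field_simps)
  obtain g where g: "pos g" "p (x - g * g) \<le> d" "\<And>z. z * x = x * z \<Longrightarrow> z * g = g * z"
    using approx_sqrt[OF assms(1) d(1)] by blast
  define c where "c = e / 2 / (p (g * g) + 1)"
  have gp: "p (g * g) + 1 > 0" using nonneg[of "g * g"] by linarith
  have c: "c > 0" "p (g * g) * c \<le> e/2" using \<open>e > 0\<close> gp by (auto simp: c_def field_simps)
  obtain h where h: "pos h" "p (y - h * h) \<le> c" "\<And>z. z * y = y * z \<Longrightarrow> z * h = h * z"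
    using approx_sqrt[OF assms(2) c(1)] by blast
  have gh: "g * h = h * g" using g(3)[of y] h(3)[of g] assms(3) by metis
  have "pos ((g * h) * (g * h))"
    by (intro pos_square) (simp add: star_mult posD[OF g(1)] posD[OF h(1)] gh)
  moreover have "p (x * y - (g * h) * (g * h)) \<le> e"
  proof -
    have "(g * h) * (g * h) = (g * g) * (h * h)" using gh by (metis mult.assoc)
    then have "x * y - (g * h) * (g * h) = (x - g * g) * y + (g * g) * (y - h * h)"
      by (simp add: algebra_simps)
    then have "p (x * y - (g * h) * (g * h)) \<le> p ((x - g * g) * y) + p ((g * g) * (y - h * h))"
      by (simp only: triangle)
    moreover have "p ((x - g * g) * y) \<le> d * p y" using g(2) by (intro mult_le) simp_all
    moreover have "p ((g * g) * (y - h * h)) \<le> p (g * g) * c" using h(2) by (intro mult_le) simp_all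
    ultimately show ?thesis using c(2) d(2) by argo
  qed
  ultimately show "\<exists>z. pos z \<and> p (x * y - z) \<le> e" by blast
qed

lemma pos_power: "pos x \<Longrightarrow> pos (x ^ n)"
  by (induction n) (auto intro: pos_one pos_mult_commuting simp: power_commutes)

text \<open>Commuting approximate roots reduce this to \<open>commuting_square_le\<close>. The
  noncommuting case \<open>mono\<close> is later deduced from it.\<close>

lemma mono_commuting:
  assumes "pos x" "pos z" "x * z = z * x" shows "p x \<le> p (x + z)"
proof (rule field_le_epsilon)
  fix e :: real assume "e > 0"
  then have e: "e/3 > 0" by simp
  obtain g where g: "pos g" "p (x - g * g) \<le> e/3" "\<And>y. y * x = x * y \<Longrightarrow> y * g = g * y"
    using approx_sqrt[OF assms(1) e] by blast
  obtain h where h: "pos h" "p (z - h * h) \<le> e/3" "\<And>y. y * z = z * y \<Longrightarrow> y * h = h * y"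
    using approx_sqrt[OF assms(2) e] by blast
  have gh: "g * h = h * g" using g(3)[of z] h(3)[of g] assms(3) by metis
  have "p (g * g) \<le> p (g * g + h * h)"
    using commuting_square_le[OF posD[OF g(1)] posD[OF h(1)] gh] posD[OF g(1)]
    by (simp add: selfadjoint_square)
  also have "\<dots> \<le> p (x + z) + 2 * (e/3)"
  proof -
    have "p (g * g - x) \<le> e/3" "p (h * h - z) \<le> e/3" using g(2) h(2) minus_commute by simp_all
    moreover have "(g * g + h * h) - (x + z) = (g * g - x) + (h * h - z)" by simp
    then have "p ((g * g + h * h) - (x + z)) \<le> p (g * g - x) + p (h * h - z)"
      by (simp only: triangle)
    ultimately show ?thesis using diff_bound[of "g * g + h * h" "x + z"] by argo
  qed
  finally show "p x \<le> p (x + z) + e"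
    using diff_bound[of x "g * g"] g(2) by simp
qed

text \<open>The product of the two commuting positive elements is
  \<open>b\<^sup>2 - k\<^sup>2\<close>, so \<open>k\<^sup>2\<close> is dominated by
  \<open>b\<^sup>2\<close>, and the C*-identity takes the root.\<close>

lemma norm_le_of_order:
  assumes "pos (of_real b - k)" "pos (of_real b + k)" "b \<ge> 0" shows "p k \<le> b"
proof -
  have "star (of_real b - k) = of_real b - k" using assms posD by blast
  then have s: "star k = k" by (simp add: star_diff)
  have "pos ((of_real b - k) * (of_real b + k))"
    using assms by (intro pos_mult_commuting) (simp_all add: algebra_simps of_real_def)
  moreover have eq: "(of_real b - k) * (of_real b + k) = of_real (b * b) - k * k"
    by (simp add: algebra_simps of_real_def)
  ultimately have "p (k * k) \<le> p (k * k + (of_real (b * b) - k * k))"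
    using pos_square[OF s] by (intro mono_commuting) (simp_all add: algebra_simps of_real_def)
  also have "\<dots> \<le> b\<^sup>2" using of_real_le[of "b * b"] by (simp add: power2_eq_square)
  finally show ?thesis using assms(3) by (simp add: selfadjoint_square[OF s] power2_le_iff_abs_le)
qed

end

section \<open>Elements of the form \<open>b\<^sup>* b\<close> are positive\<close>

lemma one_sub_mult_geometric_sum: "(1 - w) * (\<Sum>i<n. w ^ i) = (1 - w ^ n :: 'a::ring_1)"
proof (induction n)
  case (Suc n)
  then show ?case by (simp add: distrib_left) (simp add: algebra_simps)
qed simp

text \<open>This does the work of taking \<open>n\<close>-th roots in the limit. If
  \<open>a / r\<close> exceeded \<open>1\<close>, squaring Bernoulli's inequality would give growth
  quadratic in \<open>2 ^ j\<close>, against a bound that is linear in it.\<close>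

lemma exponential_le_linear_imp_le:
  fixes a r c :: real
  assumes "0 \<le> c" "0 < r" "\<And>j. a ^ 2 ^ j \<le> (1 + c * 2 ^ j) * r ^ 2 ^ j"
  shows "a \<le> r"
proof (rule ccontr)
  assume "\<not> a \<le> r"
  define x where "x = a / r"
  have x: "x > 1" using \<open>\<not> a \<le> r\<close> assms(2) by (simp add: x_def)
  have le: "x ^ 2 ^ j \<le> 1 + c * 2 ^ j" for j
    using assms(2) assms(3)[of j] by (simp add: x_def power_divide divide_le_eq)
  define m where "m = x - 1"
  have m: "m > 0" using x by (simp add: m_def)
  have sq: "(1 + m * 2 ^ j)\<^sup>2 \<le> 1 + 2 * c * 2 ^ j" for j
  proof -
    have "1 + m * 2 ^ j \<le> x ^ 2 ^ j"
      using Bernoulli_inequality[of m "2 ^ j"] m by (simp add: m_def mult.commute)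
    then have "(1 + m * 2 ^ j)\<^sup>2 \<le> (x ^ 2 ^ j)\<^sup>2" using m by (intro power_mono) simp_all
    also have "\<dots> = x ^ 2 ^ Suc j" by (simp add: mult.commute flip: power_mult)
    also have "\<dots> \<le> 1 + 2 * c * 2 ^ j" using le[of "Suc j"] by simp
    finally show ?thesis .
  qed
  obtain n :: nat where n: "2 * c / m\<^sup>2 < real n" using reals_Archimedean2 by blast
  have "2 * c < m\<^sup>2 * 2 ^ n"
  proof -
    have "2 * c / m\<^sup>2 < 2 ^ n" using n of_nat_less_two_power[of n, where 'a=real] by linarith
    then show ?thesis using m by (simp add: divide_less_eq mult.commute)
  qed
  then have "2 * c * 2 ^ n < m\<^sup>2 * 2 ^ n * 2 ^ n" by simp
  moreover have "(1 + m * 2 ^ n)\<^sup>2 = 1 + 2 * m * 2 ^ n + m\<^sup>2 * 2 ^ n * 2 ^ n"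
    by (simp add: power2_eq_square algebra_simps)
  moreover have "0 < 2 * m * 2 ^ n" using m by simp
  ultimately show False using sq[of n] by linarith
qed

context cstar_seminormed_1
begin

text \<open>The nonzero spectra of \<open>c c\<^sup>*\<close> and \<open>c\<^sup>* c\<close> agree. Here this is read off from
  \<open>c\<^sup>* c (K - c\<^sup>* c)\<^bsup>n\<^esup> = c\<^sup>* (K - c c\<^sup>*)\<^bsup>n\<^esup> c\<close>, which makes the norm of \<open>(K - c\<^sup>* c)\<^bsup>n\<^esup>\<close> grow at most
  linearly faster than that of \<open>(K - c c\<^sup>*)\<^bsup>n\<^esup>\<close>.\<close>

lemma norm_sub_star_mult_swap:
  assumes "p (of_real K - c * star c) \<le> R" "0 < K" "K \<le> R"
  shows "p (of_real K - star c * c) \<le> R"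
proof -
  define T where "T = of_real K - star c * c"
  define T' where "T' = of_real K - c * star c"
  have R: "0 < R" using assms by linarith
  have T: "star T = T" by (simp add: T_def star_diff star_mult)
  have "c * T = T' * c" by (simp add: T_def T'_def algebra_simps of_real_def)
  then have cT: "c * T ^ n = T' ^ n * c" for n
    by (induction n) (simp_all, metis mult.assoc)
  define C where "C = (p c)\<^sup>2 / R"
  have C: "0 \<le> C" using R by (simp add: C_def)
  have bound: "p (T ^ n) \<le> (1 + n * C) * R ^ n" for n
  proof (induction n)
    case 0 show ?case using one_le by simp
  next
    case (Suc n)
    have "T ^ Suc n = K *\<^sub>R T ^ n - star c * (T' ^ n * c)"
      by (simp add: T_def algebra_simps of_real_def flip: cT)
    then have "p (T ^ Suc n) \<le> p (K *\<^sub>R T ^ n) + p (star c * (T' ^ n * c))"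
      using triangle_diff by simp
    moreover have "p (K *\<^sub>R T ^ n) \<le> R * ((1 + n * C) * R ^ n)"
      unfolding scaleR using assms Suc by (intro mult_mono) simp_all
    moreover have "p (star c * (T' ^ n * c)) \<le> p c * (R ^ n * p c)"
    proof -
      have "p (T' ^ n) \<le> R ^ n"
        using power_le[of T' n] power_mono[OF assms(1) nonneg, of n] by (simp add: T'_def)
      then show ?thesis by (intro mult_le) simp_all
    qed
    moreover have "p c * (R ^ n * p c) = C * R ^ Suc n"
      using R by (simp add: C_def power2_eq_square)
    moreover have "R * ((1 + n * C) * R ^ n) + C * R ^ Suc n = (1 + Suc n * C) * R ^ Suc n"
      by (simp add: algebra_simps)
    ultimately show ?case by linarith
  qed
  have "p T \<le> R"
  proof (rule exponential_le_linear_imp_le[OF C R])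
    fix j show "p T ^ 2 ^ j \<le> (1 + C * 2 ^ j) * R ^ 2 ^ j"
      using bound[of "2 ^ j"] selfadjoint_power[OF T, of j] by (simp add: mult.commute)
  qed
  then show ?thesis by (simp add: T_def)
qed

text \<open>This is \<open>norm_sub_star_mult_swap\<close> with \<open>K = s - a\<close> and
  \<open>R = s + e\<close>. As \<open>K\<close> has to be positive, the witness \<open>s\<close> is
  first enlarged beyond \<open>a + 1\<close>.\<close>

lemma pos_add_star_mult_swap:
  assumes "pos (of_real a + c * star c)" "0 < a" shows "pos (of_real a + star c * c)"
  unfolding pos_def
proof (intro conjI allI impI)
  show "star (of_real a + star c * c) = of_real a + star c * c" by (simp add: star_add star_mult)
  fix e :: real assume "e > 0"
  then obtain s where s: "s \<ge> a + 1" "p (of_real s - (of_real a + c * star c)) \<le> s + e"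
    using posE[OF assms(1)] by metis
  have eq: "of_real s - (of_real a + x) = of_real (s - a) - x" for x :: 'a by simp
  have "p (of_real (s - a) - star c * c) \<le> s + e"
    using s(2) unfolding eq
    by (rule norm_sub_star_mult_swap) (use s(1) assms(2) \<open>e > 0\<close> in simp_all)
  then have "p (of_real s - (of_real a + star c * c)) \<le> s + e" unfolding eq .
  moreover have "s > 0" using s(1) assms(2) by simp
  ultimately show "\<exists>s>0. p (of_real s - (of_real a + star c * c)) \<le> s + e" by blast
qed

text \<open>Up to sign, \<open>?x\<close> and \<open>?y\<close> are twice the real and the imaginary
  part of \<open>c\<close>; in the sum of their squares the terms \<open>c * c\<close> and
  \<open>star c * star c\<close> cancel.\<close>

lemma pos_star_mult_add: "pos (star c * c + c * star c)"
proof -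
  let ?x = "c + star c" and ?y = "\<i> *\<^sub>C (c - star c)"
  have "\<i> *\<^sub>C \<i> *\<^sub>C z = - z" for z :: 'a
    by (simp add: scaleC_scaleC) (metis scaleC_minus_left scaleC_one)
  then have "(1/2) *\<^sub>R (?x * ?x + ?y * ?y) = star c * c + c * star c"
    by (simp add: algebra_simps mult_scaleC_left mult_scaleC_right scaleC_add_right scaleC_diff_right)
       (simp flip: scaleR_add_left add.assoc)
  moreover have "pos ((1/2) *\<^sub>R (?x * ?x + ?y * ?y))"
    by (intro pos_scaleR pos_add pos_square)
       (simp_all add: star_add star_scaleC star_diff add.commute flip: scaleC_minus_right)
  ultimately show ?thesis by simp
qed

text \<open>The scalar inequality \<open>w\<^sup>n - w\<^sup>n * w \<le> 1\<close> for nonnegative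
  \<open>w\<close> has an algebraic certificate: the element equals
  \<open>(1 - w)\<^sup>2 S + w\<close>, where \<open>S\<close> is the geometric sum and all factors
  commute.\<close>

lemma pos_one_sub_power_diff:
  assumes "pos w" shows "pos (1 - w ^ n + w ^ Suc n)"
proof -
  define S where "S = (\<Sum>i<n. w ^ i)"
  have "w * S = S * w"
    by (simp add: S_def sum_distrib_left sum_distrib_right power_commutes)
  then have "(1 - w) * S = S * (1 - w)" by (simp add: algebra_simps)
  then have "(1 - w) * (1 - w) * S = S * ((1 - w) * (1 - w))" by (metis mult.assoc)
  moreover have "pos S" unfolding S_def by (intro pos_sum pos_power assms)
  moreover have "pos ((1 - w) * (1 - w))"
    by (rule pos_square) (simp add: star_diff posD[OF assms])
  ultimately have "pos ((1 - w) * (1 - w) * S)" by (metis pos_mult_commuting)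
  moreover have "(1 - w) * (1 - w) * S = (1 - w) * (1 - w ^ n)"
    using one_sub_mult_geometric_sum[of w n] by (simp add: S_def mult.assoc)
  moreover have "(1 - w) * (1 - w ^ n) + w = 1 - w ^ n + w ^ Suc n" by (simp add: algebra_simps)
  ultimately show ?thesis using assms pos_add by metis
qed

text \<open>With \<open>w = 1 - b\<^sup>* b\<close> and \<open>c = b w\<^bsup>N\<^esup>\<close> one has \<open>c\<^sup>* c = w\<^bsup>n\<^esup> - w\<^bsup>n+1\<^esup> \<le> 1\<close> for \<open>n = 2N\<close>, hence
  \<open>c c\<^sup>* \<ge> -c\<^sup>* c \<ge> -1\<close>. By the coincidence of spectra \<open>c\<^sup>* c \<ge> -1\<close> as well, which is
  \<open>w\<^bsup>n+1\<^esup> \<le> 1 + w\<^bsup>n\<^esup>\<close>, and for large \<open>N\<close> this forces the norm of \<open>w\<close> below \<open>1\<close>.\<close>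

lemma norm_one_sub_star_mult:
  assumes "p b \<le> 1" shows "p (1 - star b * b) \<le> 1"
proof -
  define w where "w = 1 - star b * b"
  have ws: "star w = w" by (simp add: w_def star_diff star_mult)
  have pb: "p (star b * b) \<le> 1" using assms by (simp add: cstar power_le_one)
  have w: "pos w"
    using pos_sub_bound[of "star b * b" 1] pb by (simp add: w_def star_mult)
  have main: "p w ^ 2 ^ Suc j \<le> p w * (1 + p w ^ (2 ^ Suc j - 2))" for j
  proof -
    \<comment> \<open>With this \<open>N\<close> one has \<open>n + 2 = 2 ^ Suc j\<close>, so
      \<open>w * w ^ Suc n\<close> is a dyadic power, whose seminorm is exactly the power of
      \<open>p w\<close>.\<close>
    define N :: nat where "N = 2 ^ j - 1"
    define n where "n = N + N"
    have n: "n = 2 ^ Suc j - 2" by (simp add: n_def N_def)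
    have n2: "2 ^ Suc j = Suc (Suc n)"
      unfolding n power_Suc using one_le_power[of "2::nat" j] by linarith
    define c where "c = b * w ^ N"
    have "star c * c = w ^ N * (star b * b) * w ^ N"
      by (simp add: c_def star_mult star_power ws mult.assoc)
    also have "\<dots> = w ^ N * (1 - w) * w ^ N" by (simp add: w_def)
    also have "\<dots> = w ^ n - w ^ Suc n"
      by (simp add: n_def algebra_simps power_add) (metis mult.assoc power_commutes)
    finally have cc: "star c * c = w ^ n - w ^ Suc n" .
    have "pos ((1 - w ^ n + w ^ Suc n) + (star c * c + c * star c))"
      by (intro pos_add pos_one_sub_power_diff w pos_star_mult_add)
    then have "pos (of_real 1 + c * star c)" by (simp add: cc)
    then have "pos (of_real 1 + star c * c)" by (rule pos_add_star_mult_swap) simp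
    then have z: "pos (1 + w ^ n - w ^ Suc n)" by (simp only: cc of_real_1 add_diff_eq)
    have "p (w ^ Suc n) \<le> p (w ^ Suc n + (1 + w ^ n - w ^ Suc n))"
      by (intro mono_commuting pos_power w z) (simp add: algebra_simps power_commutes flip: power_Suc power_Suc2 power_add)
    also have "\<dots> \<le> 1 + p w ^ n" using triangle[of 1 "w ^ n"] one_le power_le[of w n] by simp
    finally have "p (w * w ^ Suc n) \<le> p w * (1 + p w ^ n)" by (intro mult_le) simp_all
    then show ?thesis using selfadjoint_power[OF ws, of "Suc j"] unfolding n[symmetric] n2 by simp
  qed
  have "p w \<le> 1"
  proof (rule ccontr)
    assume "\<not> p w \<le> 1"
    then have gt: "p w > 1" by simp
    obtain k where k: "p w ^ k > 1 / (p w - 1)" using real_arch_pow[OF gt] by blast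
    define n :: nat where "n = 2 ^ Suc k - 2"
    have "k < 2 ^ k" by (rule less_exp)
    then have nk: "k \<le> n" "2 ^ Suc k = Suc (Suc n)" unfolding n_def power_Suc by linarith+
    have "p w * p w ^ Suc n \<le> p w * (1 + p w ^ n)"
      using main[of k] unfolding n_def[symmetric] nk(2) by simp
    then have "p w ^ Suc n \<le> 1 + p w ^ n" using gt by simp
    then have "p w ^ n * (p w - 1) \<le> 1" by (simp add: algebra_simps)
    then have "p w ^ n \<le> 1 / (p w - 1)" using gt by (simp add: field_simps)
    moreover have "p w ^ k \<le> p w ^ n" using gt nk by (intro power_increasing) simp_all
    ultimately show False using k by linarith
  qed
  then show ?thesis by (simp add: w_def)
qed

lemma pos_star_mult: "pos (star b * b)"
proof -
  define r where "r = 1 + p b"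
  have r: "r > 0" "p b \<le> r" using nonneg[of b] by (simp_all add: r_def add_pos_nonneg)
  define d where "d = (1/r) *\<^sub>R b"
  have "p d \<le> 1" using r by (simp add: d_def scaleR)
  then have "p (1 - star d * d) \<le> 1" by (rule norm_one_sub_star_mult)
  then have "pos (of_real 1 - (1 - star d * d))" by (intro pos_sub_bound) (simp_all add: star_diff star_mult)
  then have "pos ((r\<^sup>2) *\<^sub>R (star d * d))" by (intro pos_scaleR) simp_all
  then show ?thesis using r by (simp add: d_def power2_eq_square)
qed

section \<open>Consequences for the order\<close>

text \<open>With an approximate root \<open>g\<close> of \<open>x\<close>, the conjugate is close to
  \<open>star (g * c) * (g * c)\<close>.\<close>

lemma pos_conj: assumes "pos x" shows "pos (star c * x * c)"
proof (rule pos_closed)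
  show "star (star c * x * c) = star c * x * c" by (simp add: star_mult posD[OF assms] mult.assoc)
  fix e :: real assume "e > 0"
  define d where "d = e / ((p c)\<^sup>2 + 1)"
  have c1: "(p c)\<^sup>2 + 1 > 0" by (simp add: add_nonneg_pos)
  have d: "d > 0" "p c * d * p c \<le> e"
    using \<open>e > 0\<close> c1 by (auto simp: d_def field_simps power2_eq_square)
  obtain g where g: "pos g" "p (x - g * g) \<le> d"
    using approx_sqrt[OF assms d(1)] by blast
  have "pos (star (g * c) * (g * c))" by (rule pos_star_mult)
  moreover have "star c * x * c - star (g * c) * (g * c) = star c * (x - g * g) * c"
    by (simp add: star_mult posD[OF g(1)] algebra_simps)
  then have "p (star c * x * c - star (g * c) * (g * c)) \<le> p c * d * p c"
    using g(2) by (auto intro!: mult_le)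
  ultimately show "\<exists>y. pos y \<and> p (star c * x * c - y) \<le> e" using d by (meson order_trans)
qed

text \<open>Since \<open>x + z\<close> lies below the scalar \<open>?c\<close>, so does
  \<open>x\<close>. Now \<open>x\<close> commutes with \<open>?c - x\<close>, and the commuting case
  applies to these two.\<close>

lemma mono: assumes "pos x" "pos z" shows "p x \<le> p (x + z)"
proof -
  let ?c = "p (x + z)"
  have "pos (of_real ?c - (x + z))"
    by (rule pos_sub_bound) (simp_all add: star_add posD assms)
  then have "pos (of_real ?c - (x + z) + z)" using assms(2) by (rule pos_add)
  then have "pos (of_real ?c - x)" by simp
  then have "p x \<le> p (x + (of_real ?c - x))"
    using assms(1) by (intro mono_commuting) (simp_all add: algebra_simps of_real_def)
  also have "\<dots> \<le> ?c" using of_real_le[of ?c] by simp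
  finally show ?thesis .
qed

lemma mono_sum:
  assumes "finite A" "i \<in> A" "\<And>j. j \<in> A \<Longrightarrow> pos (f j)" shows "p (f i) \<le> p (sum f A)"
proof -
  have "p (f i) \<le> p (f i + sum f (A - {i}))" by (intro mono pos_sum assms) (use assms(2) in auto)
  then show ?thesis using sum.remove[OF assms(1,2), of f] by simp
qed

lemma norm_one_sub_le:
  assumes "pos z" "p z \<le> 1" shows "p (1 - z) \<le> 1"
proof -
  have "pos (of_real 1 - z)" using assms by (intro pos_sub_bound) (simp_all add: posD)
  then show ?thesis
    using norm_le_of_order[of 1 "1 - z"] assms pos_add[OF pos_one, of "1 - z"] by simp
qed

text \<open>If \<open>w \<ge> -k\<close> then \<open>(s - g)(w + k) \<ge> 0\<close> for \<open>s \<ge> g\<close>, which improves the bound to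
  \<open>w \<ge> -k (1 - c/s)\<close>.\<close>

lemma pos_cancel_commuting:
  assumes g: "pos (g - of_real c)" "c > 0" and gw: "pos (g * w)" "g * w = w * g" "star w = w"
  shows "pos w"
proof -
  have gs: "star g = g" using posD[OF g(1)] by (simp add: star_diff)
  define s where "s = p g + c"
  have s: "s \<ge> c" "s > 0" "p g \<le> s" using g(2) nonneg[of g] by (simp_all add: s_def add_nonneg_pos)
  define t where "t = 1 - c / s"
  have t: "0 \<le> t" "t < 1" using s g(2) by (auto simp: t_def)
  have "pos (w + of_real (p w * t ^ n))" for n
  proof (induction n)
    case 0 show ?case using pos_add_bound[of w "p w"] gw by (simp add: add.commute)
  next
    case (Suc n)
    define k where "k = p w * t ^ n"
    have k: "k \<ge> 0" using t by (simp add: k_def)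
    have "pos ((of_real s - g) * (w + of_real k))"
    proof (rule pos_mult_commuting)
      show "pos (of_real s - g)" by (rule pos_sub_bound) (use gs s in auto)
      show "pos (w + of_real k)" using Suc by (simp add: k_def)
      show "(of_real s - g) * (w + of_real k) = (w + of_real k) * (of_real s - g)"
        using gw by (simp add: algebra_simps of_real_def)
    qed
    moreover have "pos (k *\<^sub>R (g - of_real c))" using g k by (intro pos_scaleR)
    ultimately have "pos ((of_real s - g) * (w + of_real k) + g * w + k *\<^sub>R (g - of_real c))"
      using gw(1) by (intro pos_add)
    then have "pos ((1/s) *\<^sub>R ((of_real s - g) * (w + of_real k) + g * w + k *\<^sub>R (g - of_real c)))"
      using s by (intro pos_scaleR) simp_all
    \<comment> \<open>The terms with \<open>g * w\<close> and with \<open>k\<close> times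
      \<open>g\<close> cancel; what is left is \<open>s w + k (s - c)\<close>, and
      \<open>s - c\<close> equals \<open>s t\<close>.\<close>
    moreover have "(of_real s - g) * (w + of_real k) + g * w + k *\<^sub>R (g - of_real c)
        = s *\<^sub>R (w + (k * t) *\<^sub>R 1)"
    proof -
      have "s * (k * t) = s * k - k * c" using s by (simp add: t_def algebra_simps)
      then have "(s * (k * t)) *\<^sub>R 1 = (s * k) *\<^sub>R (1 :: 'a) - (k * c) *\<^sub>R 1"
        by (simp only: scaleR_diff_left)
      then show ?thesis by (simp add: algebra_simps of_real_def)
    qed
    ultimately show ?case using s by (simp add: k_def of_real_def mult_ac)
  qed
  then show ?thesis
  proof (rule pos_limit[OF gw(3)])
    have "(\<lambda>n. p w * t ^ n) \<longlonglongrightarrow> 0"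
      using t by (intro tendsto_mult_right_zero LIMSEQ_realpow_zero)
    then show "(\<lambda>n. p (w - (w + of_real (p w * t ^ n)))) \<longlonglongrightarrow> 0"
    proof (rule tendsto_sandwich[OF _ _ tendsto_const, rotated 2])
      show "\<forall>\<^sub>F n in sequentially. p (w - (w + of_real (p w * t ^ n))) \<le> p w * t ^ n"
        using of_real_le[of "p w * t ^ n" for n] t by (intro always_eventually) simp
    qed (auto intro: always_eventually)
  qed
qed

text \<open>Twice \<open>?r * (?r - x)\<close> is the square of \<open>?r - x\<close> plus
  \<open>?r\<^sup>2 - x\<^sup>2\<close>, hence positive; the factor \<open>?r\<close> is bounded
  below by \<open>e\<close> and can be cancelled. No sign of \<open>x\<close> is prescribed, so the
  lemma serves for \<open>x\<close> and \<open>- x\<close> when \<open>r\<close> is an absolute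
  value.\<close>

lemma pos_diff_of_square_le:
  assumes "pos r" "star x = x" "r * x = x * r" "pos (r * r - x * x)"
  shows "pos (r - x)"
proof (rule pos_closed)
  show "star (r - x) = r - x" using assms by (simp add: star_diff posD)
  fix e :: real assume e: "e > 0"
  let ?r = "r + of_real e"
  have "pos (?r - x)"
  proof (rule pos_cancel_commuting)
    have "pos ((1/2) *\<^sub>R ((?r - x) * (?r - x) + (r * r - x * x) + (2 * e) *\<^sub>R r + of_real (e * e)))"
      using assms e by (intro pos_scaleR pos_add pos_square pos_of_real)
        (simp_all add: star_diff star_add posD)
    also have "(?r - x) * (?r - x) + (r * r - x * x) + (2 * e) *\<^sub>R r + of_real (e * e)
        = 2 *\<^sub>R (?r * (?r - x))"
      using assms(3) by (simp add: algebra_simps of_real_def scaleR_2 flip: scaleR_scaleR)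
    finally show "pos (?r * (?r - x))" by simp
    show "?r * (?r - x) = (?r - x) * ?r"
      using assms(3) by (simp add: algebra_simps of_real_def)
  qed (use assms e in \<open>simp_all add: star_diff star_add posD\<close>)
  moreover have "p (r - x - (?r - x)) \<le> e" using of_real_le[of e] e by simp
  ultimately show "\<exists>y. pos y \<and> p (r - x - y) \<le> e" by blast
qed

text \<open>From \<open>?s\<^sup>2 - ?d\<^sup>2 = 4 g h\<close> being positive one gets that the
  fourth power of \<open>?d\<close> lies below \<open>?d\<^sup>2 ?s\<^sup>2\<close>, the square of
  \<open>g\<^sup>2 - h\<^sup>2\<close>. This is the uniform continuity and the uniqueness of
  positive roots.\<close>

lemma norm_diff_square_le:
  assumes "pos g" "pos h" "g * h = h * g"
  shows "(p (g - h))\<^sup>2 \<le> p (g * g - h * h)"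
proof -
  let ?d = "g - h" and ?s = "g + h"
  have d: "star ?d = ?d" "star ?s = ?s" by (simp_all add: star_diff star_add posD assms)
  have ds: "?d * ?s = g * g - h * h" "?s * ?d = g * g - h * h"
    using assms(3) by (simp_all add: algebra_simps)
  have gh: "pos (g * h)" using assms by (rule pos_mult_commuting)
  have gh_d: "g * h * ?d = ?d * (g * h)"
    by (simp add: left_diff_distrib right_diff_distrib) (metis assms(3) mult.assoc)
  have eq: "?s * ?s - ?d * ?d = 4 *\<^sub>R (g * h)"
    using assms(3) scaleR_left.add[of 2 2 "g * h"] by (simp add: algebra_simps scaleR_2)
  have dd: "pos (?d * ?d)" using d by (intro pos_square)
  have "pos (?d * ?d * (4 *\<^sub>R (g * h)))"
  proof (rule pos_mult_commuting[OF dd pos_scaleR[OF gh]])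
    show "?d * ?d * (4 *\<^sub>R (g * h)) = 4 *\<^sub>R (g * h) * (?d * ?d)"
      by (simp only: mult_scaleR_left mult_scaleR_right) (metis gh_d mult.assoc)
  qed simp
  moreover have "pos ((?d * ?d) * (?d * ?d))" by (rule pos_square) (simp only: star_mult d)
  ultimately have "p ((?d * ?d) * (?d * ?d)) \<le> p ((?d * ?d) * (?d * ?d) + ?d * ?d * (4 *\<^sub>R (g * h)))"
    by (rule mono[rotated])
  also have "(?d * ?d) * (?d * ?d) + ?d * ?d * (4 *\<^sub>R (g * h)) = ?d * ?d * (?s * ?s)"
    unfolding eq[symmetric] by (simp add: right_diff_distrib)
  also have "\<dots> = (g * g - h * h) * (g * g - h * h)"
    using ds by (metis mult.assoc)
  also have "p \<dots> \<le> (p (g * g - h * h))\<^sup>2" using submult by (simp add: power2_eq_square)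
  finally have "((p ?d)\<^sup>2)\<^sup>2 \<le> (p (g * g - h * h))\<^sup>2"
    using d by (simp add: selfadjoint_square star_mult)
  then show ?thesis by (rule power2_le_imp_le) simp
qed

end

section \<open>Square roots in complete families\<close>

text \<open>Sequential completeness fits an index set of any size, because a single sequence of
  approximate roots converges for every index. The carrier \<open>S\<close> is a subset of the type
  because matrices of all sizes will share one type.\<close>

locale complete_seminorm_family =
  fixes I :: "'i set" and P :: "'i \<Rightarrow> 'u::complex_star_algebra_1 \<Rightarrow> real" and S :: "'u set"
  assumes seminorm: "i \<in> I \<Longrightarrow> cstar_seminorm (P i)"
    and one_closed: "1 \<in> S"
    and add_closed: "x \<in> S \<Longrightarrow> y \<in> S \<Longrightarrow> x + y \<in> S"
    and mult_closed: "x \<in> S \<Longrightarrow> y \<in> S \<Longrightarrow> x * y \<in> S"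
    and scaleR_closed: "x \<in> S \<Longrightarrow> r *\<^sub>R x \<in> S"
    and star_closed: "x \<in> S \<Longrightarrow> star x \<in> S"
    and separating: "x \<in> S \<Longrightarrow> (\<And>i. i \<in> I \<Longrightarrow> P i x = 0) \<Longrightarrow> x = 0"
    and complete: "(\<And>n. X n \<in> S) \<Longrightarrow>
      (\<And>i e. i \<in> I \<Longrightarrow> e > 0 \<Longrightarrow> \<exists>N. \<forall>m\<ge>N. \<forall>n\<ge>N. P i (X m - X n) < e) \<Longrightarrow>
      \<exists>x\<in>S. \<forall>i\<in>I. (\<lambda>n. P i (X n - x)) \<longlonglongrightarrow> 0"
begin

lemma seminormed: "i \<in> I \<Longrightarrow> cstar_seminormed_1 (P i)"
  by (simp add: cstar_seminormed_1_def cstar_seminormed_def seminorm)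

lemma diff_closed: "x \<in> S \<Longrightarrow> y \<in> S \<Longrightarrow> x - y \<in> S"
  using add_closed[of x "- y"] scaleR_closed[of y "-1"] by simp

lemma sqrt_defect_closed: "z \<in> S \<Longrightarrow> sqrt_defect z n \<in> S"
proof (induction n)
  case 0 then show ?case using scaleR_closed[of z 0] by simp
qed (auto simp: sqrt_defect.simps(2) intro: scaleR_closed add_closed mult_closed)

abbreviation psd :: "'i \<Rightarrow> 'u \<Rightarrow> bool" where
  "psd i \<equiv> cstar_seminormed_1.pos (P i)"

lemma eqI_limit:
  assumes "x \<in> S" "y \<in> S"
    and "\<And>i. i \<in> I \<Longrightarrow> \<exists>f. (\<forall>\<^sub>F n in sequentially. P i (x - y) \<le> f n) \<and> f \<longlonglongrightarrow> 0"
  shows "x = y"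
proof -
  have "x - y = 0"
  proof (rule separating)
    show "x - y \<in> S" using assms by (intro diff_closed)
    fix i assume i: "i \<in> I"
    interpret cstar_seminormed_1 "P i" by (rule seminormed[OF i])
    obtain f where "\<forall>\<^sub>F n in sequentially. P i (x - y) \<le> f n" "f \<longlonglongrightarrow> 0"
      using assms(3)[OF i] by blast
    then have "P i (x - y) \<le> 0"
      using tendsto_lowerbound[of f 0 sequentially "P i (x - y)"] by simp
    then show "P i (x - y) = 0" using nonneg[of "x - y"] by linarith
  qed
  then show ?thesis by simp
qed

text \<open>As \<open>y\<close> need not be bounded in \<open>i\<close>, the iteration is run on \<open>y/(n+1)\<close>: for each \<open>i\<close> it is
  controlled as soon as \<open>P i y \<le> n + 1\<close>.\<close>

lemma ex_sqrt:
  assumes y: "y \<in> S" "star y = y" "\<And>i. i \<in> I \<Longrightarrow> psd i y"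
  obtains b where "b \<in> S" "star b = b" "b * b = y" "\<And>i. i \<in> I \<Longrightarrow> psd i b"
    "\<And>z. z \<in> S \<Longrightarrow> z * y = y * z \<Longrightarrow> z * b = b * z"
proof -
  \<comment> \<open>The tolerance is the square of \<open>1 / Suc n\<close>: undoing the scaling of
    \<open>y\<close> multiplies the residual by \<open>Suc n\<close>, and what remains must still
    tend to zero.\<close>
  have "\<exists>N. 2 * (sqrt_majorant (Suc N) - sqrt_majorant N) < 1 / real (Suc n) / real (Suc n)" for n
  proof -
    have "(\<lambda>n. 2 * (sqrt_majorant (Suc n) - sqrt_majorant n)) \<longlonglongrightarrow> 0"
      by (rule tendsto_mult_right_zero[OF sqrt_majorant_increment])
    moreover have "0 < 1 / real (Suc n) / real (Suc n)" by simp
    ultimately have "\<forall>\<^sub>F N in sequentially.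
        2 * (sqrt_majorant (Suc N) - sqrt_majorant N) < 1 / real (Suc n) / real (Suc n)"
      by (rule order_tendstoD(2))
    then show ?thesis by (meson eventually_happens sequentially_bot)
  qed
  then obtain N where
    N: "\<And>n. 2 * (sqrt_majorant (Suc (N n)) - sqrt_majorant (N n)) < 1 / real (Suc n) / real (Suc n)"
    by metis
  define z where "z n = 1 - (1 / real (Suc n)) *\<^sub>R y" for n
  define h where "h n = 1 - sqrt_defect (z n) (N n)" for n
  define g where "g n = sqrt (real (Suc n)) *\<^sub>R h n" for n
  have z: "star (z n) = z n" "z n \<in> S" for n
    using y by (auto simp: z_def star_diff intro: diff_closed one_closed scaleR_closed)
  have g_closed: "g n \<in> S" for n
    unfolding g_def h_def by (intro scaleR_closed diff_closed one_closed sqrt_defect_closed z)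
  have g_star: "star (g n) = g n" for n
    by (simp add: g_def h_def star_diff star_sqrt_defect z)
  have commute: "x * g n = g n * x" if "x * y = y * x" for x n
  proof -
    have "x * z n = z n * x" using that by (simp add: z_def algebra_simps)
    then show ?thesis by (simp add: g_def h_def algebra_simps sqrt_defect_commute)
  qed
  have gg: "g m * g n = g n * g m" for m n by (metis commute)
  have main: "psd i (g n) \<and> P i (y - g n * g n) \<le> 1 / real (Suc n)"
    if i: "i \<in> I" and n: "P i y \<le> real (Suc n)" for i n
  proof -
    interpret cstar_seminormed_1 "P i" by (rule seminormed[OF i])
    have "pos ((1 / real (Suc n)) *\<^sub>R y)" using y(3)[OF i] by (intro pos_scaleR) simp_all
    then have pz: "P i (z n) \<le> 1"
      unfolding z_def by (rule norm_one_sub_le) (use n in \<open>simp add: scaleR divide_simps\<close>)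
    have "y - g n * g n = real (Suc n) *\<^sub>R ((1 - z n) - h n * h n)"
      by (simp add: g_def z_def algebra_simps del: of_nat_Suc)
    then have "P i (y - g n * g n) = real (Suc n) * P i ((1 - z n) - h n * h n)"
      by (simp only: scaleR)
    also have "\<dots> \<le> real (Suc n) * (1 / real (Suc n) / real (Suc n))"
      unfolding h_def using sqrt_defect_error_bound[OF pz, of "N n"] N[of n]
      by (intro mult_left_mono) (simp_all del: of_nat_Suc)
    finally have "P i (y - g n * g n) \<le> 1 / real (Suc n)" by (simp del: of_nat_Suc)
    moreover have "pos (g n)" unfolding g_def h_def
      by (intro pos_scaleR pos_one_minus_sqrt_defect z pz) simp
    ultimately show ?thesis by blast
  qed
  have ev: "\<forall>\<^sub>F n in sequentially. P i y \<le> real (Suc n)" for i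
    using eventually_ge_at_top[of "nat \<lceil>P i y\<rceil>"] by eventually_elim linarith
  have "\<exists>K. \<forall>m\<ge>K. \<forall>n\<ge>K. P i (g m - g n) < e" if i: "i \<in> I" and e: "e > 0" for i e
  proof -
    interpret cstar_seminormed_1 "P i" by (rule seminormed[OF i])
    have "(\<lambda>n. 1 / real (Suc n)) \<longlonglongrightarrow> 0" by (rule LIMSEQ_Suc[OF lim_1_over_n])
    moreover have "0 < e\<^sup>2 / 2" using e by simp
    ultimately have "\<forall>\<^sub>F n in sequentially. 1 / real (Suc n) < e\<^sup>2 / 2"
      by (rule order_tendstoD(2))
    with ev[of i] have "\<forall>\<^sub>F n in sequentially. P i y \<le> real (Suc n) \<and> 1 / real (Suc n) < e\<^sup>2 / 2"
      by eventually_elim simp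
    then obtain K where K: "\<And>n. n \<ge> K \<Longrightarrow> P i y \<le> real (Suc n) \<and> 1 / real (Suc n) < e\<^sup>2 / 2"
      unfolding eventually_sequentially by blast
    have "P i (g m - g n) < e" if "m \<ge> K" "n \<ge> K" for m n
    proof -
      have mn: "P i y \<le> real (Suc m)" "1 / real (Suc m) < e\<^sup>2 / 2"
        "P i y \<le> real (Suc n)" "1 / real (Suc n) < e\<^sup>2 / 2" using K that by blast+
      \<comment> \<open>The approximate roots are polynomials in the same \<open>y\<close>, hence
        commute, and the convergence of their squares to \<open>y\<close> makes the roots themselves
        Cauchy.\<close>
      have "(P i (g m - g n))\<^sup>2 \<le> P i (g m * g m - g n * g n)"
        using main[OF i mn(1)] main[OF i mn(3)] gg by (intro norm_diff_square_le) simp_all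
      also have "\<dots> \<le> P i (y - g n * g n) + P i (y - g m * g m)"
        using triangle_diff[of "y - g n * g n" "y - g m * g m"] by simp
      also have "\<dots> < e\<^sup>2" using main[OF i mn(1)] main[OF i mn(3)] mn by linarith
      finally show ?thesis using e by (simp add: power_less_imp_less_base)
    qed
    then show ?thesis by blast
  qed
  then obtain b where b: "b \<in> S" "\<And>i. i \<in> I \<Longrightarrow> (\<lambda>n. P i (g n - b)) \<longlonglongrightarrow> 0"
    using complete[of g] g_closed by blast
  have star_b: "star b = b"
  proof (rule eqI_limit)
    fix i assume i: "i \<in> I"
    interpret cstar_seminormed_1 "P i" by (rule seminormed[OF i])
    have "P i (star b - b) \<le> 2 * P i (g n - b)" for n
      using triangle_diff[of "g n - b" "g n - star b"] star[of "g n - b"]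
      by (simp add: star_diff g_star)
    then show "\<exists>f. (\<forall>\<^sub>F n in sequentially. P i (star b - b) \<le> f n) \<and> f \<longlonglongrightarrow> 0"
      by (intro exI[of _ "\<lambda>n. 2 * P i (g n - b)"] conjI always_eventually allI
          tendsto_mult_right_zero b(2)[OF i])
  qed (intro star_closed b)+
  moreover have "b * b = y"
  proof (rule eqI_limit)
    fix i assume i: "i \<in> I"
    interpret cstar_seminormed_1 "P i" by (rule seminormed[OF i])
    let ?f = "\<lambda>n. P i (g n - b) * P i b + (P i b + P i (g n - b)) * P i (g n - b) + 1 / real (Suc n)"
    have "P i (b * b - y) \<le> ?f n" if n: "P i y \<le> real (Suc n)" for n
    proof -
      have "P i (b * b - y) \<le> P i (b * b - g n * g n) + 1 / real (Suc n)"
        using triangle_diff[of "b * b - g n * g n" "y - g n * g n"] main[OF i n] by simp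
      moreover have "b * b - g n * g n = - ((g n - b) * b + g n * (g n - b))"
        by (simp add: algebra_simps)
      then have "P i (b * b - g n * g n) \<le> P i ((g n - b) * b) + P i (g n * (g n - b))"
        by (simp only: minus triangle)
      moreover have "P i ((g n - b) * b) \<le> P i (g n - b) * P i b" by (rule submult)
      moreover have "P i (g n * (g n - b)) \<le> (P i b + P i (g n - b)) * P i (g n - b)"
        by (intro mult_le diff_bound order_refl)
      ultimately show ?thesis by linarith
    qed
    then have "\<forall>\<^sub>F n in sequentially. P i (b * b - y) \<le> ?f n"
      using eventually_mono[OF ev[of i]] by simp
    moreover have "?f \<longlonglongrightarrow> 0 * P i b + (P i b + 0) * 0 + 0"
      by (intro tendsto_intros b(2)[OF i] LIMSEQ_Suc[OF lim_1_over_n])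
    ultimately show "\<exists>f. (\<forall>\<^sub>F n in sequentially. P i (b * b - y) \<le> f n) \<and> f \<longlonglongrightarrow> 0"
      by auto
  qed (intro mult_closed b y)+
  moreover have "psd i b" if i: "i \<in> I" for i
  proof -
    interpret cstar_seminormed_1 "P i" by (rule seminormed[OF i])
    obtain K where K: "\<And>n. n \<ge> K \<Longrightarrow> P i y \<le> real (Suc n)"
      using ev[of i] unfolding eventually_sequentially by blast
    show ?thesis
    proof (rule pos_limit[OF star_b, of "\<lambda>n. g (n + K)"])
      show "pos (g (n + K))" for n using main[OF i K[of "n + K"]] by simp
      show "(\<lambda>n. P i (b - g (n + K))) \<longlonglongrightarrow> 0"
        using LIMSEQ_ignore_initial_segment[OF b(2)[OF i], of K] by (simp only: minus_commute[of b])
    qed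
  qed
  moreover have "x * b = b * x" if x: "x \<in> S" "x * y = y * x" for x
  proof (rule eqI_limit)
    fix i assume i: "i \<in> I"
    interpret cstar_seminormed_1 "P i" by (rule seminormed[OF i])
    have "P i (x * b - b * x) \<le> 2 * P i x * P i (g n - b)" for n
    proof -
      have "x * b - b * x = (g n - b) * x - x * (g n - b)"
        using commute[OF x(2), of n] by (simp add: algebra_simps)
      then show ?thesis
        using triangle_diff[of "(g n - b) * x" "x * (g n - b)"] submult[of x "g n - b"]
          submult[of "g n - b" x] by (simp add: mult.commute[of _ "P i x"])
    qed
    then show "\<exists>f. (\<forall>\<^sub>F n in sequentially. P i (x * b - b * x) \<le> f n) \<and> f \<longlonglongrightarrow> 0"
      by (intro exI[of _ "\<lambda>n. 2 * P i x * P i (g n - b)"] conjI always_eventually allI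
          tendsto_mult_right_zero b(2)[OF i])
  qed (intro mult_closed b x)+
  ultimately show ?thesis using that b(1) by blast
qed

end

section \<open>Operator seminorms\<close>

text \<open>\<open>N\<close> is the seminorm of a Hilbert module on which the algebra acts by adjointable operators;
  the last assumption is the Cauchy-Schwarz inequality for \<open>\<langle>ux, ux\<rangle> = \<langle>x, u\<^sup>*ux\<rangle>\<close>.\<close>

locale star_action =
  fixes act :: "'m::complex_star_algebra \<Rightarrow> 'e::complex_star_algebra \<Rightarrow> 'e" and N :: "'e \<Rightarrow> real"
  assumes N_nonneg: "0 \<le> N x"
    and N_triangle: "N (x + y) \<le> N x + N y"
    and N_scale: "N (c *\<^sub>C x) = cmod c * N x"
    and act_add: "act (u + v) x = act u x + act v x"
    and act_scale: "act (c *\<^sub>C u) x = c *\<^sub>C act u x"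
    and act_scale_right: "act u (c *\<^sub>C x) = c *\<^sub>C act u x"
    and act_mult: "act (u * v) x = act u (act v x)"
    and act_bounded: "\<exists>C. \<forall>x. N (act u x) \<le> C * N x"
    and act_cstar: "(N (act u x))\<^sup>2 \<le> N x * N (act (star u * u) x)"
begin

definition opnorm :: "'m \<Rightarrow> real" where
  "opnorm u = (SUP x\<in>{x. N x \<le> 1}. N (act u x))"

lemma N_zero: "N 0 = 0"
  using N_scale[of 0 0] by simp

lemma act_zero: "act u 0 = 0"
  using act_scale_right[of u 0 0] by simp

lemma opnorm_bdd: "bdd_above ((\<lambda>x. N (act u x)) ` {x. N x \<le> 1})"
proof -
  obtain C where C: "\<And>x. N (act u x) \<le> C * N x" using act_bounded by blast
  have "N (act u x) \<le> \<bar>C\<bar>" if "N x \<le> 1" for x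
  proof -
    have "C * N x \<le> \<bar>C\<bar> * 1" using that N_nonneg[of x] by (intro mult_mono) simp_all
    then show ?thesis using C[of x] by simp
  qed
  then show ?thesis by (intro bdd_aboveI2[of _ _ "\<bar>C\<bar>"]) simp
qed

lemma act_le: "N (act u x) \<le> opnorm u * N x"
proof (cases "N x = 0")
  case True
  obtain C where "\<And>x. N (act u x) \<le> C * N x" using act_bounded by blast
  from this[of x] show ?thesis using True by simp
next
  case False
  then have x: "N x > 0" using N_nonneg[of x] by linarith
  let ?y = "complex_of_real (1 / N x) *\<^sub>C x"
  have "N ?y \<le> 1" using x by (simp only: N_scale norm_of_real) simp
  then have "N (act u ?y) \<le> opnorm u"
    unfolding opnorm_def by (intro cSUP_upper opnorm_bdd) simp
  moreover have "N (act u ?y) = N (act u x) / N x"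
    using x by (simp only: act_scale_right N_scale norm_of_real) simp
  ultimately show ?thesis using x by (simp add: divide_le_eq)
qed

lemma opnorm_nonneg: "0 \<le> opnorm u"
proof -
  have "N (act u 0) \<le> opnorm u"
    unfolding opnorm_def by (intro cSUP_upper opnorm_bdd) (simp add: N_zero)
  then show ?thesis by (simp add: act_zero N_zero)
qed

lemma opnorm_le:
  assumes "\<And>x. N (act u x) \<le> C * N x" "0 \<le> C" shows "opnorm u \<le> C"
  unfolding opnorm_def
proof (rule cSUP_least)
  show "{x. N x \<le> 1} \<noteq> {}" using N_zero by (auto intro: exI[of _ 0])
  fix x assume "x \<in> {x. N x \<le> 1}"
  then have "C * N x \<le> C" using assms(2) by (simp add: mult_left_le)
  then show "N (act u x) \<le> C" using assms(1)[of x] by linarith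
qed

lemma opnorm_scale: "opnorm (c *\<^sub>C u) = cmod c * opnorm u"
proof -
  have le: "opnorm (c *\<^sub>C u) \<le> cmod c * opnorm u" for c u
    using mult_left_mono[OF act_le, of "cmod c" u]
    by (intro opnorm_le) (simp_all add: act_scale N_scale opnorm_nonneg mult.assoc)
  show ?thesis
  proof (cases "c = 0")
    case True
    then show ?thesis using le[of 0 u] opnorm_nonneg[of "c *\<^sub>C u"] by simp
  next
    case False
    then have "u = (1 / c) *\<^sub>C c *\<^sub>C u" by (simp add: scaleC_scaleC scaleC_one)
    then have "opnorm u \<le> cmod (1 / c) * opnorm (c *\<^sub>C u)" by (metis le)
    then have "cmod c * opnorm u \<le> opnorm (c *\<^sub>C u)"
      using False by (simp add: norm_divide field_simps)
    then show ?thesis using le[of c u] by simp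
  qed
qed

lemma opnorm_mult: "opnorm (u * v) \<le> opnorm u * opnorm v"
proof (rule opnorm_le)
  fix x
  have "N (act (u * v) x) \<le> opnorm u * N (act v x)" by (simp add: act_mult act_le)
  also have "\<dots> \<le> opnorm u * (opnorm v * N x)" by (intro mult_left_mono act_le opnorm_nonneg)
  finally show "N (act (u * v) x) \<le> opnorm u * opnorm v * N x" by (simp add: mult.assoc)
qed (simp add: opnorm_nonneg)

text \<open>The lower bound is the Cauchy-Schwarz assumption. The upper bound needs the involution
  to be isometric, which follows from the lower bound by cancelling one factor
  \<open>opnorm u\<close>.\<close>

lemma opnorm_star_mult: "opnorm (star u * u) = (opnorm u)\<^sup>2"
proof -
  have le: "(opnorm u)\<^sup>2 \<le> opnorm (star u * u)" for u
  proof -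
    have "opnorm u \<le> sqrt (opnorm (star u * u))"
    proof (rule opnorm_le)
      fix x
      have "(N (act u x))\<^sup>2 \<le> N x * (opnorm (star u * u) * N x)"
        by (rule order_trans[OF act_cstar]) (intro mult_left_mono act_le N_nonneg)
      also have "\<dots> = (sqrt (opnorm (star u * u)) * N x)\<^sup>2"
        by (simp add: power_mult_distrib opnorm_nonneg power2_eq_square[of "N x"])
      finally show "N (act u x) \<le> sqrt (opnorm (star u * u)) * N x"
        by (rule power2_le_imp_le) (simp add: opnorm_nonneg N_nonneg)
    qed (simp add: opnorm_nonneg)
    then have "(opnorm u)\<^sup>2 \<le> (sqrt (opnorm (star u * u)))\<^sup>2"
      by (intro power_mono opnorm_nonneg)
    then show ?thesis by (simp add: opnorm_nonneg)
  qed
  have "opnorm u \<le> opnorm (star u)" for u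
  proof (cases "opnorm u = 0")
    case False
    then have "opnorm u > 0" using opnorm_nonneg[of u] by linarith
    moreover have "opnorm u * opnorm u \<le> opnorm (star u) * opnorm u"
      using le[of u] opnorm_mult[of "star u" u] by (simp add: power2_eq_square)
    ultimately show ?thesis by simp
  qed (simp add: opnorm_nonneg)
  from this[of "star u"] have "opnorm (star u * u) \<le> opnorm u * opnorm u"
    by (intro order_trans[OF opnorm_mult] mult_right_mono) (simp_all add: opnorm_nonneg)
  then show ?thesis using le[of u] by (simp add: power2_eq_square)
qed

lemma cstar_seminorm_opnorm: "cstar_seminorm opnorm"
  unfolding cstar_seminorm_def
proof (intro conjI allI)
  fix u v
  show "opnorm (u + v) \<le> opnorm u + opnorm v"
  proof (rule opnorm_le)
    fix x show "N (act (u + v) x) \<le> (opnorm u + opnorm v) * N x"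
      unfolding act_add distrib_right
      by (rule order_trans[OF N_triangle]) (intro add_mono act_le)
  qed (simp add: opnorm_nonneg)
qed (simp_all add: opnorm_nonneg opnorm_scale opnorm_mult opnorm_star_mult)

end

lemma cstar_seminorm_max:
  assumes "cstar_seminorm p" "cstar_seminorm q" shows "cstar_seminorm (\<lambda>x. max (p x) (q x))"
proof -
  interpret P: cstar_seminormed p using assms by unfold_locales
  interpret Q: cstar_seminormed q using assms by unfold_locales
  show ?thesis unfolding cstar_seminorm_def
  proof (intro conjI allI)
    fix x y c
    show "0 \<le> max (p x) (q x)" by (simp add: le_max_iff_disj)
    show "max (p (x + y)) (q (x + y)) \<le> max (p x) (q x) + max (p y) (q y)"
      using P.triangle[of x y] Q.triangle[of x y] by linarith
    show "max (p (c *\<^sub>C x)) (q (c *\<^sub>C x)) = cmod c * max (p x) (q x)"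
      by (simp add: P.scale Q.scale max_mult_distrib_left)
    show "max (p (x * y)) (q (x * y)) \<le> max (p x) (q x) * max (p y) (q y)"
      by (intro max.boundedI P.mult_le Q.mult_le) simp_all
    show "max (p (star x * x)) (q (star x * x)) = (max (p x) (q x))\<^sup>2"
      by (simp add: P.cstar Q.cstar max_def power2_le_iff_abs_le)
  qed
qed

section \<open>Unitization\<close>

datatype 'a unitization = Unitization (scalar_part: complex) (algebra_part: 'a)

instantiation unitization :: (complex_star_algebra) complex_star_algebra_1
begin

definition "0 = Unitization 0 0"
definition "1 = Unitization 1 0"
definition "u + v = Unitization (scalar_part u + scalar_part v) (algebra_part u + algebra_part v)"
definition "u - v = Unitization (scalar_part u - scalar_part v) (algebra_part u - algebra_part v)"
definition "- u = Unitization (- scalar_part u) (- algebra_part u)"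
definition "u * v = Unitization (scalar_part u * scalar_part v)
  (scalar_part u *\<^sub>C algebra_part v + scalar_part v *\<^sub>C algebra_part u + algebra_part u * algebra_part v)"
definition "c *\<^sub>C u = Unitization (c * scalar_part u) (c *\<^sub>C algebra_part u)"
definition "r *\<^sub>R u = Unitization (complex_of_real r * scalar_part u) (complex_of_real r *\<^sub>C algebra_part u)"
definition "star u = Unitization (cnj (scalar_part u)) (star (algebra_part u))"

lemmas unitization_defs = zero_unitization_def one_unitization_def plus_unitization_def
  minus_unitization_def uminus_unitization_def times_unitization_def scaleC_unitization_def
  scaleR_unitization_def star_unitization_def

instance
  by standard
    (simp_all add: unitization_defs unitization.expand algebra_simps scaleC_add_right scaleC_add_left
      scaleC_scaleC scaleC_one mult_scaleC_left mult_scaleC_right star_add star_scaleC star_mult)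

end

lemma scalar_part_simps [simp]:
  "scalar_part 0 = 0" "scalar_part 1 = 1" "scalar_part (u + v) = scalar_part u + scalar_part v"
  "scalar_part (u - v) = scalar_part u - scalar_part v" "scalar_part (- u) = - scalar_part u"
  "scalar_part (u * v) = scalar_part u * scalar_part v"
  "scalar_part (c *\<^sub>C u) = c * scalar_part u"
  "scalar_part (r *\<^sub>R u) = complex_of_real r * scalar_part u"
  "scalar_part (star u) = cnj (scalar_part u)"
  by (simp_all add: unitization_defs)

lemma algebra_part_simps [simp]:
  "algebra_part 0 = 0" "algebra_part 1 = 0"
  "algebra_part (u + v) = algebra_part u + algebra_part v"
  "algebra_part (u - v) = algebra_part u - algebra_part v"
  "algebra_part (- u) = - algebra_part u"
  "algebra_part (u * v) = scalar_part u *\<^sub>C algebra_part v + scalar_part v *\<^sub>C algebra_part u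
     + algebra_part u * algebra_part v"
  "algebra_part (c *\<^sub>C u) = c *\<^sub>C algebra_part u"
  "algebra_part (r *\<^sub>R u) = complex_of_real r *\<^sub>C algebra_part u"
  "algebra_part (star u) = star (algebra_part u)"
  by (simp_all add: unitization_defs)

definition embed :: "'a \<Rightarrow> 'a::complex_star_algebra unitization" where
  "embed a = Unitization 0 a"

lemma embed_parts [simp]: "scalar_part (embed a) = 0" "algebra_part (embed a) = a"
  by (simp_all add: embed_def)

lemma embed_hom:
  "embed (a + b) = embed a + embed b" "embed (a - b) = embed a - embed b" "embed (- a) = - embed a"
  "embed (a * b) = embed a * embed b" "embed (c *\<^sub>C a) = c *\<^sub>C embed a" "embed (star a) = star (embed a)"
  "embed 0 = 0"
  by (simp_all add: unitization.expand)

lemma embed_sum: "embed (sum f A) = (\<Sum>i\<in>A. embed (f i))"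
  by (induction A rule: infinite_finite_induct) (simp_all add: embed_hom)

lemma embed_of_real: "embed (complex_of_real r *\<^sub>C a) = r *\<^sub>R embed a"
  by (simp add: unitization.expand)

lemma embed_algebra_part: "scalar_part u = 0 \<Longrightarrow> embed (algebra_part u) = u"
  by (simp add: unitization.expand)

definition unit_action :: "'a::complex_star_algebra unitization \<Rightarrow> 'a \<Rightarrow> 'a" where
  "unit_action u x = scalar_part u *\<^sub>C x + algebra_part u * x"

text \<open>The maximum with the scalar part is needed because a unit is adjoined even where one
  exists: if \<open>e\<close> is a unit of the algebra, \<open>1 - embed e\<close> acts as zero and
  the operator seminorm alone would not see it.\<close>

definition unit_seminorm :: "('a::complex_star_algebra \<Rightarrow> real) \<Rightarrow> 'a unitization \<Rightarrow> real" where
  "unit_seminorm p u = max (cmod (scalar_part u)) (star_action.opnorm unit_action p u)"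

lemma cstar_seminorm_scalar_part: "cstar_seminorm (\<lambda>u. cmod (scalar_part u))"
  unfolding cstar_seminorm_def
  by (auto intro: norm_triangle_ineq simp: norm_mult power2_eq_square)

context cstar_seminormed
begin

lemma unit_action_bound: "p (unit_action u x) \<le> (cmod (scalar_part u) + p (algebra_part u)) * p x"
  unfolding unit_action_def distrib_right
  by (rule order_trans[OF triangle]) (simp add: scale submult)

sublocale unit: star_action unit_action p
proof
  fix u v :: "'a unitization" and x y :: 'a and c
  show "unit_action (u + v) x = unit_action u x + unit_action v x"
    "unit_action (c *\<^sub>C u) x = c *\<^sub>C unit_action u x"
    "unit_action u (c *\<^sub>C x) = c *\<^sub>C unit_action u x"
    "unit_action (u * v) x = unit_action u (unit_action v x)"
    by (simp_all add: unit_action_def algebra_simps scaleC_add_right scaleC_add_left scaleC_scaleC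
      mult_scaleC_left mult_scaleC_right)
  show "\<exists>C. \<forall>x. p (unit_action u x) \<le> C * p x" using unit_action_bound by blast
  have "star (unit_action u x) * unit_action u x = star x * unit_action (star u * u) x"
    by (simp add: unit_action_def algebra_simps scaleC_add_right scaleC_add_left scaleC_scaleC
      mult_scaleC_left mult_scaleC_right star_add star_mult star_scaleC)
  then show "(p (unit_action u x))\<^sup>2 \<le> p x * p (unit_action (star u * u) x)"
    using submult[of "star x" "unit_action (star u * u) x"] by (simp flip: cstar)
qed (simp_all add: triangle scale)

lemma cstar_seminorm_unit_seminorm: "cstar_seminorm (unit_seminorm p)"
  unfolding unit_seminorm_def
  by (rule cstar_seminorm_max[OF cstar_seminorm_scalar_part unit.cstar_seminorm_opnorm])

lemma unit_seminormed: "cstar_seminormed_1 (unit_seminorm p)"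
  by (simp add: cstar_seminormed_1_def cstar_seminormed_def cstar_seminorm_unit_seminorm)

interpretation unitization: cstar_seminormed_1 "unit_seminorm p"
  by (rule unit_seminormed)

lemma unit_seminorm_scalar: "cmod (scalar_part u) \<le> unit_seminorm p u"
  by (simp add: unit_seminorm_def)

text \<open>Left multiplication by \<open>a\<close> is tested on \<open>star a\<close>, where the
  C*-identity turns the value into the square of \<open>p a\<close>.\<close>

lemma unit_seminorm_embed [simp]: "unit_seminorm p (embed a) = p a"
proof -
  have "unit.opnorm (embed a) \<le> p a"
    by (rule unit.opnorm_le) (simp_all add: unit_action_def submult)
  moreover have "p a \<le> unit.opnorm (embed a)"
  proof (cases "p a = 0")
    case False
    then have "p a > 0" using nonneg[of a] by linarith
    moreover have "p a * p a \<le> unit.opnorm (embed a) * p a"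
      using unit.act_le[of "embed a" "star a"] by (simp add: unit_action_def cstar' flip: power2_eq_square)
    ultimately show ?thesis by simp
  qed (simp add: unit.opnorm_nonneg)
  ultimately show ?thesis by (simp add: unit_seminorm_def max_def)
qed

lemma unit_seminorm_le: "unit_seminorm p u \<le> cmod (scalar_part u) + p (algebra_part u)"
  using unit.opnorm_le[OF unit_action_bound] by (simp add: unit_seminorm_def)

text \<open>With \<open>unit_seminorm_scalar\<close> and \<open>unit_seminorm_le\<close> this makes
  convergence in the unitization the same as convergence of both components, which is how
  completeness is inherited.\<close>

lemma unit_seminorm_algebra_part: "p (algebra_part u) \<le> cmod (scalar_part u) + unit_seminorm p u"
proof -
  have "embed (algebra_part u) = u - scalar_part u *\<^sub>C 1" by (simp add: unitization.expand)
  then have "p (algebra_part u) \<le> unit_seminorm p u + unit_seminorm p (scalar_part u *\<^sub>C 1)"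
    using unitization.triangle_diff by (metis unit_seminorm_embed)
  then show ?thesis
    using unitization.one_le mult_left_mono[OF unitization.one_le, of "cmod (scalar_part u)"]
    by (simp add: unitization.scale)
qed

lemma pos_embed_square: "unitization.pos (embed (star b * b))"
  unfolding embed_hom by (rule unitization.pos_star_mult)

lemma pos_embed_sum_squares: "unitization.pos (embed (\<Sum>i\<in>A. star (f i) * f i))"
  unfolding embed_sum by (intro unitization.pos_sum pos_embed_square)

lemma square_le_sum_squares:
  assumes "finite A" "i \<in> A" shows "(p (f i))\<^sup>2 \<le> p (\<Sum>j\<in>A. star (f j) * f j)"
proof -
  have "unit_seminorm p (embed (star (f i) * f i)) \<le> unit_seminorm p (\<Sum>j\<in>A. embed (star (f j) * f j))"
    by (rule unitization.mono_sum[OF assms]) (rule pos_embed_square)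
  then show ?thesis by (simp add: cstar flip: embed_sum)
qed

end

section \<open>Finitely supported matrices\<close>

text \<open>All the algebras \<open>M\<^sub>n(A)\<close> sit in the single type of finitely supported matrices.\<close>

definition supported :: "nat \<Rightarrow> (nat \<Rightarrow> nat \<Rightarrow> 'a::zero) \<Rightarrow> bool" where
  "supported n f \<longleftrightarrow> (\<forall>i j. n \<le> i \<or> n \<le> j \<longrightarrow> f i j = 0)"

typedef (overloaded) 'a fmat = "{f :: nat \<Rightarrow> nat \<Rightarrow> 'a::zero. \<exists>n. supported n f}"
  morphisms entry Fmat
  by (rule exI[of _ "\<lambda>i j. 0"]) (simp add: supported_def)

lemma supportedD: "supported n f \<Longrightarrow> n \<le> i \<or> n \<le> j \<Longrightarrow> f i j = 0"
  by (auto simp: supported_def)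

lemma supported_mono: "supported m f \<Longrightarrow> m \<le> n \<Longrightarrow> supported n f"
  by (auto simp: supported_def)

lemma fmat_eqI: "(\<And>i j. entry x i j = entry y i j) \<Longrightarrow> x = y"
  by (metis entry_inject ext)

lemma ex_supported: "\<exists>n. supported n (entry x)"
  using entry[of x] by simp

lemma ex_supported2: "\<exists>n. supported n (entry x) \<and> supported n (entry y)"
  by (meson ex_supported supported_mono max.cobounded1 max.cobounded2)

lemma ex_supported3: "\<exists>n. supported n (entry x) \<and> supported n (entry y) \<and> supported n (entry z)"
  by (meson ex_supported ex_supported2 supported_mono max.cobounded1 max.cobounded2)

lemma entry_Fmat: "supported n f \<Longrightarrow> entry (Fmat f) = f"
  by (rule Fmat_inverse) blast

text \<open>The least support bound of the left factor cuts the matrix product down to a finite sum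
  without a size parameter; \<open>entry_times\<close> then allows any support bound in its
  place.\<close>

definition fmat_dim :: "'a::zero fmat \<Rightarrow> nat" where
  "fmat_dim x = (LEAST n. supported n (entry x))"

lemma supported_fmat_dim: "supported (fmat_dim x) (entry x)"
  unfolding fmat_dim_def using ex_supported by (rule LeastI_ex)

lemma fmat_dim_le: "supported n (entry x) \<Longrightarrow> fmat_dim x \<le> n"
  unfolding fmat_dim_def by (rule Least_le)

instantiation fmat :: (complex_star_algebra) complex_star_algebra
begin

definition "0 = Fmat (\<lambda>i j. 0 :: 'a)"
definition "x + y = Fmat (\<lambda>i j. entry x i j + entry y i j :: 'a)"
definition "x - y = Fmat (\<lambda>i j. entry x i j - entry y i j :: 'a)"
definition "- x = Fmat (\<lambda>i j. - entry x i j :: 'a)"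
definition "x * y = Fmat (\<lambda>i j. \<Sum>k<fmat_dim x. entry x i k * entry y k j :: 'a)"
definition "c *\<^sub>C x = Fmat (\<lambda>i j. c *\<^sub>C entry x i j :: 'a)"
definition "star x = Fmat (\<lambda>i j. star (entry x j i) :: 'a)"

lemma entry_simps [simp]:
  fixes x y :: "'a fmat"
  shows "entry 0 i j = (0 :: 'a)"
    "entry (x + y) i j = entry x i j + entry y i j"
    "entry (x - y) i j = entry x i j - entry y i j"
    "entry (- x) i j = - entry x i j"
    "entry (c *\<^sub>C x) i j = c *\<^sub>C entry x i j"
    "entry (star x) i j = star (entry x j i)"
proof -
  obtain n where n: "supported n (entry x)" "supported n (entry y)" using ex_supported2 by blast
  have "supported n (\<lambda>i j. 0 :: 'a)" "supported n (\<lambda>i j. entry x i j + entry y i j)"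
    "supported n (\<lambda>i j. entry x i j - entry y i j)" "supported n (\<lambda>i j. - entry x i j)"
    "supported n (\<lambda>i j. c *\<^sub>C entry x i j)" "supported n (\<lambda>i j. star (entry x j i))"
    using n by (auto simp: supported_def)
  from this[THEN entry_Fmat] show "entry 0 i j = (0 :: 'a)"
    "entry (x + y) i j = entry x i j + entry y i j"
    "entry (x - y) i j = entry x i j - entry y i j"
    "entry (- x) i j = - entry x i j"
    "entry (c *\<^sub>C x) i j = c *\<^sub>C entry x i j"
    "entry (star x) i j = star (entry x j i)"
    by (simp_all add: zero_fmat_def plus_fmat_def minus_fmat_def uminus_fmat_def scaleC_fmat_def
        star_fmat_def)
qed

lemma entry_times:
  fixes x y :: "'a fmat"
  assumes "supported n (entry x)"
  shows "entry (x * y) i j = (\<Sum>k<n. entry x i k * entry y k j)"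
proof -
  have "(\<Sum>k<fmat_dim x. entry x i k * entry y k j) = (\<Sum>k<n. entry x i k * entry y k j)" for i j
    using fmat_dim_le[OF assms] supportedD[OF supported_fmat_dim[of x]]
    by (intro sum.mono_neutral_left) auto
  moreover obtain m where m: "supported m (entry x)" "supported m (entry y)"
    using ex_supported2 by blast
  then have "supported m (\<lambda>i j. \<Sum>k<fmat_dim x. entry x i k * entry y k j)"
    by (auto simp: supported_def intro!: sum.neutral)
  ultimately show ?thesis by (simp add: times_fmat_def entry_Fmat)
qed

instance
proof
  fix x y z :: "'a fmat" and c d :: complex
  obtain n where n: "supported n (entry x)" "supported n (entry y)" "supported n (entry z)"
    using ex_supported3 by blast
  have n': "supported n (entry (x * y))" "supported n (entry (x + y))" "supported n (entry (c *\<^sub>C x))"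
    using n by (auto simp: supported_def entry_times[OF n(1)] intro!: sum.neutral)
  note e = entry_times[OF n(1)] entry_times[OF n(2)] entry_times[OF n'(1)] entry_times[OF n'(2)]
    entry_times[OF n'(3)]
  show "x * y * z = x * (y * z)"
  proof (rule fmat_eqI)
    fix i j
    have "entry (x * y * z) i j = (\<Sum>k<n. \<Sum>l<n. entry x i l * (entry y l k * entry z k j))"
      by (simp add: e sum_distrib_right mult.assoc)
    also have "\<dots> = (\<Sum>l<n. \<Sum>k<n. entry x i l * (entry y l k * entry z k j))"
      by (rule sum.swap)
    also have "\<dots> = entry (x * (y * z)) i j" by (simp add: e sum_distrib_left)
    finally show "entry (x * y * z) i j = entry (x * (y * z)) i j" .
  qed
  show "star (x * y) = star y * star x"
  proof -
    have "supported n (entry (star y))" using n(2) by (auto simp: supported_def)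
    then show ?thesis by (intro fmat_eqI) (simp add: e entry_times[of n "star y"] star_sum star_mult)
  qed
  show "(x + y) * z = x * z + y * z" "x * (y + z) = x * y + x * z"
    "(c *\<^sub>C x) * y = c *\<^sub>C (x * y)" "x * (c *\<^sub>C y) = c *\<^sub>C (x * y)"
    by (rule fmat_eqI, simp add: e distrib_left distrib_right sum.distrib scaleC_sum_right
        mult_scaleC_left mult_scaleC_right)+
qed (rule fmat_eqI, simp add: add_ac scaleC_add_right scaleC_add_left scaleC_scaleC scaleC_one
    star_add star_scaleC)+

end

definition single :: "nat \<Rightarrow> nat \<Rightarrow> 'a::complex_star_algebra \<Rightarrow> 'a fmat" where
  "single i j a = Fmat (\<lambda>k l. if k = i \<and> l = j then a else 0)"

lemma entry_single: "entry (single i j a) k l = (if k = i \<and> l = j then a else 0)"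
proof -
  have "supported (Suc (i + j)) (\<lambda>k l. if k = i \<and> l = j then a else 0)"
    by (auto simp: supported_def)
  then show ?thesis by (simp add: single_def entry_Fmat)
qed

lemma entry_times_single:
  "entry (x * single i j a) k l = (if l = j then entry x k i * a else 0)"
proof -
  obtain n where n: "supported n (entry x)" using ex_supported by blast
  then have "entry (x * single i j a) k l = (\<Sum>m<n. if m = i then (if l = j then entry x k i * a else 0) else 0)"
    unfolding entry_times[OF n] entry_single by (intro sum.cong) auto
  also have "\<dots> = (if l = j then entry x k i * a else 0)"
    using supportedD[OF n, of k i] by (auto simp: not_less)
  finally show ?thesis .
qed

text \<open>The inner product of the Hilbert module of finitely supported columns; a column is represented
  by any matrix having it as column \<open>0\<close>.\<close>

definition col_inner :: "'a::complex_star_algebra fmat \<Rightarrow> 'a fmat \<Rightarrow> 'a" where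
  "col_inner v w = entry (star v * w) 0 0"

lemma col_inner_add_left: "col_inner (u + v) w = col_inner u w + col_inner v w"
  and col_inner_add_right: "col_inner u (v + w) = col_inner u v + col_inner u w"
  and col_inner_diff_left: "col_inner (u - v) w = col_inner u w - col_inner v w"
  and col_inner_diff_right: "col_inner u (v - w) = col_inner u v - col_inner u w"
  and col_inner_scale_left: "col_inner (c *\<^sub>C u) w = cnj c *\<^sub>C col_inner u w"
  and col_inner_scale_right: "col_inner u (c *\<^sub>C w) = c *\<^sub>C col_inner u w"
  and col_inner_mult: "col_inner (x * u) w = col_inner u (star x * w)"
  and star_col_inner: "star (col_inner u w) = col_inner w u"
proof -
  show "col_inner (u + v) w = col_inner u w + col_inner v w"
    "col_inner u (v + w) = col_inner u v + col_inner u w"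
    "col_inner (u - v) w = col_inner u w - col_inner v w"
    "col_inner u (v - w) = col_inner u v - col_inner u w"
    "col_inner (c *\<^sub>C u) w = cnj c *\<^sub>C col_inner u w"
    "col_inner u (c *\<^sub>C w) = c *\<^sub>C col_inner u w"
    "col_inner (x * u) w = col_inner u (star x * w)"
    by (simp_all add: col_inner_def star_add star_diff star_scaleC star_mult distrib_left distrib_right
        left_diff_distrib right_diff_distrib mult_scaleC_left mult_scaleC_right mult.assoc)
  have "star (col_inner u w) = entry (star (star u * w)) 0 0" unfolding col_inner_def by simp
  then show "star (col_inner u w) = col_inner w u" by (simp add: col_inner_def star_mult del: entry_simps)
qed

text \<open>Multiplying on the right by \<open>single 0 0 a\<close> realizes the right module
  structure: it multiplies column \<open>0\<close> by \<open>a\<close> from the right.\<close>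

lemma col_inner_single_right: "col_inner v (w * single 0 0 a) = col_inner v w * a"
  by (simp add: col_inner_def entry_times_single flip: mult.assoc)

lemma col_inner_single_left: "col_inner (v * single 0 0 a) w = star a * col_inner v w"
  by (metis col_inner_single_right star_col_inner star_mult star_star)

lemma col_inner_eq_sum:
  assumes "supported n (entry v)" shows "col_inner v w = (\<Sum>k<n. star (entry v k 0) * entry w k 0)"
proof -
  have "supported n (entry (star v))" using assms by (auto simp: supported_def)
  then show ?thesis by (simp add: col_inner_def entry_times)
qed

definition col_norm :: "('a::complex_star_algebra \<Rightarrow> real) \<Rightarrow> 'a fmat \<Rightarrow> real" where
  "col_norm p v = sqrt (p (col_inner v v))"

definition fmat_seminorm :: "('a::complex_star_algebra \<Rightarrow> real) \<Rightarrow> 'a fmat \<Rightarrow> real" where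
  "fmat_seminorm p = star_action.opnorm (*) (col_norm p)"

section \<open>The Hilbert module of columns and the operator seminorm of matrices\<close>

context cstar_seminormed
begin

interpretation unitization: cstar_seminormed_1 "unit_seminorm p"
  by (rule unit_seminormed)

lemma col_norm_nonneg: "0 \<le> col_norm p v"
  by (simp add: col_norm_def)

lemma col_norm_square: "(col_norm p v)\<^sup>2 = p (col_inner v v)"
  by (simp add: col_norm_def)

lemma pos_col_inner: "unitization.pos (embed (col_inner v v))"
proof -
  obtain n where "supported n (entry v)" using ex_supported by blast
  then show ?thesis by (simp only: col_inner_eq_sum pos_embed_sum_squares)
qed

lemma entry_le_col_norm: "p (entry v k 0) \<le> col_norm p v"
proof -
  obtain n where n: "supported n (entry v)" using ex_supported by blast
  show ?thesis
  proof (cases "k < n")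
    case True
    have "(p (entry v k 0))\<^sup>2 \<le> (col_norm p v)\<^sup>2"
      unfolding col_norm_square col_inner_eq_sum[OF n]
      using square_le_sum_squares[of "{..<n}" k "\<lambda>k. entry v k 0"] True by simp
    then show ?thesis by (rule power2_le_imp_le) (rule col_norm_nonneg)
  next
    case False
    then show ?thesis using supportedD[OF n, of k 0] col_norm_nonneg by simp
  qed
qed

text \<open>Positivity of the inner square of \<open>w - t v a\<close> with
  \<open>a = col_inner v w\<close>, together with \<open>col_inner v v \<le> B\<close> conjugated by
  \<open>a\<close>, bounds \<open>(2 t - t\<^sup>2 B) star a * a\<close> by
  \<open>col_inner w w\<close>. The order is read in the unitization; for positive \<open>B\<close>
  the optimal choice is \<open>t = 1 / B\<close>.\<close>

lemma cauchy_schwarz: "p (col_inner v w) \<le> col_norm p v * col_norm p w"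
proof -
  define a where "a = col_inner v w"
  define B where "B = p (col_inner v v)"
  define A where "A = embed (star a * a)"
  have B0: "B \<ge> 0" by (simp add: B_def)
  have A: "unitization.pos A" unfolding A_def by (rule pos_embed_square)
  have main: "(2 * t - t\<^sup>2 * B) * (p a)\<^sup>2 \<le> p (col_inner w w)" if t: "t \<ge> 0" "2 * t - t\<^sup>2 * B \<ge> 0" for t
  proof -
    let ?c = "complex_of_real t"
    define z where "z = w - ?c *\<^sub>C (v * single 0 0 a)"
    have wv: "col_inner w v = star a" by (simp add: a_def star_col_inner)
    have "col_inner z z = col_inner w w - ?c *\<^sub>C (star a * a) - ?c *\<^sub>C (star a * a)
        + complex_of_real (t\<^sup>2) *\<^sub>C (star a * col_inner v v * a)"
      by (simp add: z_def col_inner_diff_left col_inner_diff_right col_inner_scale_left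
          col_inner_scale_right col_inner_single_left col_inner_single_right wv scaleC_diff_right
          scaleC_scaleC mult_scaleC_left mult_scaleC_right power2_eq_square mult.assoc algebra_simps
          flip: a_def)
    then have z: "embed (col_inner z z) = embed (col_inner w w) - (2 * t) *\<^sub>R A
        + (t\<^sup>2) *\<^sub>R (star (embed a) * embed (col_inner v v) * embed a)"
      using scaleR_left.add[of t t A]
      by (simp add: embed_hom(1,2) embed_of_real A_def del: of_real_power) (simp add: embed_hom(4,6))
    have Bv: "unitization.pos (of_real B - embed (col_inner v v))"
      by (rule unitization.pos_sub_bound) (simp_all add: B_def unitization.posD pos_col_inner)
    have "star (embed a) * (of_real B - embed (col_inner v v)) * embed a
        = B *\<^sub>R A - star (embed a) * embed (col_inner v v) * embed a"
      by (simp add: A_def embed_hom of_real_def algebra_simps)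
    then have "unitization.pos (B *\<^sub>R A - star (embed a) * embed (col_inner v v) * embed a)"
      using unitization.pos_conj[OF Bv, of "embed a"] by simp
    then have "unitization.pos ((t\<^sup>2) *\<^sub>R (B *\<^sub>R A - star (embed a) * embed (col_inner v v) * embed a)
        + embed (col_inner z z))"
      by (intro unitization.pos_add unitization.pos_scaleR pos_col_inner) simp_all
    then have pos: "unitization.pos (embed (col_inner w w) - (2 * t - t\<^sup>2 * B) *\<^sub>R A)"
      unfolding z by (simp add: algebra_simps)
    have "unit_seminorm p ((2 * t - t\<^sup>2 * B) *\<^sub>R A) \<le> unit_seminorm p ((2 * t - t\<^sup>2 * B) *\<^sub>R A
        + (embed (col_inner w w) - (2 * t - t\<^sup>2 * B) *\<^sub>R A))"
      by (rule unitization.mono[OF unitization.pos_scaleR[OF A t(2)] pos])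
    then show ?thesis using t(2) by (simp add: unitization.scaleR A_def cstar)
  qed
  have "(p a)\<^sup>2 \<le> B * p (col_inner w w)"
  proof (cases "B = 0")
    case False
    then have B: "B > 0" using B0 by simp
    then have "(2 * (1 / B) - (1 / B)\<^sup>2 * B) = 1 / B" by (simp add: power2_eq_square)
    then show ?thesis using main[of "1 / B"] B by (simp add: field_simps)
  next
    \<comment> \<open>For \<open>B = 0\<close> the factor is \<open>2 t\<close>, which is unbounded,
      so \<open>p a\<close> has to vanish; the chosen \<open>t\<close> already gives a
      contradiction.\<close>
    case True
    have "(p a)\<^sup>2 = 0"
    proof (rule ccontr)
      assume "(p a)\<^sup>2 \<noteq> 0"
      then have pos: "(p a)\<^sup>2 > 0" by simp
      have "2 * (p (col_inner w w) / (p a)\<^sup>2 + 1) * (p a)\<^sup>2 \<le> p (col_inner w w)"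
        using main[of "p (col_inner w w) / (p a)\<^sup>2 + 1"] True by simp
      then have "2 * p (col_inner w w) + 2 * (p a)\<^sup>2 \<le> p (col_inner w w)"
        using pos by (simp add: field_simps)
      then show False using pos nonneg[of "col_inner w w"] by linarith
    qed
    then show ?thesis using B0 by simp
  qed
  also have "\<dots> = (col_norm p v * col_norm p w)\<^sup>2"
    by (simp add: power_mult_distrib col_norm_square B_def)
  finally show ?thesis unfolding a_def
    by (rule power2_le_imp_le) (simp add: col_norm_nonneg)
qed

text \<open>A crude bound by the entries is enough: it makes the operator seminorm finite and
  reduces convergence of matrices to convergence of entries.\<close>

lemma col_norm_mult_bound:
  assumes "supported n (entry x)"
  shows "col_norm p (x * v) \<le> (\<Sum>k<n. \<Sum>l<n. p (entry x k l)) * col_norm p v"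
proof -
  define r where "r k = (\<Sum>l<n. p (entry x k l))" for k
  have r: "r k \<ge> 0" for k by (simp add: r_def sum_nonneg)
  have e: "p (entry (x * v) k 0) \<le> r k * col_norm p v" for k
    unfolding entry_times[OF assms] r_def sum_distrib_right
    by (rule order_trans[OF sum_bound]) (intro sum_mono mult_le entry_le_col_norm order_refl)
  have n: "star (entry (x * v) k 0) * entry (x * v) k 0 = 0" if "k \<ge> n" for k
    using supportedD[OF assms, of k] that by (simp add: entry_times[OF assms])
  obtain m where m: "supported m (entry (x * v))" using ex_supported by blast
  \<comment> \<open>A support bound limits rows and columns alike, and \<open>x * v\<close> may have
    columns beyond \<open>n\<close>; its rows from \<open>n\<close> on vanish, so the sum over
    \<open>max m n\<close> shrinks to \<open>n\<close> terms.\<close>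
  have "(col_norm p (x * v))\<^sup>2 = p (\<Sum>k<max m n. star (entry (x * v) k 0) * entry (x * v) k 0)"
    unfolding col_norm_square by (subst col_inner_eq_sum[OF supported_mono[OF m max.cobounded1]]) rule
  also have "(\<Sum>k<max m n. star (entry (x * v) k 0) * entry (x * v) k 0)
      = (\<Sum>k<n. star (entry (x * v) k 0) * entry (x * v) k 0)"
    by (rule sum.mono_neutral_right) (auto simp: n not_less)
  also have "p \<dots> \<le> (\<Sum>k<n. (r k * col_norm p v)\<^sup>2)"
    by (rule order_trans[OF sum_bound]) (intro sum_mono, simp add: cstar power_mono e)
  also have "\<dots> = (\<Sum>k<n. r k * r k) * (col_norm p v)\<^sup>2"
    by (simp add: sum_distrib_left sum_distrib_right power2_eq_square mult_ac)
  also have "\<dots> \<le> (\<Sum>k<n. r k * (\<Sum>k<n. r k)) * (col_norm p v)\<^sup>2"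
    by (intro mult_right_mono sum_mono mult_left_mono r member_le_sum) (auto simp: r)
  also have "\<dots> = ((\<Sum>k<n. r k) * col_norm p v)\<^sup>2"
    by (simp add: power_mult_distrib power2_eq_square flip: sum_distrib_right)
  finally show ?thesis unfolding r_def
    by (rule power2_le_imp_le) (intro mult_nonneg_nonneg sum_nonneg col_norm_nonneg nonneg)
qed

lemma star_action_fmat: "star_action (*) (col_norm p)"
proof
  fix v w x :: "'a fmat" and c
  show "0 \<le> col_norm p v" by (rule col_norm_nonneg)
  show "col_norm p (c *\<^sub>C v) = cmod c * col_norm p v"
    by (simp add: col_norm_def col_inner_scale_left col_inner_scale_right scale real_sqrt_mult
        flip: mult.assoc)
  have wv: "p (col_inner w v) \<le> col_norm p v * col_norm p w"
    using cauchy_schwarz[of w v] by (simp add: mult.commute)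
  have "(col_norm p (v + w))\<^sup>2 = p (col_inner v v + col_inner v w + (col_inner w v + col_inner w w))"
    by (simp add: col_norm_square col_inner_add_left col_inner_add_right algebra_simps)
  also have "\<dots> \<le> p (col_inner v v) + p (col_inner v w) + (p (col_inner w v) + p (col_inner w w))"
    by (intro order_trans[OF triangle] add_mono triangle)
  also have "\<dots> \<le> (col_norm p v + col_norm p w)\<^sup>2"
    using wv cauchy_schwarz[of v w] by (simp add: power2_sum col_norm_square)
  finally show "col_norm p (v + w) \<le> col_norm p v + col_norm p w"
    by (rule power2_le_imp_le) (simp add: col_norm_nonneg)
  show "\<exists>C. \<forall>v. col_norm p (x * v) \<le> C * col_norm p v"
    using col_norm_mult_bound ex_supported by blast
  show "(col_norm p (x * v))\<^sup>2 \<le> col_norm p v * col_norm p (star x * x * v)"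
    using cauchy_schwarz[of v "star x * x * v"]
    by (simp add: col_norm_square col_inner_mult mult.assoc)
qed (simp_all add: distrib_right mult_scaleC_left mult_scaleC_right mult.assoc)

lemma cstar_seminorm_fmat_seminorm: "cstar_seminorm (fmat_seminorm p)"
  unfolding fmat_seminorm_def by (rule star_action.cstar_seminorm_opnorm[OF star_action_fmat])

lemma fmat_seminorm_le:
  assumes "supported n (entry x)"
  shows "fmat_seminorm p x \<le> (\<Sum>k<n. \<Sum>l<n. p (entry x k l))"
  unfolding fmat_seminorm_def
  by (intro star_action.opnorm_le[OF star_action_fmat] col_norm_mult_bound assms sum_nonneg nonneg)

text \<open>The matrix is tested on the column with the adjoint of the entry in row
  \<open>j\<close>; row \<open>i\<close> of the result is the entry times its adjoint.\<close>

lemma entry_le_fmat_seminorm: "p (entry x i j) \<le> fmat_seminorm p x"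
proof (cases "p (entry x i j) = 0")
  case True
  then show ?thesis
    by (simp add: fmat_seminorm_def star_action.opnorm_nonneg[OF star_action_fmat])
next
  case False
  then have pos: "p (entry x i j) > 0" using nonneg[of "entry x i j"] by linarith
  define v where "v = single j 0 (star (entry x i j))"
  have sup: "supported (Suc j) (entry v)" by (auto simp: v_def supported_def entry_single)
  have "col_inner v v = entry x i j * star (entry x i j)"
    unfolding col_inner_eq_sum[OF sup] by (simp add: v_def entry_single)
  then have v: "col_norm p v = p (entry x i j)" by (simp add: col_norm_def cstar')
  have "p (entry x i j) * p (entry x i j) = p (entry (x * v) i 0)"
    by (simp add: v_def entry_times_single cstar' power2_eq_square)
  also have "\<dots> \<le> col_norm p (x * v)" by (rule entry_le_col_norm)
  also have "\<dots> \<le> fmat_seminorm p x * p (entry x i j)"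
    unfolding fmat_seminorm_def v[symmetric] by (rule star_action.act_le[OF star_action_fmat])
  finally show ?thesis using pos by simp
qed

end

section \<open>Square roots and truncations in complete star algebras\<close>

text \<open>Used twice: with \<open>M\<close> the whole algebra, for truncations and decompositions
  in the domain of a map, and with \<open>M\<close> the \<open>n\<close> by \<open>n\<close>
  matrices, for their roots.\<close>

locale complete_star_subalgebra =
  fixes I :: "'i set" and R :: "'i \<Rightarrow> 'm::complex_star_algebra \<Rightarrow> real" and M :: "'m set"
  assumes index_nonempty: "I \<noteq> {}"
    and seminorm: "i \<in> I \<Longrightarrow> cstar_seminorm (R i)"
    and add_closed: "x \<in> M \<Longrightarrow> y \<in> M \<Longrightarrow> x + y \<in> M"
    and mult_closed: "x \<in> M \<Longrightarrow> y \<in> M \<Longrightarrow> x * y \<in> M"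
    and scale_closed: "x \<in> M \<Longrightarrow> c *\<^sub>C x \<in> M"
    and star_closed: "x \<in> M \<Longrightarrow> star x \<in> M"
    and zero_closed: "0 \<in> M"
    and separating: "x \<in> M \<Longrightarrow> (\<And>i. i \<in> I \<Longrightarrow> R i x = 0) \<Longrightarrow> x = 0"
    and complete: "(\<And>n. X n \<in> M) \<Longrightarrow>
      (\<And>i e. i \<in> I \<Longrightarrow> e > 0 \<Longrightarrow> \<exists>N. \<forall>m\<ge>N. \<forall>n\<ge>N. R i (X m - X n) < e) \<Longrightarrow>
      \<exists>x\<in>M. \<forall>i\<in>I. (\<lambda>n. R i (X n - x)) \<longlonglongrightarrow> 0"
begin

lemma seminormed: "i \<in> I \<Longrightarrow> cstar_seminormed (R i)"
  by (simp add: cstar_seminormed_def seminorm)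

sublocale unit: complete_seminorm_family I "\<lambda>i. unit_seminorm (R i)" "{u. algebra_part u \<in> M}"
proof
  fix i and x y :: "'m unitization" and r :: real
  show "cstar_seminorm (unit_seminorm (R i))" if "i \<in> I"
    using seminormed[OF that] by (rule cstar_seminormed.cstar_seminorm_unit_seminorm)
  show "1 \<in> {u::'m unitization. algebra_part u \<in> M}" by (simp add: zero_closed)
  show "x + y \<in> {u. algebra_part u \<in> M}" "x * y \<in> {u. algebra_part u \<in> M}"
    if "x \<in> {u. algebra_part u \<in> M}" "y \<in> {u. algebra_part u \<in> M}"
    using that by (auto intro!: add_closed mult_closed scale_closed)
  show "r *\<^sub>R x \<in> {u. algebra_part u \<in> M}" "star x \<in> {u. algebra_part u \<in> M}"
    if "x \<in> {u. algebra_part u \<in> M}"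
    using that by (auto intro: scale_closed star_closed)
  show "x = 0" if x: "x \<in> {u. algebra_part u \<in> M}" and 0: "\<And>i. i \<in> I \<Longrightarrow> unit_seminorm (R i) x = 0"
  proof -
    have sc: "scalar_part x = 0"
    proof -
      obtain i where i: "i \<in> I" using index_nonempty by blast
      interpret cstar_seminormed "R i" by (rule seminormed[OF i])
      show ?thesis using unit_seminorm_scalar[of x] 0[OF i] by simp
    qed
    have "algebra_part x = 0"
    proof (rule separating)
      show "algebra_part x \<in> M" using x by simp
      fix i assume i: "i \<in> I"
      interpret cstar_seminormed "R i" by (rule seminormed[OF i])
      show "R i (algebra_part x) = 0"
        using unit_seminorm_algebra_part[of x] 0[OF i] sc nonneg[of "algebra_part x"] by simp
    qed
    with sc show "x = 0" by (simp add: unitization.expand)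
  qed
next
  fix X :: "nat \<Rightarrow> 'm unitization"
  assume X: "\<And>n. X n \<in> {u. algebra_part u \<in> M}"
    and cauchy: "\<And>i e. i \<in> I \<Longrightarrow> 0 < e \<Longrightarrow> \<exists>N. \<forall>m\<ge>N. \<forall>n\<ge>N. unit_seminorm (R i) (X m - X n) < e"
  have "Cauchy (\<lambda>n. scalar_part (X n))"
  proof (rule CauchyI)
    fix e :: real assume e: "0 < e"
    obtain i where i: "i \<in> I" using index_nonempty by blast
    interpret cstar_seminormed "R i" by (rule seminormed[OF i])
    obtain N where N: "\<And>m n. m \<ge> N \<Longrightarrow> n \<ge> N \<Longrightarrow> unit_seminorm (R i) (X m - X n) < e"
      using cauchy[OF i e] by blast
    have "norm (scalar_part (X m) - scalar_part (X n)) < e" if "m \<ge> N" "n \<ge> N" for m n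
      using unit_seminorm_scalar[of "X m - X n"] N[OF that] by simp
    then show "\<exists>N. \<forall>m\<ge>N. \<forall>n\<ge>N. norm (scalar_part (X m) - scalar_part (X n)) < e" by blast
  qed
  then obtain c where c: "(\<lambda>n. scalar_part (X n)) \<longlonglongrightarrow> c"
    using Cauchy_convergent_iff convergent_def by blast
  have "\<exists>a\<in>M. \<forall>i\<in>I. (\<lambda>n. R i (algebra_part (X n) - a)) \<longlonglongrightarrow> 0"
  proof (rule complete)
    show "algebra_part (X n) \<in> M" for n using X[of n] by simp
    fix i and e :: real assume i: "i \<in> I" and e: "0 < e"
    interpret cstar_seminormed "R i" by (rule seminormed[OF i])
    obtain N where N: "\<And>m n. m \<ge> N \<Longrightarrow> n \<ge> N \<Longrightarrow> unit_seminorm (R i) (X m - X n) < e / 2"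
      using cauchy[OF i, of "e / 2"] e by auto
    have "R i (algebra_part (X m) - algebra_part (X n)) < e" if "m \<ge> N" "n \<ge> N" for m n
      using unit_seminorm_algebra_part[of "X m - X n"] unit_seminorm_scalar[of "X m - X n"] N[OF that]
      by simp
    then show "\<exists>N. \<forall>m\<ge>N. \<forall>n\<ge>N. R i (algebra_part (X m) - algebra_part (X n)) < e" by blast
  qed
  then obtain a where a: "a \<in> M" "\<And>i. i \<in> I \<Longrightarrow> (\<lambda>n. R i (algebra_part (X n) - a)) \<longlonglongrightarrow> 0" by blast
  show "\<exists>x\<in>{u. algebra_part u \<in> M}. \<forall>i\<in>I. (\<lambda>n. unit_seminorm (R i) (X n - x)) \<longlonglongrightarrow> 0"
  proof (intro bexI[of _ "Unitization c a"] ballI)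
    fix i assume i: "i \<in> I"
    interpret cstar_seminormed "R i" by (rule seminormed[OF i])
    interpret unitization: cstar_seminormed_1 "unit_seminorm (R i)" by (rule unit_seminormed)
    have "(\<lambda>n. cmod (scalar_part (X n) - c) + R i (algebra_part (X n) - a)) \<longlonglongrightarrow> 0 + 0"
      using c by (intro tendsto_add a i tendsto_norm_zero) (simp add: LIM_zero)
    then have lim: "(\<lambda>n. cmod (scalar_part (X n) - c) + R i (algebra_part (X n) - a)) \<longlonglongrightarrow> 0"
      by simp
    show "(\<lambda>n. unit_seminorm (R i) (X n - Unitization c a)) \<longlonglongrightarrow> 0"
    proof (rule tendsto_sandwich[OF _ _ tendsto_const lim])
      show "\<forall>\<^sub>F n in sequentially. unit_seminorm (R i) (X n - Unitization c a)
          \<le> cmod (scalar_part (X n) - c) + R i (algebra_part (X n) - a)"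
        using unit_seminorm_le[of "X n - Unitization c a" for n] by (intro always_eventually) simp
    qed simp
  qed (simp add: a)
qed

definition psd :: "'m \<Rightarrow> bool" where
  "psd a \<longleftrightarrow> star a = a \<and> (\<forall>i\<in>I. unit.psd i (embed a))"

lemma psd_add: "psd a \<Longrightarrow> psd b \<Longrightarrow> psd (a + b)"
  unfolding psd_def by (auto simp: star_add embed_hom intro: cstar_seminormed_1.pos_add unit.seminormed)

lemma psd_scale: "psd a \<Longrightarrow> 0 \<le> r \<Longrightarrow> psd (complex_of_real r *\<^sub>C a)"
  unfolding psd_def embed_of_real
  by (auto simp: star_scaleC intro: cstar_seminormed_1.pos_scaleR unit.seminormed)

lemma psd_zero: "psd 0"
  unfolding psd_def embed_hom by (auto intro: cstar_seminormed_1.pos_zero unit.seminormed)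

lemma psd_square: "psd (star b * b)"
  unfolding psd_def embed_hom by (auto simp: star_mult intro: cstar_seminormed_1.pos_star_mult unit.seminormed)

lemma psd_limit:
  assumes "a \<in> M" "\<And>n. X n \<in> M" "\<And>n. psd (X n)" "\<And>i. i \<in> I \<Longrightarrow> (\<lambda>n. R i (X n - a)) \<longlonglongrightarrow> 0"
  shows "psd a"
proof -
  have minus_closed: "x - y \<in> M" if "x \<in> M" "y \<in> M" for x y
    using add_closed[OF that(1) scale_closed[OF that(2), of "-1"]] by (simp add: scaleC_one)
  have "star a - a = 0"
  proof (rule separating)
    show "star a - a \<in> M" by (intro minus_closed star_closed assms)
    fix i assume i: "i \<in> I"
    interpret cstar_seminormed "R i" by (rule seminormed[OF i])
    have "R i (star a - a) \<le> 2 * R i (X n - a)" for n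
      using triangle_diff[of "X n - a" "X n - star a"] star[of "X n - a"] assms(3)[of n]
      by (simp add: star_diff psd_def)
    then have "R i (star a - a) \<le> 0"
      using LIMSEQ_le_const[OF tendsto_mult_right_zero[OF assms(4)[OF i], of 2]] by blast
    then show "R i (star a - a) = 0" using nonneg[of "star a - a"] by linarith
  qed
  then have sa: "star a = a" by simp
  moreover have "unit.psd i (embed a)" if i: "i \<in> I" for i
  proof -
    interpret cstar_seminormed "R i" by (rule seminormed[OF i])
    interpret unitization: cstar_seminormed_1 "unit_seminorm (R i)" by (rule unit_seminormed)
    show ?thesis
    proof (rule unitization.pos_limit)
      show "star (embed a) = embed a" by (simp add: sa flip: embed_hom)
      show "unitization.pos (embed (X n))" for n using assms(3) i by (simp add: psd_def)
      show "(\<lambda>n. unit_seminorm (R i) (embed a - embed (X n))) \<longlonglongrightarrow> 0"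
        using assms(4)[OF i] by (simp add: minus_commute[of a] flip: embed_hom)
    qed
  qed
  ultimately show ?thesis by (simp add: psd_def)
qed

lemma psd_sum: "(\<And>k. k \<in> A \<Longrightarrow> psd (f k)) \<Longrightarrow> psd (sum f A)"
  by (induction A rule: infinite_finite_induct) (auto intro: psd_add psd_zero)

text \<open>The root is taken in the unitization. The square of its scalar part is the scalar part
  of \<open>embed a\<close>, that is \<open>0\<close>, so the root falls back into
  \<open>M\<close>.\<close>

lemma ex_psd_sqrt:
  assumes "psd a" "a \<in> M"
  obtains b where "b \<in> M" "psd b" "b * b = a" "\<And>z. z \<in> M \<Longrightarrow> z * a = a * z \<Longrightarrow> z * b = b * z"
proof -
  have a: "embed a \<in> {u. algebra_part u \<in> M}" "star (embed a) = embed a"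
    "\<And>i. i \<in> I \<Longrightarrow> unit.psd i (embed a)"
    using assms by (auto simp: psd_def simp flip: embed_hom)
  obtain u where u: "u \<in> {u. algebra_part u \<in> M}" "star u = u" "u * u = embed a"
    "\<And>i. i \<in> I \<Longrightarrow> unit.psd i u"
    "\<And>z. z \<in> {u. algebra_part u \<in> M} \<Longrightarrow> z * embed a = embed a * z \<Longrightarrow> z * u = u * z"
    using unit.ex_sqrt[OF a] by blast
  have "scalar_part u * scalar_part u = 0" using arg_cong[OF u(3), of scalar_part] by simp
  then have e: "embed (algebra_part u) = u" by (simp add: embed_algebra_part)
  show ?thesis
  proof (rule that[of "algebra_part u"])
    show "algebra_part u \<in> M" using u(1) by simp
    show "psd (algebra_part u)"
      unfolding psd_def e using u(4) arg_cong[OF u(2), of algebra_part] by simp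
    have "algebra_part (embed (algebra_part u) * embed (algebra_part u)) = algebra_part (embed a)"
      unfolding e u(3) ..
    then show "algebra_part u * algebra_part u = a" by simp
    fix z assume z: "z \<in> M" "z * a = a * z"
    then have "embed z * u = u * embed z" by (intro u(5)) (simp_all flip: embed_hom)
    then have "algebra_part (embed z * embed (algebra_part u))
        = algebra_part (embed (algebra_part u) * embed z)" by (simp only: e)
    then show "z * algebra_part u = algebra_part u * z" by simp
  qed
qed

text \<open>Here \<open>r\<close> is the absolute value of \<open>a\<close>, and \<open>b\<close>,
  \<open>c\<close> are the positive and negative parts. Positivity of \<open>r - a\<close> and
  \<open>r + a\<close> follows by comparing squares; the bounds hold because \<open>r\<close> and
  \<open>a\<close> have the same seminorms.\<close>

lemma ex_psd_parts:
  assumes "a \<in> M" "star a = a"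
  obtains b c where "psd b" "psd c" "a = b - c"
    "\<And>i. i \<in> I \<Longrightarrow> R i b \<le> R i a" "\<And>i. i \<in> I \<Longrightarrow> R i c \<le> R i a"
proof -
  obtain r where r: "r \<in> M" "psd r" "r * r = a * a" "a * r = r * a"
    using ex_psd_sqrt[of "a * a"] psd_square[of a] assms mult_closed by (metis mult.assoc)
  define b where "b = (1/2) *\<^sub>C (r + a)"
  define c where "c = (1/2) *\<^sub>C (r - a)"
  have rs: "star r = r" using r(2) by (simp add: psd_def)
  have "psd (r - x)" if "x = a \<or> x = - a" for x
    unfolding psd_def
  proof (intro conjI ballI)
    show "star (r - x) = r - x" using that rs assms by (auto simp: star_diff star_add)
    fix i assume i: "i \<in> I"
    interpret unitization: cstar_seminormed_1 "unit_seminorm (R i)" by (rule unit.seminormed[OF i])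
    show "unitization.pos (embed (r - x))"
      unfolding embed_hom(2)
    proof (rule unitization.pos_diff_of_square_le)
      show "unitization.pos (embed r)" using r(2) i by (simp add: psd_def)
      show "unitization.pos (embed r * embed r - embed x * embed x)"
        using that r(3) by (auto simp flip: embed_hom(2,4)) (simp_all add: embed_hom(7))
    qed (use that assms r(4) in \<open>auto simp flip: embed_hom(3,4,6)\<close>)
  qed
  from this[of a] this[of "- a"] have "psd (r - a)" "psd (r + a)" by simp_all
  then have "psd b" "psd c"
    using psd_scale[of "r + a" "1/2"] psd_scale[of "r - a" "1/2"] by (simp_all add: b_def c_def)
  moreover have "a = b - c"
  proof -
    have "b - c = (1/2) *\<^sub>C (a + a)" by (simp add: b_def c_def flip: scaleC_diff_right)
    also have "\<dots> = (1/2 + 1/2) *\<^sub>C a" by (simp only: scaleC_add_right scaleC_add_left)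
    finally show ?thesis by (simp add: scaleC_one)
  qed
  moreover have "R i b \<le> R i a \<and> R i c \<le> R i a" if i: "i \<in> I" for i
  proof -
    interpret cstar_seminormed "R i" by (rule seminormed[OF i])
    have "(R i r)\<^sup>2 = (R i a)\<^sup>2" using cstar[of r] cstar[of a] rs assms r(3) by simp
    then have "R i r = R i a" by (rule power2_eq_imp_eq) simp_all
    then show ?thesis
      using triangle[of r a] triangle_diff[of r a] by (simp add: b_def c_def scale)
  qed
  ultimately show ?thesis using that by blast
qed

text \<open>The truncation \<open>min a 1\<close> is \<open>(1 + a - \<bar>1 - a\<bar>)/2\<close>.\<close>

lemma ex_truncation:
  assumes a: "psd a" "a \<in> M" and i: "i \<in> I" "R i a \<le> 1"
  obtains b where "b \<in> M" "psd b" "\<And>j. j \<in> I \<Longrightarrow> R j b \<le> 1" "R i (b - a) = 0"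
proof -
  define x where "x = 1 - embed a"
  have as: "star (embed a) = embed a" using a by (simp add: psd_def flip: embed_hom)
  then have x: "star x = x" "x \<in> {u. algebra_part u \<in> M}"
    using a scale_closed[of a "-1"] by (simp_all add: x_def star_diff scaleC_one)
  have xx: "x * x \<in> {u. algebra_part u \<in> M}" "star (x * x) = x * x"
    by (rule unit.mult_closed[OF x(2) x(2)]) (simp add: star_mult x(1))
  have "unit.psd j (x * x)" if "j \<in> I" for j
    using x by (intro cstar_seminormed_1.pos_square unit.seminormed that)
  then obtain r where r: "r \<in> {u. algebra_part u \<in> M}" "star r = r" "r * r = x * x"
    "\<And>i. i \<in> I \<Longrightarrow> unit.psd i r"
    and comm: "\<And>z. z \<in> {u. algebra_part u \<in> M} \<Longrightarrow> z * (x * x) = x * x * z \<Longrightarrow> z * r = r * z"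
    using unit.ex_sqrt[OF xx] by metis
  have xr: "x * r = r * x" by (rule comm[OF x(2)]) (simp add: mult.assoc)
  have "scalar_part r * scalar_part r = 1"
    using arg_cong[OF r(3), of scalar_part] by (simp add: x_def)
  then have "scalar_part r = 1 \<or> scalar_part r = - 1" by (simp add: square_eq_1_iff)
  \<comment> \<open>A root with scalar part \<open>-1\<close> would give \<open>s - r\<close> the
    scalar part \<open>s + 1\<close>, too large for positivity. The value \<open>1\<close> is what
    makes the scalar part of \<open>w\<close> vanish, so that the truncation lies in the algebra
    itself.\<close>
  moreover have "scalar_part r \<noteq> - 1"
  proof
    interpret cstar_seminormed "R i" by (rule seminormed[OF i(1)])
    interpret unitization: cstar_seminormed_1 "unit_seminorm (R i)" by (rule unit_seminormed)
    assume neg: "scalar_part r = - 1"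
    obtain s where s: "s > 0" "unit_seminorm (R i) (of_real s - r) \<le> s + 1/2"
      using unitization.posE[OF r(4)[OF i(1)], of "1/2" 0] by auto
    have "cmod (scalar_part (of_real s - r)) \<le> s + 1/2"
      using unit_seminorm_scalar s(2) by (rule order_trans)
    moreover have "scalar_part (of_real s - r) = complex_of_real (s + 1)"
      by (simp add: neg of_real_def scaleR_add_left)
    ultimately show False using s(1) by (simp only: norm_of_real)
  qed
  ultimately have sr: "scalar_part r = 1" by blast
  define w where "w = (1/2) *\<^sub>R (1 + embed a - r)"
  define b where "b = algebra_part w"
  have "scalar_part w = 0" by (simp add: w_def sr)
  then have w: "embed b = w" by (simp add: b_def embed_algebra_part)
  have ws: "star w = w" by (simp add: w_def star_add star_diff as r)
  have ar: "embed a * r = r * embed a" using xr by (simp add: x_def algebra_simps)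
  have pos: "unit.psd j w" "unit.psd j (1 - w)" if j: "j \<in> I" for j
  proof -
    interpret unitization: cstar_seminormed_1 "unit_seminorm (R j)" by (rule unit.seminormed[OF j])
    have aj: "unitization.pos (embed a)" using a j by (simp add: psd_def)
    \<comment> \<open>The product with \<open>1 + a + r\<close>, which is at least \<open>1\<close>,
      equals \<open>(1 + a)\<^sup>2 - (1 - a)\<^sup>2 = 4 a\<close>; the factor can therefore be
      cancelled.\<close>
    have "unitization.pos (1 + embed a - r)"
    proof (rule unitization.pos_cancel_commuting)
      show "unitization.pos ((1 + embed a + r) - of_real 1)"
        using unitization.pos_add[OF aj r(4)[OF j]] by simp
      have "(1 + embed a + r) * (1 + embed a - r) = (1 + embed a) * (1 + embed a) - r * r"
        using ar by (simp add: algebra_simps)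
      also have "\<dots> = 4 *\<^sub>R embed a"
        using scaleR_left.add[of 2 2 "embed a"] by (simp add: r(3) x_def algebra_simps scaleR_2)
      finally show "unitization.pos ((1 + embed a + r) * (1 + embed a - r))"
        by (simp add: unitization.pos_scaleR aj)
    qed (simp_all add: ar algebra_simps star_add star_diff as r)
    then show "unitization.pos w" unfolding w_def by (intro unitization.pos_scaleR) simp_all
    have "unitization.pos (r - (- x))"
      by (rule unitization.pos_diff_of_square_le[OF r(4)[OF j]]) (simp_all add: x(1) r(3) xr)
    moreover have "1 - w = (1/2) *\<^sub>R (r - (- x))"
    proof -
      have "2 *\<^sub>R (1 - w) = r - (- x)" by (simp add: w_def x_def scaleR_right_diff_distrib) (simp add: scaleR_2)
      then show ?thesis by (metis scaleR_half_double scaleR_2 scaleR_right_distrib)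
    qed
    ultimately show "unitization.pos (1 - w)" by (simp add: unitization.pos_scaleR del: diff_minus_eq_add)
  qed
  show ?thesis
  proof (rule that[of b])
    have "1 + embed a - r \<in> {u. algebra_part u \<in> M}"
      using a(2) by (intro unit.add_closed unit.diff_closed unit.one_closed r) simp
    then have "w \<in> {u. algebra_part u \<in> M}" unfolding w_def by (rule unit.scaleR_closed)
    then show "b \<in> M" by (simp add: b_def)
    show "psd b"
      unfolding psd_def w using pos(1) arg_cong[OF ws, of algebra_part] by (simp add: b_def)
    show "R j b \<le> 1" if j: "j \<in> I" for j
    proof -
      interpret cstar_seminormed "R j" by (rule seminormed[OF j])
      interpret unitization: cstar_seminormed_1 "unit_seminorm (R j)" by (rule unit_seminormed)
      have "unit_seminorm (R j) w \<le> 1"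
        using unitization.norm_le_of_order[of 1 w] pos[OF j] unitization.pos_add[OF unitization.pos_one]
        by simp
      then show ?thesis by (simp flip: w)
    qed
    interpret cstar_seminormed "R i" by (rule seminormed[OF i(1)])
    interpret unitization: cstar_seminormed_1 "unit_seminorm (R i)" by (rule unit_seminormed)
    \<comment> \<open>For the index \<open>i\<close> the element \<open>1 - a\<close> is itself
      positive, so by uniqueness of roots it agrees with \<open>r\<close> up to a null element: the
      truncation leaves \<open>a\<close> unchanged there.\<close>
    have "unitization.pos x"
      using unitization.pos_sub_bound[of "embed a" 1] as i(2) by (simp add: x_def)
    then have "(unit_seminorm (R i) (x - r))\<^sup>2 \<le> unit_seminorm (R i) (x * x - r * r)"
      using r(4)[OF i(1)] xr by (intro unitization.norm_diff_square_le)
    then have "unit_seminorm (R i) (x - r) = 0" by (simp add: r(3))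
    moreover have "2 *\<^sub>R embed (b - a) = x - r"
      by (simp add: embed_hom w w_def x_def scaleR_right_diff_distrib) (simp add: scaleR_2)
    then have "unit_seminorm (R i) (x - r) = 2 * R i (b - a)"
      using unitization.scaleR[of 2 "embed (b - a)"] by simp
    ultimately show "R i (b - a) = 0" by simp
  qed
qed

end

section \<open>Locally C*-algebras\<close>

context locally_cstar_algebra
begin

lemma seminormed: "l \<in> L \<Longrightarrow> cstar_seminormed (p l)"
  by (simp add: cstar_seminormed_def seminorms)

text \<open>Nested balls make the inner infimum a filter base and directedness of the family the
  outer one, so one index and one radius witness every entourage.\<close>

lemma eventually_uniformity_iff:
  "eventually P uniformity \<longleftrightarrow> (\<exists>l\<in>L. \<exists>e>0. \<forall>x y. p l (x - y) < e \<longrightarrow> P (x, y))"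
proof -
  let ?F = "\<lambda>l. INF e\<in>{0<..}. principal {(x, y). p l (x - y) < e}"
  have "eventually P (?F l) \<longleftrightarrow> (\<exists>e\<in>{0<..}. eventually P (principal {(x, y). p l (x - y) < e}))" for l
  proof (rule eventually_INF_base)
    fix a b :: real assume "a \<in> {0<..}" "b \<in> {0<..}"
    then show "\<exists>c\<in>{0<..}. principal {(x, y). p l (x - y) < c}
        \<le> inf (principal {(x, y). p l (x - y) < a}) (principal {(x, y). p l (x - y) < b})"
      by (intro bexI[of _ "min a b"]) auto
  qed (auto intro: exI[of _ 1])
  then have F: "eventually P (?F l) \<longleftrightarrow> (\<exists>e>0. \<forall>x y. p l (x - y) < e \<longrightarrow> P (x, y))" for l
    by (auto simp: eventually_principal)
  have "eventually P (INF l\<in>L. ?F l) \<longleftrightarrow> (\<exists>l\<in>L. eventually P (?F l))"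
  proof (rule eventually_INF_base[OF index_nonempty])
    fix l m assume "l \<in> L" "m \<in> L"
    then obtain k where k: "k \<in> L" "\<And>x. p l x \<le> p k x" "\<And>x. p m x \<le> p k x"
      using upward_filtered by blast
    have "?F k \<le> ?F l" "?F k \<le> ?F m"
      using k by (auto intro!: INF_mono intro: le_less_trans)
    then show "\<exists>k\<in>L. ?F k \<le> inf (?F l) (?F m)" using k(1) by auto
  qed
  then show ?thesis unfolding uniformity_seminorms F .
qed

lemma separating:
  assumes "\<And>l. l \<in> L \<Longrightarrow> p l x = 0" shows "x = 0"
proof (rule ccontr)
  assume "x \<noteq> 0"
  then obtain U where U: "open U" "0 \<in> U" "x \<notin> U" by (metis t1_space)
  have "eventually (\<lambda>y. y \<in> U) (nhds 0)" by (rule eventually_nhds_in_open[OF U(1,2)])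
  then obtain l e where l: "l \<in> L" "e > 0" "\<And>y. p l (0 - y) < e \<Longrightarrow> y \<in> U"
    unfolding eventually_nhds_uniformity eventually_uniformity_iff by auto
  interpret cstar_seminormed "p l" by (rule seminormed[OF l(1)])
  show False using l(2) l(3)[of x] U(3) assms[OF l(1)] by simp
qed

lemma sequentially_complete:
  assumes "\<And>l e. l \<in> L \<Longrightarrow> e > 0 \<Longrightarrow> \<exists>N. \<forall>m\<ge>N. \<forall>n\<ge>N. p l (X m - X n) < e"
  shows "\<exists>x. \<forall>l\<in>L. (\<lambda>n. p l (X n - x)) \<longlonglongrightarrow> 0"
proof -
  have "Cauchy X"
    unfolding Cauchy_uniform_iff eventually_uniformity_iff using assms by meson
  then obtain x where x: "filtermap X sequentially \<le> nhds x"
    using complete_UNIV unfolding complete_uniform Cauchy_uniform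
    by (metis filtermap_bot_iff principal_eq_bot_iff sequentially_bot top_greatest principal_UNIV UNIV_I)
  have "(\<lambda>n. p l (X n - x)) \<longlonglongrightarrow> 0" if l: "l \<in> L" for l
  proof (rule tendstoI)
    interpret cstar_seminormed "p l" by (rule seminormed[OF l])
    fix e :: real assume "e > 0"
    then have "eventually (\<lambda>y. p l (x - y) < e) (nhds x)"
      unfolding eventually_nhds_uniformity eventually_uniformity_iff using l by auto
    then have "eventually (\<lambda>n. p l (x - X n) < e) sequentially"
      using filter_leD[OF x] by (simp add: eventually_filtermap)
    then show "\<forall>\<^sub>F n in sequentially. dist (p l (X n - x)) 0 < e"
      by (simp add: minus_commute[of x])
  qed
  then show ?thesis by blast
qed

sublocale complete: complete_star_subalgebra L p UNIV
  using index_nonempty seminorms separating sequentially_complete by unfold_locales auto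

text \<open>The matrix seminorm dominates each entry and is dominated by the sum over the entries,
  so separation and completeness are checked entrywise.\<close>

lemma complete_star_subalgebra_fmat:
  "complete_star_subalgebra L (\<lambda>l. fmat_seminorm (p l)) {x. supported n (entry x)}"
proof
  show "L \<noteq> {}" by (rule index_nonempty)
  show "cstar_seminorm (fmat_seminorm (p l))" if "l \<in> L" for l
    using seminormed[OF that] by (rule cstar_seminormed.cstar_seminorm_fmat_seminorm)
  fix x y :: "'a fmat" and c
  assume x: "x \<in> {x. supported n (entry x)}"
  show "c *\<^sub>C x \<in> {x. supported n (entry x)}" "star x \<in> {x. supported n (entry x)}"
    using x by (auto simp: supported_def)
  show "x = 0" if 0: "\<And>l. l \<in> L \<Longrightarrow> fmat_seminorm (p l) x = 0"
  proof (rule fmat_eqI)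
    fix i j
    have "entry x i j = 0"
    proof (rule separating)
      fix l assume l: "l \<in> L"
      interpret cstar_seminormed "p l" by (rule seminormed[OF l])
      show "p l (entry x i j) = 0"
        using entry_le_fmat_seminorm[of x i j] 0[OF l] nonneg[of "entry x i j"] by simp
    qed
    then show "entry x i j = entry 0 i j" by simp
  qed
  assume y: "y \<in> {x. supported n (entry x)}"
  show "x + y \<in> {x. supported n (entry x)}" using x y by (auto simp: supported_def)
  have "supported n (entry x)" using x by simp
  then show "x * y \<in> {x. supported n (entry x)}"
    using x y by (auto simp: supported_def entry_times intro!: sum.neutral)
next
  show "(0 :: 'a fmat) \<in> {x. supported n (entry x)}" by (simp add: supported_def)
  fix X :: "nat \<Rightarrow> 'a fmat"
  assume X: "\<And>k. X k \<in> {x. supported n (entry x)}"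
    and cauchy: "\<And>l e. l \<in> L \<Longrightarrow> 0 < e \<Longrightarrow> \<exists>N. \<forall>m\<ge>N. \<forall>n\<ge>N. fmat_seminorm (p l) (X m - X n) < e"
  have "\<exists>a. \<forall>l\<in>L. (\<lambda>k. p l (entry (X k) i j - a)) \<longlonglongrightarrow> 0" for i j
  proof (rule sequentially_complete)
    fix l and e :: real assume l: "l \<in> L" and e: "0 < e"
    interpret cstar_seminormed "p l" by (rule seminormed[OF l])
    obtain N where N: "\<And>m n. m \<ge> N \<Longrightarrow> n \<ge> N \<Longrightarrow> fmat_seminorm (p l) (X m - X n) < e"
      using cauchy[OF l e] by blast
    have "p l (entry (X m) i j - entry (X n) i j) < e" if "m \<ge> N" "n \<ge> N" for m n
      using entry_le_fmat_seminorm[of "X m - X n" i j] N[OF that] by simp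
    then show "\<exists>N. \<forall>m\<ge>N. \<forall>n\<ge>N. p l (entry (X m) i j - entry (X n) i j) < e" by blast
  qed
  then obtain a where a: "\<And>i j l. l \<in> L \<Longrightarrow> (\<lambda>k. p l (entry (X k) i j - a i j)) \<longlonglongrightarrow> 0" by metis
  define x where "x = Fmat (\<lambda>i j. if i < n \<and> j < n then a i j else 0)"
  have "supported n (\<lambda>i j. if i < n \<and> j < n then a i j else 0)" by (auto simp: supported_def)
  then have x: "entry x = (\<lambda>i j. if i < n \<and> j < n then a i j else 0)" "supported n (entry x)"
    by (simp_all add: x_def entry_Fmat)
  show "\<exists>x\<in>{x. supported n (entry x)}. \<forall>l\<in>L. (\<lambda>k. fmat_seminorm (p l) (X k - x)) \<longlonglongrightarrow> 0"
  proof (intro bexI[of _ x] ballI)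
    fix l assume l: "l \<in> L"
    interpret cstar_seminormed "p l" by (rule seminormed[OF l])
    interpret F: cstar_seminormed "fmat_seminorm (p l)"
      by unfold_locales (rule cstar_seminorm_fmat_seminorm)
    have "(\<lambda>k. \<Sum>i<n. \<Sum>j<n. p l (entry (X k) i j - a i j)) \<longlonglongrightarrow> (\<Sum>i<n. \<Sum>j<n. 0)"
      by (intro tendsto_sum a l)
    then have lim: "(\<lambda>k. \<Sum>i<n. \<Sum>j<n. p l (entry (X k) i j - a i j)) \<longlonglongrightarrow> 0" by simp
    show "(\<lambda>k. fmat_seminorm (p l) (X k - x)) \<longlonglongrightarrow> 0"
    proof (rule tendsto_sandwich[OF _ _ tendsto_const lim])
      have "fmat_seminorm (p l) (X k - x) \<le> (\<Sum>i<n. \<Sum>j<n. p l (entry (X k) i j - a i j))" for k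
      proof -
        have "supported n (entry (X k - x))" using X[of k] x(2) by (auto simp: supported_def)
        then show ?thesis by (rule order_trans[OF fmat_seminorm_le]) (simp add: x(1))
      qed
      then show "\<forall>\<^sub>F k in sequentially. fmat_seminorm (p l) (X k - x)
          \<le> (\<Sum>i<n. \<Sum>j<n. p l (entry (X k) i j - a i j))" by simp
    qed simp
  qed (use x in simp)
qed

end

section \<open>Matrices\<close>

definition fmat_of_mat :: "'a::complex_star_algebra mat \<Rightarrow> 'a fmat" where
  "fmat_of_mat x = Fmat (\<lambda>i j. if i < dim_row x \<and> j < dim_col x then x $$ (i, j) else 0)"

lemma entry_fmat_of_mat:
  "entry (fmat_of_mat x) i j = (if i < dim_row x \<and> j < dim_col x then x $$ (i, j) else 0)"
proof -
  have "supported (max (dim_row x) (dim_col x))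
      (\<lambda>i j. if i < dim_row x \<and> j < dim_col x then x $$ (i, j) else 0)"
    by (auto simp: supported_def)
  then show ?thesis by (simp add: fmat_of_mat_def entry_Fmat)
qed

lemma supported_fmat_of_mat: "x \<in> carrier_mat n n \<Longrightarrow> supported n (entry (fmat_of_mat x))"
  by (auto simp: supported_def entry_fmat_of_mat)

lemma fmat_of_mat_inject:
  assumes "x \<in> carrier_mat n n" "y \<in> carrier_mat n n" "fmat_of_mat x = fmat_of_mat y"
  shows "x = y"
proof (rule eq_matI)
  fix i j assume "i < dim_row y" "j < dim_col y"
  then show "x $$ (i, j) = y $$ (i, j)"
    using assms entry_fmat_of_mat[of x i j] entry_fmat_of_mat[of y i j] by simp
qed (use assms in auto)

lemma fmat_of_mat_surj:
  assumes "supported n (entry x)" obtains y where "y \<in> carrier_mat n n" "x = fmat_of_mat y"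
proof (rule that)
  show "mat n n (\<lambda>(i, j). entry x i j) \<in> carrier_mat n n" by simp
  show "x = fmat_of_mat (mat n n (\<lambda>(i, j). entry x i j))"
    using assms by (intro fmat_eqI) (auto simp: entry_fmat_of_mat supported_def not_less)
qed

lemma mat_star_carrier: "x \<in> carrier_mat n n \<Longrightarrow> mat_star x \<in> carrier_mat n n"
  by (simp add: mat_star_def)

lemma fmat_of_mat_hom:
  assumes "x \<in> carrier_mat n n" "y \<in> carrier_mat n n"
  shows "fmat_of_mat (x + y) = fmat_of_mat x + fmat_of_mat y"
    and "fmat_of_mat (x * y) = fmat_of_mat x * fmat_of_mat y"
    and "fmat_of_mat (mat_star x) = star (fmat_of_mat x)"
proof -
  show "fmat_of_mat (x + y) = fmat_of_mat x + fmat_of_mat y"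
    "fmat_of_mat (mat_star x) = star (fmat_of_mat x)"
    using assms by (auto intro!: fmat_eqI simp: entry_fmat_of_mat mat_star_def)
  show "fmat_of_mat (x * y) = fmat_of_mat x * fmat_of_mat y"
    using assms by (intro fmat_eqI)
      (auto simp: entry_times[OF supported_fmat_of_mat[OF assms(1)]] entry_fmat_of_mat scalar_prod_def
        atLeast0LessThan intro!: sum.cong)
qed

definition fmat_of_vec :: "'a::complex_star_algebra vec \<Rightarrow> 'a fmat" where
  "fmat_of_vec v = Fmat (\<lambda>i j. if i < dim_vec v \<and> j = 0 then v $ i else 0)"

lemma supported_vec:
  "supported (Suc (dim_vec v)) (\<lambda>i j. if i < dim_vec v \<and> j = 0 then v $ i else 0)"
  by (auto simp: supported_def)

lemma entry_fmat_of_vec: "entry (fmat_of_vec v) i j = (if i < dim_vec v \<and> j = 0 then v $ i else 0)"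
  using supported_vec[of v] by (simp add: fmat_of_vec_def entry_Fmat)

lemma fmat_of_vec_mult:
  assumes "x \<in> carrier_mat n n" "v \<in> carrier_vec n"
  shows "fmat_of_vec (x *\<^sub>v v) = fmat_of_mat x * fmat_of_vec v"
  using assms by (intro fmat_eqI)
    (auto simp: entry_times[OF supported_fmat_of_mat[OF assms(1)]] entry_fmat_of_vec entry_fmat_of_mat
      scalar_prod_def atLeast0LessThan intro!: sum.cong)

lemma vec_seminorm_eq_col_norm: "vec_seminorm p v = col_norm p (fmat_of_vec v)"
proof -
  have s: "supported (Suc (dim_vec v)) (entry (fmat_of_vec v))"
    using supported_vec[of v] by (simp add: fmat_of_vec_def entry_Fmat)
  have "col_inner (fmat_of_vec v) (fmat_of_vec v) = map_vec star v \<bullet> v"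
    by (simp add: col_inner_eq_sum[OF s] entry_fmat_of_vec scalar_prod_def atLeast0LessThan)
  then show ?thesis by (simp add: col_norm_def vec_seminorm_def)
qed

context cstar_seminormed
begin

lemma fmat_seminorm_eq_0_iff:
  assumes "x \<in> carrier_mat n n"
  shows "fmat_seminorm p (fmat_of_mat x) = 0 \<longleftrightarrow> (\<forall>i<n. \<forall>j<n. p (x $$ (i, j)) = 0)"
proof
  assume 0: "fmat_seminorm p (fmat_of_mat x) = 0"
  show "\<forall>i<n. \<forall>j<n. p (x $$ (i, j)) = 0"
  proof (intro allI impI)
    fix i j assume ij: "i < n" "j < n"
    show "p (x $$ (i, j)) = 0"
      using entry_le_fmat_seminorm[of "fmat_of_mat x" i j] assms 0 ij nonneg[of "x $$ (i, j)"]
      by (simp add: entry_fmat_of_mat)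
  qed
next
  assume "\<forall>i<n. \<forall>j<n. p (x $$ (i, j)) = 0"
  then have "(\<Sum>k<n. \<Sum>l<n. p (entry (fmat_of_mat x) k l)) = 0"
    using assms by (intro sum.neutral ballI) (simp add: entry_fmat_of_mat)
  then have "fmat_seminorm p (fmat_of_mat x) \<le> 0"
    using fmat_seminorm_le[OF supported_fmat_of_mat[OF assms]] by simp
  moreover have "0 \<le> fmat_seminorm p (fmat_of_mat x)"
    unfolding fmat_seminorm_def by (rule star_action.opnorm_nonneg[OF star_action_fmat])
  ultimately show "fmat_seminorm p (fmat_of_mat x) = 0" by simp
qed

text \<open>Boundedness of the set in the definition of \<^const>\<open>mat_seminorm\<close> has to be known in both
  directions, since the supremum of an unbounded set of reals is unspecified.\<close>

lemma mat_seminorm_eq_0_iff: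
  assumes x: "x \<in> carrier_mat n n"
  shows "mat_seminorm p n x = 0 \<longleftrightarrow> fmat_seminorm p (fmat_of_mat x) = 0"
proof -
  let ?V = "{v \<in> carrier_vec n. vec_seminorm p v \<le> 1}"
  have le: "vec_seminorm p (x *\<^sub>v v) \<le> fmat_seminorm p (fmat_of_mat x) * vec_seminorm p v"
    if "v \<in> carrier_vec n" for v
    unfolding vec_seminorm_eq_col_norm fmat_of_vec_mult[OF x that] fmat_seminorm_def
    by (rule star_action.act_le[OF star_action_fmat])
  have vs: "0 \<le> vec_seminorm p v" for v by (simp add: vec_seminorm_def)
  have F0: "0 \<le> fmat_seminorm p (fmat_of_mat x)"
    unfolding fmat_seminorm_def by (rule star_action.opnorm_nonneg[OF star_action_fmat])
  have le1: "vec_seminorm p (x *\<^sub>v v) \<le> fmat_seminorm p (fmat_of_mat x)" if v: "v \<in> ?V" for v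
    using le[of v] v mult_left_mono[of "vec_seminorm p v" 1, OF _ F0] by simp
  have bdd: "bdd_above ((\<lambda>v. vec_seminorm p (x *\<^sub>v v)) ` ?V)"
    using le1 by (intro bdd_aboveI2)
  show ?thesis
  proof
    assume 0: "mat_seminorm p n x = 0"
    have le0: "vec_seminorm p (x *\<^sub>v v) \<le> 0" if "v \<in> ?V" for v
      unfolding 0[symmetric] mat_seminorm_def using that bdd by (rule cSUP_upper)
    have "p (x $$ (i, j)) = 0" if ij: "i < n" "j < n" for i j
    proof (rule ccontr)
      assume nz: "p (x $$ (i, j)) \<noteq> 0"
      define a where "a = x $$ (i, j)"
      have a: "p a > 0" using nz nonneg[of a] by (simp add: a_def less_le)
      \<comment> \<open>The column with the normalized adjoint of \<open>a\<close> in row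
        \<open>j\<close> has seminorm \<open>1\<close>, and row \<open>i\<close> of its image has
        seminorm \<open>p a\<close>.\<close>
      define b where "b = complex_of_real (1 / p a) *\<^sub>C star a"
      define v where "v = vec n (\<lambda>k. if k = j then b else 0)"
      have v: "v \<in> carrier_vec n" by (simp add: v_def)
      have pb: "p b = 1" unfolding b_def scale norm_of_real using a by simp
      have "map_vec star v \<bullet> v = star b * b"
      proof -
        have "map_vec star v \<bullet> v = (\<Sum>k\<in>{0..<n}. if k = j then star b * b else 0)"
          unfolding scalar_prod_def by (rule sum.cong) (auto simp: v_def)
        then show ?thesis using ij by simp
      qed
      then have "vec_seminorm p v = 1" by (simp add: vec_seminorm_def cstar pb)
      then have 1: "vec_seminorm p (x *\<^sub>v v) \<le> 0" using v by (intro le0) simp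
      have "(x *\<^sub>v v) $ i = (\<Sum>k\<in>{0..<n}. if k = j then a * b else 0)"
        using x ij unfolding index_mult_mat_vec[of i x v, unfolded carrier_matD(1)[OF x], OF ij(1)] scalar_prod_def
        by (intro sum.cong) (auto simp: v_def a_def)
      then have "(x *\<^sub>v v) $ i = a * b" using ij by simp
      then have "p (a * b) \<le> vec_seminorm p (x *\<^sub>v v)"
        using entry_le_col_norm[of "fmat_of_vec (x *\<^sub>v v)" i] x ij
        by (simp add: vec_seminorm_eq_col_norm entry_fmat_of_vec)
      moreover have "p (a * b) = p a"
        unfolding b_def mult_scaleC_right scale norm_of_real cstar' using a by (simp add: power2_eq_square)
      ultimately show False using a 1 by simp
    qed
    then show "fmat_seminorm p (fmat_of_mat x) = 0" by (simp add: fmat_seminorm_eq_0_iff[OF x])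
  next
    assume 0: "fmat_seminorm p (fmat_of_mat x) = 0"
    have "vec_seminorm p (0\<^sub>v n) = 0" by (simp add: vec_seminorm_def scalar_prod_def)
    then have ne: "?V \<noteq> {}" by (auto intro: exI[of _ "0\<^sub>v n"])
    have "vec_seminorm p (x *\<^sub>v v) = 0" if "v \<in> ?V" for v
      using le1[OF that] vs[of "x *\<^sub>v v"] 0 by simp
    then have "mat_seminorm p n x = (SUP v\<in>?V. 0)"
      unfolding mat_seminorm_def by (intro SUP_cong) simp_all
    then show "mat_seminorm p n x = 0" using ne by simp
  qed
qed

lemma mat_zero_wrt_iff:
  "x \<in> carrier_mat n n \<Longrightarrow> mat_zero_wrt p n x \<longleftrightarrow> (\<forall>i<n. \<forall>j<n. p (x $$ (i, j)) = 0)"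
  by (simp add: mat_zero_wrt_def mat_seminorm_eq_0_iff fmat_seminorm_eq_0_iff)

lemma mat_positive_wrt_if_mat_positive:
  assumes "mat_positive n x" shows "mat_positive_wrt p n x"
proof -
  obtain b where b: "b \<in> carrier_mat n n" "x = mat_star b * b" using assms mat_positive_def by blast
  have "mat_zero_wrt p n (0\<^sub>m n n)" by (subst mat_zero_wrt_iff) auto
  then show ?thesis
    unfolding mat_positive_wrt_def mat_zero_wrt_def
    using b mat_star_carrier[OF b(1)] by (intro bexI[of _ b] bexI[of _ "0\<^sub>m n n"]) auto
qed

end

context locally_cstar_algebra
begin

text \<open>The factors \<open>b\<close> in the local decompositions depend on the index and do not
  fit together. They only show that the matrix is self-adjoint and positive for every seminorm; a
  single factor then comes from the self-adjoint root in the complete algebra.\<close>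

lemma mat_positive_if_locally:
  assumes x: "x \<in> carrier_mat n n" and pos: "\<And>l. l \<in> L \<Longrightarrow> mat_positive_wrt (p l) n x"
  shows "mat_positive n x"
proof -
  let ?M = "{x. supported n (entry x)}"
  interpret F: complete_star_subalgebra L "\<lambda>l. fmat_seminorm (p l)" ?M
    by (rule complete_star_subalgebra_fmat)
  define y where "y = fmat_of_mat x"
  have y: "y \<in> ?M" using supported_fmat_of_mat[OF x] by (simp add: y_def)
  have dec: "\<exists>b c. y = star b * b + c \<and> fmat_seminorm (p l) c = 0" if l: "l \<in> L" for l
  proof -
    interpret cstar_seminormed "p l" by (rule seminormed[OF l])
    obtain b c where bc: "b \<in> carrier_mat n n" "c \<in> carrier_mat n n" "x = mat_star b * b + c"
      "mat_seminorm (p l) n c = 0"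
      using pos[OF l] unfolding mat_positive_wrt_def by blast
    note b' = mat_star_carrier[OF bc(1)]
    have "y = star (fmat_of_mat b) * fmat_of_mat b + fmat_of_mat c"
      unfolding y_def bc(3) fmat_of_mat_hom(1)[OF mult_carrier_mat[OF b' bc(1)] bc(2)]
        fmat_of_mat_hom(2)[OF b' bc(1)] fmat_of_mat_hom(3)[OF bc(1) bc(1)] ..
    then show ?thesis using bc(4) mat_seminorm_eq_0_iff[OF bc(2)] by blast
  qed
  have "star y - y = 0"
  proof (rule F.separating)
    have "star y + (- 1) *\<^sub>C y \<in> ?M" by (intro F.add_closed F.star_closed F.scale_closed y)
    then show "star y - y \<in> ?M" by (simp add: scaleC_one)
    fix l assume l: "l \<in> L"
    interpret N: cstar_seminormed "fmat_seminorm (p l)" by (rule F.seminormed[OF l])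
    obtain b c where "y = star b * b + c" "fmat_seminorm (p l) c = 0" using dec[OF l] by blast
    then show "fmat_seminorm (p l) (star y - y) = 0"
      using N.triangle_diff[of "star c" c] N.nonneg[of "star c - c"] by (simp add: star_add star_mult)
  qed
  then have ys: "star y = y" by simp
  have "F.psd y" unfolding F.psd_def
  proof (intro conjI ballI ys)
    fix l assume l: "l \<in> L"
    interpret N: cstar_seminormed "fmat_seminorm (p l)" by (rule F.seminormed[OF l])
    interpret U: cstar_seminormed_1 "unit_seminorm (fmat_seminorm (p l))" by (rule N.unit_seminormed)
    obtain b c where bc: "y = star b * b + c" "fmat_seminorm (p l) c = 0" using dec[OF l] by blast
    show "U.pos (embed y)"
    proof (rule U.pos_null)
      show "star (embed y) = embed y" by (simp add: ys flip: embed_hom)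
      show "U.pos (embed (star b * b))" by (rule N.pos_embed_square)
      have "embed y - embed (star b * b) = embed c" by (simp add: bc(1) flip: embed_hom)
      then show "unit_seminorm (fmat_seminorm (p l)) (embed y - embed (star b * b)) = 0"
        by (simp add: bc(2))
    qed
  qed
  then obtain b where b: "b \<in> ?M" "F.psd b" "b * b = y" using F.ex_psd_sqrt y by metis
  obtain c where c: "c \<in> carrier_mat n n" "b = fmat_of_mat c" using fmat_of_mat_surj b(1) by blast
  note c' = mat_star_carrier[OF c(1)]
  have "star b = b" using b(2) by (simp add: F.psd_def)
  then have "fmat_of_mat (mat_star c * c) = fmat_of_mat x"
    unfolding fmat_of_mat_hom(2)[OF c' c(1)] fmat_of_mat_hom(3)[OF c(1) c(1)] c(2)[symmetric]
    using b(3) by (simp add: y_def)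
  then have "mat_star c * c = x" by (rule fmat_of_mat_inject[OF mult_carrier_mat[OF c' c(1)] x])
  then show ?thesis using c(1) by (auto simp: mat_positive_def)
qed

section \<open>Automatic continuity of positive maps\<close>

text \<open>The series is summed in the domain only. In the target the image of the sum is compared
  with the image of each single term, by monotonicity of \<open>r\<close> on positive elements
  modulo null elements.\<close>

lemma positive_map_bounded_on_psd:
  fixes f :: "'a \<Rightarrow> 'b::complex_star_algebra"
  assumes r: "cstar_seminorm r"
    and add: "\<And>a b. f (a + b) = f a + f b" and scale: "\<And>c a. f (c *\<^sub>C a) = c *\<^sub>C f a"
    and l: "l \<in> L" and null: "\<And>a. p l a = 0 \<Longrightarrow> r (f a) = 0"
    and pos: "\<And>b. \<exists>e c. f (star b * b) = star e * e + c \<and> r c = 0"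
  shows "\<exists>C. \<forall>a. complete.psd a \<and> p l a \<le> 1 \<longrightarrow> r (f a) \<le> C"
proof (rule ccontr)
  interpret r: cstar_seminormed r by unfold_locales (rule r)
  interpret U: cstar_seminormed_1 "unit_seminorm r" by (rule r.unit_seminormed)
  interpret pl: cstar_seminormed "p l" by (rule seminormed[OF l])
  have f_diff: "f (a - b) = f a - f b" for a b using add[of "a - b" b] by simp
  have dec: "\<exists>e c. f a = star e * e + c \<and> r c = 0" if psd: "complete.psd a" for a
  proof -
    obtain b where "b * b = a" "complete.psd b" using complete.ex_psd_sqrt[OF psd UNIV_I] by blast
    then show ?thesis using pos[of b] by (simp add: complete.psd_def)
  qed
  have mono: "r (f a) \<le> r (f b)" if a: "complete.psd a" and ba: "complete.psd (b - a)" for a b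
  proof -
    obtain e c e' c' where 1: "f a = star e * e + c" "r c = 0"
      and 2: "f (b - a) = star e' * e' + c'" "r c' = 0"
      using dec[OF a] dec[OF ba] by blast
    have "f b = f a + f (b - a)" by (simp add: f_diff)
    then have "f b - (star e * e + star e' * e') = c + c'" by (simp add: 1 2)
    then have b: "r (f b) = r (star e * e + star e' * e')"
      using r.triangle[of c c'] r.nonneg[of "c + c'"] 1 2 by (intro r.eq_mod_null) simp
    have "r (f a) = r (star e * e)" using 1 by (intro r.eq_mod_null) simp
    also have "\<dots> \<le> r (star e * e + star e' * e')"
      using U.mono[OF r.pos_embed_square[of e] r.pos_embed_square[of e']]
      by (simp flip: embed_hom(1))
    finally show ?thesis by (simp add: b)
  qed
  assume "\<nexists>C. \<forall>a. complete.psd a \<and> p l a \<le> 1 \<longrightarrow> r (f a) \<le> C"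
  \<comment> \<open>Images beyond \<open>4 ^ k\<close> leave room for the weights
    \<open>(1/2) ^ k\<close>: the weights are summable, and the weighted images still exceed
    \<open>2 ^ k\<close>.\<close>
  then have "\<exists>a. complete.psd a \<and> p l a \<le> 1 \<and> r (f a) > 4 ^ k" for k :: nat
    by (meson not_le)
  then obtain a where a: "\<And>k. complete.psd (a k)" "\<And>k. p l (a k) \<le> 1" "\<And>k::nat. r (f (a k)) > 4 ^ k"
    by metis
  have "\<exists>b. complete.psd b \<and> (\<forall>m\<in>L. p m b \<le> 1) \<and> p l (b - a k) = 0" for k
    using complete.ex_truncation[OF a(1) UNIV_I l a(2)] by metis
  then obtain u where u: "\<And>k. complete.psd (u k)" "\<And>k m. m \<in> L \<Longrightarrow> p m (u k) \<le> 1"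
    "\<And>k. p l (u k - a k) = 0" by metis
  \<comment> \<open>Truncation changes \<open>a k\<close> by a \<open>p l\<close>-null element,
    which \<open>null\<close> sends to an \<open>r\<close>-null one, so the size of the image
    survives.\<close>
  have fu: "r (f (u k)) > 4 ^ k" for k
    using a(3)[of k] null[OF u(3)[of k]] r.eq_mod_null[of "f (u k)" "f (a k)"] by (simp add: f_diff)
  define v where "v k = complex_of_real ((1/2) ^ k) *\<^sub>C u k" for k
  have v: "complete.psd (v k)" for k unfolding v_def by (intro complete.psd_scale u) simp
  define S where "S n = (\<Sum>k<n. v k)" for n
  have tail: "p m (S (n + j) - S n) \<le> 2 * (1/2) ^ n * (1 - (1/2) ^ j)" if m: "m \<in> L" for m n j
  proof (induction j)
    case (Suc j)
    interpret cstar_seminormed "p m" by (rule seminormed[OF m])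
    have "p m (v (n + j)) = (1/2) ^ (n + j) * p m (u (n + j))"
      unfolding v_def cstar_seminormed.scale[OF seminormed[OF m]] norm_of_real by simp
    also have "\<dots> \<le> (1/2) ^ (n + j)" using u(2)[OF m] by (simp add: mult_left_le)
    finally have "p m (S (n + Suc j) - S n) \<le> 2 * (1/2) ^ n * (1 - (1/2) ^ j) + (1/2) ^ (n + j)"
      using triangle[of "S (n + j) - S n" "v (n + j)"] Suc by (simp add: S_def algebra_simps)
    also have "\<dots> = 2 * (1/2) ^ n * (1 - (1/2) ^ Suc j)" by (simp add: power_add algebra_simps)
    finally show ?case .
  next
    case 0
    interpret cstar_seminormed "p m" by (rule seminormed[OF m])
    show ?case by simp
  qed
  have "\<exists>x. \<forall>m\<in>L. (\<lambda>n. p m (S n - x)) \<longlonglongrightarrow> 0"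
  proof (rule sequentially_complete)
    fix m and e :: real assume m: "m \<in> L" and e: "e > 0"
    interpret cstar_seminormed "p m" by (rule seminormed[OF m])
    obtain N where N: "(1/2::real) ^ N < e / 4" using real_arch_pow_inv[of "e/4" "1/2"] e by auto
    have half: "p m (S i - S N) < e / 2" if "i \<ge> N" for i
    proof -
      have "p m (S i - S N) \<le> 2 * (1/2) ^ N * (1 - (1/2) ^ (i - N))"
        using tail[OF m, of N "i - N"] that by simp
      also have "\<dots> \<le> 2 * (1/2) ^ N" by (intro mult_left_le) (simp_all add: power_le_one)
      finally show ?thesis using N by simp
    qed
    have "p m (S i - S j) < e" if "i \<ge> N" "j \<ge> N" for i j
      using triangle_diff[of "S i - S N" "S j - S N"] half[OF that(1)] half[OF that(2)] by simp
    then show "\<exists>N. \<forall>i\<ge>N. \<forall>j\<ge>N. p m (S i - S j) < e" by blast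
  qed
  then obtain s where s: "\<And>m. m \<in> L \<Longrightarrow> (\<lambda>n. p m (S n - s)) \<longlonglongrightarrow> 0" by blast
  \<comment> \<open>The sum dominates each term: \<open>s - v k\<close> is a limit of partial sums
    with term \<open>k\<close> removed. The shift by \<open>Suc k\<close> ensures that term
    \<open>k\<close> is present in all of them.\<close>
  have sv: "complete.psd (s - v k)" for k
  proof (rule complete.psd_limit)
    fix n
    have "S (n + Suc k) - v k = (\<Sum>j\<in>{..<n + Suc k} - {k}. v j)"
      unfolding S_def by (subst sum.remove[of _ k]) simp_all
    then show "complete.psd (S (n + Suc k) - v k)" by (simp only:) (intro complete.psd_sum v)
  next
    fix m assume m: "m \<in> L"
    show "(\<lambda>n. p m (S (n + Suc k) - v k - (s - v k))) \<longlonglongrightarrow> 0"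
      using LIMSEQ_ignore_initial_segment[OF s[OF m], of "Suc k"] by (simp del: add_Suc_right)
  qed simp_all
  have "2 ^ k < r (f s)" for k
  proof -
    have "2 ^ k = (1/2) ^ k * (4::real) ^ k" by (simp flip: power_mult_distrib)
    also have "\<dots> < (1/2) ^ k * r (f (u k))" using fu[of k] by simp
    also have "\<dots> = r (f (v k))" unfolding v_def scale r.scale norm_of_real by simp
    also have "\<dots> \<le> r (f s)" by (rule mono[OF v sv])
    finally show ?thesis .
  qed
  moreover obtain k where "r (f s) < 2 ^ k" using real_arch_pow[of 2 "r (f s)"] by auto
  ultimately show False by (metis less_asym)
qed

text \<open>Splitting into real and imaginary parts and each of these into positive and negative
  parts yields four positive elements with no larger \<open>p l\<close>, hence the factor
  \<open>4\<close>. Homogeneity extends the bound from the unit ball, except where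
  \<open>p l a = 0\<close>; there \<open>null\<close> applies.\<close>

lemma positive_map_bounded:
  fixes f :: "'a \<Rightarrow> 'b::complex_star_algebra"
  assumes r: "cstar_seminorm r"
    and add: "\<And>a b. f (a + b) = f a + f b" and scale: "\<And>c a. f (c *\<^sub>C a) = c *\<^sub>C f a"
    and l: "l \<in> L" and null: "\<And>a. p l a = 0 \<Longrightarrow> r (f a) = 0"
    and pos: "\<And>b. \<exists>e c. f (star b * b) = star e * e + c \<and> r c = 0"
  shows "\<exists>C\<ge>0. \<forall>a. r (f a) \<le> C * p l a"
proof -
  interpret r: cstar_seminormed r by unfold_locales (rule r)
  interpret pl: cstar_seminormed "p l" by (rule seminormed[OF l])
  obtain C where C: "\<And>a. complete.psd a \<Longrightarrow> p l a \<le> 1 \<Longrightarrow> r (f a) \<le> C"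
    using positive_map_bounded_on_psd[OF assms] by blast
  have f_diff: "f (a - b) = f a - f b" for a b using add[of "a - b" b] by simp
  have sa: "r (f a) \<le> 2 * C" if a: "star a = a" "p l a \<le> 1" for a
  proof -
    obtain b c where bc: "complete.psd b" "complete.psd c" "a = b - c" "p l b \<le> p l a" "p l c \<le> p l a"
      using complete.ex_psd_parts[OF UNIV_I a(1)] l by metis
    then show ?thesis
      using C[of b] C[of c] r.triangle_diff[of "f b" "f c"] a(2) by (simp add: f_diff)
  qed
  have unit: "r (f a) \<le> 4 * C" if "p l a \<le> 1" for a
  proof -
    define h where "h = (1/2) *\<^sub>C (a + star a)"
    define k where "k = (- \<i> / 2) *\<^sub>C (a - star a)"
    have "star h = h" "star k = k"
      by (simp_all add: h_def k_def star_scaleC star_add star_diff add.commute flip: scaleC_minus_right)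
    moreover have "p l h \<le> 1" "p l k \<le> 1"
      using that pl.triangle[of a "star a"] pl.triangle_diff[of a "star a"]
      by (simp_all add: h_def k_def pl.scale norm_divide)
    ultimately have "r (f h) \<le> 2 * C" "r (f k) \<le> 2 * C" by (simp_all add: sa)
    moreover have "a = h + \<i> *\<^sub>C k"
    proof -
      have "h + \<i> *\<^sub>C k = (1/2) *\<^sub>C (a + a)"
        by (simp add: h_def k_def scaleC_scaleC flip: scaleC_add_right)
      also have "\<dots> = (1/2 + 1/2) *\<^sub>C a" by (simp only: scaleC_add_right scaleC_add_left)
      finally show ?thesis by (simp add: scaleC_one)
    qed
    ultimately show ?thesis
      using r.triangle[of "f h" "\<i> *\<^sub>C f k"] by (simp add: add scale r.scale)
  qed
  have C0: "0 \<le> 4 * C" by (rule order_trans[OF r.nonneg[of "f 0"] unit[of 0]]) simp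
  have "r (f a) \<le> 4 * C * p l a" for a
  proof (cases "p l a = 0")
    case True then show ?thesis by (simp add: null)
  next
    case False
    then have a: "p l a > 0" using pl.nonneg[of a] by linarith
    let ?b = "complex_of_real (1 / p l a) *\<^sub>C a"
    have "r (f ?b) \<le> 4 * C" by (rule unit) (use a in \<open>simp only: pl.scale norm_of_real, simp\<close>)
    moreover have "r (f ?b) = r (f a) / p l a"
      unfolding scale r.scale norm_of_real using a by simp
    ultimately show ?thesis using a by (simp add: divide_le_eq)
  qed
  then show ?thesis using C0 by blast
qed

end

section \<open>Continuity in terms of seminorms, and the equivalence\<close>

lemma continuous_on_iff_seminorms:
  assumes "locally_cstar_algebra L p" "locally_cstar_algebra D q"
  shows "continuous_on UNIV f \<longleftrightarrow>
    (\<forall>x. \<forall>d\<in>D. \<forall>e>0. \<exists>l\<in>L. \<exists>c>0. \<forall>y. p l (x - y) < c \<longrightarrow> q d (f x - f y) < e)"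
proof -
  interpret A: locally_cstar_algebra L p by fact
  interpret B: locally_cstar_algebra D q by fact
  have "continuous_on UNIV f \<longleftrightarrow> (\<forall>x. filterlim f (nhds (f x)) (nhds x))"
    by (simp add: continuous_on_eq_continuous_at continuous_at tendsto_at_iff_tendsto_nhds)
  also have "\<dots> \<longleftrightarrow> (\<forall>x P. eventually P (nhds (f x)) \<longrightarrow> eventually (\<lambda>y. P (f y)) (nhds x))"
    by (simp add: filterlim_iff)
  also have "\<dots> \<longleftrightarrow> (\<forall>x. \<forall>d\<in>D. \<forall>e>0. eventually (\<lambda>y. q d (f x - f y) < e) (nhds x))"
  proof (intro iffI allI ballI impI)
    fix x d and e :: real
    assume *: "\<forall>x P. eventually P (nhds (f x)) \<longrightarrow> eventually (\<lambda>y. P (f y)) (nhds x)" "d \<in> D" "e > 0"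
    then have "eventually (\<lambda>z. q d (f x - z) < e) (nhds (f x))"
      unfolding eventually_nhds_uniformity B.eventually_uniformity_iff by auto
    then show "eventually (\<lambda>y. q d (f x - f y) < e) (nhds x)" using *(1) by blast
  next
    fix x P
    assume *: "\<forall>x. \<forall>d\<in>D. \<forall>e>0. eventually (\<lambda>y. q d (f x - f y) < e) (nhds x)"
      and "eventually P (nhds (f x))"
    then obtain d e where d: "d \<in> D" "e > 0" "\<And>z. q d (f x - z) < e \<Longrightarrow> P z"
      unfolding eventually_nhds_uniformity B.eventually_uniformity_iff by auto
    then have "eventually (\<lambda>y. q d (f x - f y) < e) (nhds x)" using * by blast
    then show "eventually (\<lambda>y. P (f y)) (nhds x)" by eventually_elim (rule d(3))
  qed
  finally have iff: "continuous_on UNIV f \<longleftrightarrow>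
    (\<forall>x. \<forall>d\<in>D. \<forall>e>0. eventually (\<lambda>y. q d (f x - f y) < e) (nhds x))" .
  have "eventually Q (nhds x) \<longleftrightarrow> (\<exists>l\<in>L. \<exists>c>0. \<forall>y. p l (x - y) < c \<longrightarrow> Q y)" for Q x
    unfolding eventually_nhds_uniformity A.eventually_uniformity_iff by auto
  then show ?thesis unfolding iff by simp
qed

theorem proposition3p3:
  fixes L :: "'l set"
    and p :: "'l \<Rightarrow> 'a::{complex_star_algebra, uniform_space, t2_space} \<Rightarrow> real"
    and D :: "'d set"
    and q :: "'d \<Rightarrow> 'b::{complex_star_algebra, uniform_space, t2_space} \<Rightarrow> real"
    and \<phi> :: "'a \<Rightarrow> 'b"
  assumes "locally_cstar_algebra L p"
    and "locally_cstar_algebra D q"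
    and "Vector_Spaces.linear scaleC scaleC \<phi>"
  shows "local_completely_positive L p D q \<phi> \<longleftrightarrow>
         continuous_on UNIV \<phi> \<and> completely_positive \<phi>"
proof -
  interpret A: locally_cstar_algebra L p by fact
  interpret B: locally_cstar_algebra D q by fact
  have add: "\<phi> (a + b) = \<phi> a + \<phi> b" and scale: "\<phi> (c *\<^sub>C a) = c *\<^sub>C \<phi> a" for a b c
    using assms(3) by (simp_all add: Vector_Spaces.linear_iff)
  have diff: "\<phi> (a - b) = \<phi> a - \<phi> b" for a b using add[of "a - b" b] by simp
  have zero: "\<phi> 0 = 0" using diff[of 0 0] by simp
  show ?thesis
  proof
    assume lcp: "local_completely_positive L p D q \<phi>"
    have "continuous_on UNIV \<phi>"
      unfolding continuous_on_iff_seminorms[OF assms(1,2)]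
    proof (intro allI ballI impI)
      fix x d and e :: real assume d: "d \<in> D" and e: "e > 0"
      interpret q: cstar_seminormed "q d" by (rule B.seminormed[OF d])
      obtain l where l: "l \<in> L"
        and pos: "\<And>n x. n \<ge> 1 \<Longrightarrow> x \<in> carrier_mat n n \<Longrightarrow> mat_positive_wrt (p l) n x \<Longrightarrow>
            mat_positive_wrt (q d) n (map_mat \<phi> x)"
        and null: "\<And>n x. n \<ge> 1 \<Longrightarrow> x \<in> carrier_mat n n \<Longrightarrow> mat_zero_wrt (p l) n x \<Longrightarrow>
            mat_zero_wrt (q d) n (map_mat \<phi> x)"
        using lcp d unfolding local_completely_positive_def by metis
      interpret p: cstar_seminormed "p l" by (rule A.seminormed[OF l])
      have null1: "q d (\<phi> a) = 0" if "p l a = 0" for a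
      proof -
        have "mat_zero_wrt (q d) 1 (map_mat \<phi> (mat 1 1 (\<lambda>_. a)))"
          by (rule null) (simp_all add: p.mat_zero_wrt_iff that)
        then show ?thesis by (simp add: q.mat_zero_wrt_iff)
      qed
      have pos1: "\<exists>e c. \<phi> (star b * b) = star e * e + c \<and> q d c = 0" for b
      proof -
        have eq: "mat_star (mat 1 1 (\<lambda>_. b)) * mat 1 1 (\<lambda>_. b) = mat 1 1 (\<lambda>_. star b * b)"
          by (rule eq_matI) (auto simp: mat_star_def scalar_prod_def)
        have "mat_positive 1 (mat 1 1 (\<lambda>_. star b * b))"
          unfolding mat_positive_def using eq[symmetric] by (intro bexI[of _ "mat 1 1 (\<lambda>_. b)"]) simp_all
        then have "mat_positive_wrt (q d) 1 (map_mat \<phi> (mat 1 1 (\<lambda>_. star b * b)))"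
          by (intro pos p.mat_positive_wrt_if_mat_positive) simp_all
        then obtain e c where ec: "e \<in> carrier_mat 1 1" "c \<in> carrier_mat 1 1"
          "map_mat \<phi> (mat 1 1 (\<lambda>_. star b * b)) = mat_star e * e + c" "mat_seminorm (q d) 1 c = 0"
          unfolding mat_positive_wrt_def by blast
        have "\<phi> (star b * b) = star (e $$ (0, 0)) * e $$ (0, 0) + c $$ (0, 0)"
          using arg_cong[OF ec(3), of "\<lambda>x. x $$ (0, 0)"] ec(1,2) by (simp add: mat_star_def scalar_prod_def)
        moreover have "q d (c $$ (0, 0)) = 0"
          using ec(4) q.mat_zero_wrt_iff[OF ec(2)] by (simp add: mat_zero_wrt_def)
        ultimately show ?thesis by blast
      qed
      obtain C where C: "C \<ge> 0" "\<And>a. q d (\<phi> a) \<le> C * p l a"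
        using A.positive_map_bounded[OF B.seminorms[OF d] add scale l null1 pos1] by blast
      \<comment> \<open>The radius uses \<open>C + 1\<close> because \<open>C\<close> may be
        \<open>0\<close>; it also makes the last inequality strict.\<close>
      have "q d (\<phi> x - \<phi> y) < e" if "p l (x - y) < e / (C + 1)" for y
      proof -
        have "q d (\<phi> x - \<phi> y) \<le> C * p l (x - y)" using C(2)[of "x - y"] by (simp add: diff)
        also have "\<dots> \<le> C * (e / (C + 1))" using that C(1) by (intro mult_left_mono) simp_all
        also have "\<dots> < e" using C(1) e by (simp add: field_simps)
        finally show ?thesis .
      qed
      then show "\<exists>l\<in>L. \<exists>c>0. \<forall>y. p l (x - y) < c \<longrightarrow> q d (\<phi> x - \<phi> y) < e"
        using l e C(1) by (intro bexI[of _ l] exI[of _ "e / (C + 1)"]) simp_all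
    qed
    moreover have "completely_positive \<phi>"
      unfolding completely_positive_def
    proof (intro allI ballI impI)
      fix n :: nat and x :: "'a mat"
      assume n: "1 \<le> n" and x: "x \<in> carrier_mat n n" "mat_positive n x"
      show "mat_positive n (map_mat \<phi> x)"
      proof (rule B.mat_positive_if_locally)
        show "map_mat \<phi> x \<in> carrier_mat n n" using x by simp
        fix d assume "d \<in> D"
        then obtain l where l: "l \<in> L" "mat_positive_wrt (p l) n x \<Longrightarrow> mat_positive_wrt (q d) n (map_mat \<phi> x)"
          using lcp n x unfolding local_completely_positive_def by blast
        interpret p: cstar_seminormed "p l" by (rule A.seminormed[OF l(1)])
        show "mat_positive_wrt (q d) n (map_mat \<phi> x)"
          using l(2) p.mat_positive_wrt_if_mat_positive[OF x(2)] by blast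
      qed
    qed
    ultimately show "continuous_on UNIV \<phi> \<and> completely_positive \<phi>" by blast
  next
    assume *: "continuous_on UNIV \<phi> \<and> completely_positive \<phi>"
    show "local_completely_positive L p D q \<phi>"
      unfolding local_completely_positive_def
    proof (intro ballI)
      fix d assume d: "d \<in> D"
      interpret q: cstar_seminormed "q d" by (rule B.seminormed[OF d])
      \<comment> \<open>The index comes from continuity at \<open>0\<close> with tolerance
        \<open>1\<close>, so it depends on \<open>d\<close> alone and is available for all matrix
        sizes.\<close>
      have "\<exists>l\<in>L. \<exists>c>0. \<forall>y. p l (0 - y) < c \<longrightarrow> q d (\<phi> 0 - \<phi> y) < 1"
        using bspec[OF spec[OF *[THEN conjunct1, unfolded continuous_on_iff_seminorms[OF assms(1,2)]], of 0] d]
        by simp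
      then obtain l c where l: "l \<in> L" "c > 0" "\<And>y. p l (0 - y) < c \<Longrightarrow> q d (\<phi> 0 - \<phi> y) < 1"
        by blast
      interpret p: cstar_seminormed "p l" by (rule A.seminormed[OF l(1)])
      \<comment> \<open>All multiples of a \<open>p l\<close>-null element lie in the ball whose
        image stays below \<open>1\<close>, whereas a suitable multiple would have an image of
        seminorm exactly \<open>1\<close>.\<close>
      have null: "q d (\<phi> a) = 0" if a: "p l a = 0" for a
      proof (rule ccontr)
        assume "q d (\<phi> a) \<noteq> 0"
        then have pos: "q d (\<phi> a) > 0" using q.nonneg[of "\<phi> a"] by linarith
        let ?b = "complex_of_real (1 / q d (\<phi> a)) *\<^sub>C a"
        have "q d (\<phi> ?b) < 1" using l(2) l(3)[of ?b] by (simp add: zero p.scale a)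
        moreover have "q d (\<phi> ?b) = 1" unfolding scale q.scale norm_of_real using pos by simp
        ultimately show False by simp
      qed
      \<comment> \<open>Being null is an entrywise condition on both sides, so the statement for
        elements passes to every size with the same index.\<close>
      have null_mat: "mat_zero_wrt (q d) n (map_mat \<phi> x)"
        if "x \<in> carrier_mat n n" "mat_zero_wrt (p l) n x" for n x
        using that null by (auto simp: p.mat_zero_wrt_iff q.mat_zero_wrt_iff)
      have "mat_positive_wrt (q d) n (map_mat \<phi> x)"
        if n: "n \<ge> 1" and x: "x \<in> carrier_mat n n" "mat_positive_wrt (p l) n x" for n x
      proof -
        obtain b c where bc: "b \<in> carrier_mat n n" "c \<in> carrier_mat n n" "x = mat_star b * b + c"
          "mat_zero_wrt (p l) n c"
          using x(2) unfolding mat_positive_wrt_def mat_zero_wrt_def by blast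
        have b2: "mat_star b * b \<in> carrier_mat n n" using mat_star_carrier[OF bc(1)] bc(1) by simp
        have "mat_positive n (map_mat \<phi> (mat_star b * b))"
          using * n b2 bc(1) unfolding completely_positive_def mat_positive_def by blast
        then obtain e where e: "e \<in> carrier_mat n n" "map_mat \<phi> (mat_star b * b) = mat_star e * e"
          unfolding mat_positive_def by blast
        have "map_mat \<phi> (y + c) = map_mat \<phi> y + map_mat \<phi> c" if "y \<in> carrier_mat n n" for y
          using that bc(2) by (intro eq_matI) (auto simp: add)
        then have "map_mat \<phi> x = map_mat \<phi> (mat_star b * b) + map_mat \<phi> c"
          unfolding bc(3) using b2 .
        then have "map_mat \<phi> x = mat_star e * e + map_mat \<phi> c" by (simp add: e(2))
        moreover have "mat_seminorm (q d) n (map_mat \<phi> c) = 0"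
          using null_mat[OF bc(2,4)] by (simp add: mat_zero_wrt_def)
        moreover have "map_mat \<phi> c \<in> carrier_mat n n" using bc(2) by simp
        ultimately show ?thesis unfolding mat_positive_wrt_def using e(1) by blast
      qed
      then show "\<exists>l\<in>L. \<forall>n\<ge>1. \<forall>x\<in>carrier_mat n n.
          (mat_positive_wrt (p l) n x \<longrightarrow> mat_positive_wrt (q d) n (map_mat \<phi> x)) \<and>
          (mat_zero_wrt (p l) n x \<longrightarrow> mat_zero_wrt (q d) n (map_mat \<phi> x))"
        using l(1) null_mat by blast
    qed
  qed
qed

end
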